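(* Let $f_j:\mathbb C^{n_j}\to\mathbb C$, $1\le j\le m$, be entire functions of class $\mathscr C$, and let $P$, $Q$ be holomorphic polynomial automorphisms of $\mathbb C^{n_1+\cdots+n_m}$ and $\mathbb C^m$, respectively. Then the graph $\Gamma_{F_{P,Q}}\subset\mathbb C^{n_1+\cdots+n_m+m}$ of the map $F_{P,Q}:=Q\circ(f_1\times\cdots\times f_m)\circ P:\mathbb C^{n_1+\cdots+n_m}\to\mathbb C^m$ admits the Bernstein type inequality of exponent $\mu(k):=k^{2+\varepsilon(k)}$, $k\in\mathbb Z_+$, where $\varepsilon=0$ if all $\rho_{f_j}<\infty$, and $\varepsilon:\mathbb Z_+\to\mathbb R_+$ is some function decreasing to $0$ if one of the $\rho_{f_j}$ is $\infty$. Moreover, if all $n_j=1$ and all $\rho_{f_j}<\infty$, then $k\mapsto k^2$ is an optimal exponent for $\Gamma_{F_{P,Q}}$.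
   Context: $\mathbb Z_+=\{0,1,2,\dots\}$, $\mathbb R_+=[0,\infty)$; $\|\cdot\|$ is the Euclidean norm; $\mathbb B^n_r\subset\mathbb C^n$ is the open Euclidean ball of radius $r$ centered at $0$. For an entire function $f$ on $\mathbb C^n$: $M_f(r):=\sup_{\mathbb B^n_r}|f|$, $m_f(r):=\ln M_f(r)$, the order is $\rho_f:=\limsup_{r\to\infty}\frac{\ln m_f(r)}{\ln r}$, and $\phi_f(t):=m_f(e^t)$, $t\in\mathbb R$ (a convex increasing function for nonconstant $f$). Class $\mathscr C$ consists of the nonpolynomial entire functions $f$ satisfying one of the following: (I) $\rho_f<\infty$ and $\limsup_{t\to\infty}\frac{\phi_f(t+1)-\phi_f(t)}{\phi_f(t)-\phi_f(t-1)}<\infty$; (II) $\rho_f=\infty$ and $\lim_{t\to\infty}t^2\left(\frac1{\ln\psi(t)}\right)'=0$ (limit over the points where $\psi'$ exists) for some convex increasing $\psi\in C(\mathbb R)$ with $\lim_{t\to\infty}\frac{\ln\psi(t)}{\ln\phi_f(t)}=1$. $(f_1\times\cdots\times f_m)(z_1,\dots,z_m):=(f_1(z_1),\dots,f_m(z_m))$, $z_j\in\mathbb C^{n_j}$. A holomorphic polynomial automorphism of $\mathbb C^N$ is a bijective polynomial map with polynomial inverse. The graph $\Gamma_F=\{(z,F(z))\}\subset\mathbb C^{n+m}$ of a holomorphic map $F:\mathbb C^n\to\mathbb C^m$ admits the Bernstein type inequality of exponent $\mu:\mathbb Z_+\to\mathbb R_+$ if for each $r>0$ there is a nonnegative constant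 $C(r)$ such that for all holomorphic polynomials $p$ on $\mathbb C^{n+m}$, $\max_{\|z\|\le er}|p(z,F(z))|\le C(r)^{\mu(\deg p)}\max_{\|z\|\le r}|p(z,F(z))|$. Write $\langle\mu_1\rangle\le\langle\mu_2\rangle$ if $\mu_1\le c\,\mu_2$ on $\mathbb Z_+$ for some $c>0$, where $\langle\mu\rangle$ is the class of $\mu$ under the equivalence $\frac1c\mu_1\le\mu_2\le c\mu_1$ for some $c>0$. An exponent $\mu_o$ is optimal for $\Gamma_F$ if $\langle\mu_o\rangle$ is the minimal element of the set of classes $\langle\mu\rangle$ such that $\Gamma_F$ admits the Bernstein type inequality of exponent $\mu$; in other words, $\Gamma_F$ admits the inequality of exponent $\mu_o$ and does not admit such an inequality of any exponent $\mu$ with $\mu\le c\mu_o$ for some $c>0$ and $\limsup_{k\to\infty}\mu_o(k)/\mu(k)=\infty$. *)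

theory Defs
  imports
    "HOL-Analysis.Analysis"
    "HOL-Library.Poly_Mapping"
    "Jordan_Normal_Form.Matrix"
begin

text \<open>
  The space \<open>C^n\<close> is \<^term>\<open>carrier_vec n\<close> (vectors of variable length \<open>n\<close>, coordinates numbered
  from \<open>0\<close>), so that the dimensions \<open>n_1, \<dots>, n_m\<close> may depend on an index. Maps between such spaces
  are HOL functions of which only the values on the carrier matter.
\<close>

type_synonym cvec = "complex Matrix.vec"

definition euclid_norm :: "cvec \<Rightarrow> real" where
  "euclid_norm z = L2_set (\<lambda>i. cmod (Matrix.vec_index z i)) {..<dim_vec z}"

text \<open>Complex Frechet differentiability at every point; \<open>a\<close> is the complex gradient.\<close>

definition entire :: "nat \<Rightarrow> (cvec \<Rightarrow> complex) \<Rightarrow> bool" where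
  "entire n f \<longleftrightarrow>
    (\<forall>z\<in>carrier_vec n. \<exists>a\<in>carrier_vec n. \<forall>\<epsilon>>0. \<exists>\<delta>>0. \<forall>h\<in>carrier_vec n. euclid_norm h < \<delta> \<longrightarrow>
       cmod (f (z + h) - f z - (\<Sum>i<n. Matrix.vec_index a i * Matrix.vec_index h i))
         \<le> \<epsilon> * euclid_norm h)"


text \<open>
  Polynomials in \<open>z_0, \<dots>, z_(n-1)\<close> are finitely supported coefficient families indexed by finitely
  supported multi-exponents in which only the variables below \<open>n\<close> occur.
  The zero polynomial gets degree \<open>0\<close>.
\<close>

type_synonym cpoly = "(nat \<Rightarrow>\<^sub>0 nat) \<Rightarrow>\<^sub>0 complex"

definition polys :: "nat \<Rightarrow> cpoly set" where
  "polys n = {p. \<forall>\<alpha>\<in>Poly_Mapping.keys p. Poly_Mapping.keys \<alpha> \<subseteq> {..<n}}"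

definition poly_value :: "cpoly \<Rightarrow> cvec \<Rightarrow> complex" where
  "poly_value p z =
    (\<Sum>\<alpha>\<in>Poly_Mapping.keys p. Poly_Mapping.lookup p \<alpha> *
       (\<Prod>i\<in>Poly_Mapping.keys \<alpha>. Matrix.vec_index z i ^ Poly_Mapping.lookup \<alpha> i))"

definition total_degree :: "cpoly \<Rightarrow> nat" where
  "total_degree p =
    Max (insert 0 ((\<lambda>\<alpha>. \<Sum>i\<in>Poly_Mapping.keys \<alpha>. Poly_Mapping.lookup \<alpha> i) ` Poly_Mapping.keys p))"

definition polynomial_function :: "nat \<Rightarrow> (cvec \<Rightarrow> complex) \<Rightarrow> bool" where
  "polynomial_function n g \<longleftrightarrow> (\<exists>p\<in>polys n. \<forall>z\<in>carrier_vec n. g z = poly_value p z)"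

definition polynomial_map :: "nat \<Rightarrow> nat \<Rightarrow> (cvec \<Rightarrow> cvec) \<Rightarrow> bool" where
  "polynomial_map n k G \<longleftrightarrow>
    (\<forall>z\<in>carrier_vec n. G z \<in> carrier_vec k) \<and>
    (\<forall>i<k. polynomial_function n (\<lambda>z. Matrix.vec_index (G z) i))"

definition polynomial_automorphism :: "nat \<Rightarrow> (cvec \<Rightarrow> cvec) \<Rightarrow> bool" where
  "polynomial_automorphism n G \<longleftrightarrow>
    bij_betw G (carrier_vec n) (carrier_vec n) \<and>
    polynomial_map n n G \<and>
    polynomial_map n n (inv_into (carrier_vec n) G)"


definition max_modulus :: "nat \<Rightarrow> (cvec \<Rightarrow> complex) \<Rightarrow> real \<Rightarrow> real" where
  "max_modulus n f r = (SUP z\<in>{z \<in> carrier_vec n. euclid_norm z < r}. cmod (f z))"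

definition log_max_modulus :: "nat \<Rightarrow> (cvec \<Rightarrow> complex) \<Rightarrow> real \<Rightarrow> real" where
  "log_max_modulus n f r = ln (max_modulus n f r)"

definition growth_order :: "nat \<Rightarrow> (cvec \<Rightarrow> complex) \<Rightarrow> ereal" where
  "growth_order n f = Limsup at_top (\<lambda>r::real. ereal (ln (log_max_modulus n f r) / ln r))"

definition phi :: "nat \<Rightarrow> (cvec \<Rightarrow> complex) \<Rightarrow> real \<Rightarrow> real" where
  "phi n f t = log_max_modulus n f (exp t)"

definition class_C_I :: "nat \<Rightarrow> (cvec \<Rightarrow> complex) \<Rightarrow> bool" where
  "class_C_I n f \<longleftrightarrow>
    growth_order n f < \<infinity> \<and>
    Limsup at_top (\<lambda>t::real.
      ereal ((phi n f (t + 1) - phi n f t) / (phi n f t - phi n f (t - 1)))) < \<infinity>"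

text \<open>
  A convex \<open>\<psi>\<close> is differentiable outside a countable set; the limit of \<open>t\<^sup>2 (1 / ln \<psi>)'\<close>
  is taken along the points of differentiability.
\<close>

definition class_C_II :: "nat \<Rightarrow> (cvec \<Rightarrow> complex) \<Rightarrow> bool" where
  "class_C_II n f \<longleftrightarrow>
    growth_order n f = \<infinity> \<and>
    (\<exists>\<psi> :: real \<Rightarrow> real.
      continuous_on UNIV \<psi> \<and> convex_on UNIV \<psi> \<and> mono \<psi> \<and>
      ((\<lambda>t. ln (\<psi> t) / ln (phi n f t)) \<longlongrightarrow> 1) at_top \<and>
      ((\<lambda>t. t\<^sup>2 * deriv (\<lambda>s. 1 / ln (\<psi> s)) t) \<longlongrightarrow> 0)
        (inf at_top (principal {t. \<psi> differentiable (at t)})))"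

definition class_C :: "nat \<Rightarrow> (cvec \<Rightarrow> complex) \<Rightarrow> bool" where
  "class_C n f \<longleftrightarrow>
    entire n f \<and> \<not> polynomial_function n f \<and> (class_C_I n f \<or> class_C_II n f)"


text \<open>
  Block \<open>j\<close> (\<open>j = 0, 1, \<dots>\<close>) of a vector that is the concatenation of vectors of lengths
  \<open>n 0, n 1, \<dots>\<close>.
\<close>

definition block :: "(nat \<Rightarrow> nat) \<Rightarrow> nat \<Rightarrow> cvec \<Rightarrow> cvec" where
  "block n j z = Matrix.vec (n j) (\<lambda>i. Matrix.vec_index z ((\<Sum>l<j. n l) + i))"

definition product_map :: "nat \<Rightarrow> (nat \<Rightarrow> nat) \<Rightarrow> (nat \<Rightarrow> cvec \<Rightarrow> complex) \<Rightarrow> cvec \<Rightarrow> cvec" where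
  "product_map m n f z = Matrix.vec m (\<lambda>j. f j (block n j z))"


text \<open>
  For a holomorphic map \<open>F\<close> from \<open>C^n\<close> to \<open>C^k\<close>, the supremum below is the maximum of \<open>|p|\<close> over
  the compact part \<open>{(z, F z). |z| \<le> r}\<close> of the graph.
\<close>

definition graph_max :: "nat \<Rightarrow> (cvec \<Rightarrow> cvec) \<Rightarrow> cpoly \<Rightarrow> real \<Rightarrow> real" where
  "graph_max n F p r =
    (SUP z\<in>{z \<in> carrier_vec n. euclid_norm z \<le> r}. cmod (poly_value p (z @\<^sub>v F z)))"

text \<open>
  The convention \<^term>\<open>(0::real) powr 0 = 0\<close> is harmless: if the inequalities hold with some
  \<open>C \<ge> 0\<close>, under either convention for \<open>0\<close> to the power \<open>0\<close>, they also hold with \<^term>\<open>max C 1\<close>.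
\<close>

definition admits_Bernstein :: "nat \<Rightarrow> nat \<Rightarrow> (cvec \<Rightarrow> cvec) \<Rightarrow> (nat \<Rightarrow> real) \<Rightarrow> bool" where
  "admits_Bernstein n k F \<mu> \<longleftrightarrow>
    (\<forall>d. 0 \<le> \<mu> d) \<and>
    (\<forall>r>0. \<exists>C\<ge>0. \<forall>p\<in>polys (n + k).
       graph_max n F p (exp 1 * r) \<le> C powr \<mu> (total_degree p) * graph_max n F p r)"

text \<open>
  The quotient is taken in \<^typ>\<open>ereal\<close>, so that it is \<open>\<infinity>\<close> where \<open>\<mu>\<close> vanishes and \<open>\<mu>\<^sub>o\<close> does not.
\<close>

definition optimal_exponent :: "nat \<Rightarrow> nat \<Rightarrow> (cvec \<Rightarrow> cvec) \<Rightarrow> (nat \<Rightarrow> real) \<Rightarrow> bool" where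
  "optimal_exponent n k F \<mu>\<^sub>o \<longleftrightarrow>
    admits_Bernstein n k F \<mu>\<^sub>o \<and>
    (\<nexists>\<mu>. admits_Bernstein n k F \<mu> \<and>
         (\<exists>c>0. \<forall>d. \<mu> d \<le> c * \<mu>\<^sub>o d) \<and>
         limsup (\<lambda>d. ereal (\<mu>\<^sub>o d) / ereal (\<mu> d)) = \<infinity>)"

end

theory Submission
  imports
    Defs
    "HOL-Complex_Analysis.Complex_Analysis"
    "HOL-Real_Asymp.Real_Asymp"
    "Jordan_Normal_Form.Determinant"
begin

text \<open>
  Let \<open>g(w) = q(w, f(w))\<close> with \<open>deg q \<le> k\<close> and \<open>\<phi>(t) = ln M\<^sub>f(e\<^sup>t)\<close>. By Hadamard's three circles
  theorem \<open>ln M\<^sub>g(e\<^sup>t)\<close> is convex, so its growth near a fixed radius is dominated by its growth near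
  \<open>e\<^sup>T\<close>, for any large \<open>T\<close>. There a comparison with the polynomial \<open>q\<close> itself is possible: on a complex
  line through a point \<open>b\<close> near the origin and a point of modulus \<open>e\<^sup>T\<close> where \<open>|f|\<close> is almost maximal,
  \<open>f\<close> stays below \<open>\<rho> = exp (\<phi>(T - 1))\<close> near \<open>b\<close> and reaches \<open>exp (\<phi>(T))\<close>. If \<open>\<phi>(T) - \<phi>(T - 1)\<close> is a large
  multiple of \<open>k\<close>, a Harnack argument shows that \<open>f\<close> takes more than \<open>k\<close> times all but few of a
  large set of separated values \<open>c\<close> with \<open>2\<rho> \<le> |c| \<le> 3\<rho>\<close>. Hermite interpolation at these preimages, where
  \<open>g = q(\<cdot>, c)\<close>, and Newton interpolation in \<open>c\<close> bound \<open>q(b, \<cdot>)\<close> by \<open>g\<close>, and the Bernstein--Walsh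
  inequality bounds \<open>g\<close> on a larger ball. The growth conditions of class \<open>C\<close> provide suitable \<open>T\<close>, and
  products are treated one block of variables at a time.

  For optimality, a polynomial of degree at most \<open>2L\<close> in one variable \<open>w\<close> and in \<open>f(w)\<close> is chosen to vanish
  to order \<open>(L + 1)\<^sup>2 - 1\<close> at a point; by the Schwarz lemma it grows by a factor of at least
  \<open>exp ((L + 1)\<^sup>2 - 1)\<close> from radius \<open>1\<close> to radius \<open>e\<close>.
\<close>

section \<open>Interpolation and Harnack inequalities\<close>

text \<open>For a single value \<open>c\<close> taken at most \<open>k\<close> times, Harnack's
  inequality bounds the increment of \<phi> over \<open>[T - 1, T]\<close> only by a multiple of the
  increment \<open>A\<close> over \<open>[T - 1, T + 20 * s]\<close>. This is useless, because
  \<open>A\<close> is never the smaller of the two. The cure is to add the logarithms for many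
  separated values: at each point at most one value can be close to \<open>f\<close>, so a loss of
  order \<open>A\<close> hits one summand and not all. With about \<open>A / s\<close> summands the
  average loss is of order \<open>k\<close>. So many values must be packed at distance about
  \<open>s / A\<close>, which costs only a logarithm. Hence \<open>growth_at\<close> compares the
  increment over \<open>[T - 1, T]\<close> with \<open>k\<close> and with the logarithm of
  \<open>A / s\<close>, never with \<open>A\<close> itself, and functions of infinite order become
  accessible.

  The resulting growth rate of polynomials on the graph is \<open>k * A / s\<close>: a factor
  exponential in \<open>k * A\<close>, gained over a logarithmic interval of length comparable to
  \<open>s\<close>. Both \<open>T\<close> and the step \<open>s\<close> are chosen to keep this cost
  low.\<close>

lemma factor_bound:
  fixes g :: "complex \<Rightarrow> complex"
  assumes g: "g holomorphic_on ball 0 R" and z: "norm z \<le> r" and "r < R"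
    and B: "\<And>x. x \<in> ball 0 R \<Longrightarrow> norm ((x - z) * g x) \<le> B"
    and x: "x \<in> ball 0 R"
  shows "norm (g x) \<le> 2 * B / (R - r)"
proof -
  \<comment> \<open>The circle must enclose \<open>x\<close> and avoid the point \<open>z\<close>:
    at radius at least \<open>(R + r) / 2\<close> the factor \<open>x - z\<close> has modulus at
    least \<open>(R - r) / 2\<close>, whence the constant 2.\<close>
  define t where "t = max (norm x) ((R + r) / 2)"
  have t: "norm x \<le> t" "(R + r) / 2 \<le> t" "t < R"
    using x \<open>r < R\<close> by (auto simp: t_def)
  have sub: "cball 0 t \<subseteq> ball 0 R" using t by auto
  show ?thesis
  proof (rule maximum_modulus_frontier [where S = "cball 0 t" and f = g and \<xi> = x])
    show "g holomorphic_on interior (cball 0 t)"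
      using g sub by (meson holomorphic_on_subset interior_subset)
    show "continuous_on (closure (cball 0 t)) g"
      using g sub holomorphic_on_imp_continuous_on continuous_on_subset by (metis closed_cball closure_closed)
    show "x \<in> cball 0 t" using t by simp
    fix y :: complex assume "y \<in> frontier (cball 0 t)"
    then have y: "norm y = t"
      by simp
    have "norm (y - z) \<ge> (R - r) / 2"
      using norm_triangle_ineq2[of y z] y t z by (simp add: field_simps)
    then have "(R - r) / 2 * norm (g y) \<le> norm (y - z) * norm (g y)"
      by (intro mult_right_mono) auto
    also have "\<dots> \<le> B" using B[of y] y t by (simp add: norm_mult)
    finally show "norm (g y) \<le> 2 * B / (R - r)" using \<open>r < R\<close> by (simp add: field_simps)
  qed auto
qed

text \<open>\<open>a\<close> is the Hermite interpolant, at the nodes \<open>zs\<close> with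
  multiplicity, of the function bounded by \<open>B\<close>. As that function is holomorphic and
  bounded on a larger disc, no separation of the nodes is required: removing a node replaces the
  function by a divided difference, which \<open>factor_bound\<close> controls, and costs one factor
  \<open>1 + 8 * R / (R - r)\<close>.\<close>

lemma hermite_interpolation_bound:
  fixes a :: "complex poly"
  assumes "0 \<le> r" "r < R" and H: "H holomorphic_on ball 0 R"
  shows "\<lbrakk>\<And>z. z \<in> set zs \<Longrightarrow> norm z \<le> r;
     \<And>x. x \<in> ball 0 R \<Longrightarrow> norm (poly a x + (\<Prod>z\<leftarrow>zs. x - z) * H x) \<le> B;
     a = 0 \<or> degree a < length zs; x \<in> ball 0 R\<rbrakk>
    \<Longrightarrow> norm (poly a x) \<le> (1 + 8 * R / (R - r)) ^ length zs * B"
proof (induction zs arbitrary: a B x)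
  case Nil
  have "0 \<le> B" using order_trans[OF norm_ge_zero Nil.prems(2)[OF Nil.prems(4)]] .
  then show ?case using Nil.prems(3) by auto
next
  case (Cons w zs)
  define a' where "a' = synthetic_div a w"
  \<comment> \<open>The divided difference at \<open>w\<close> of the interpolated function; its
    interpolant at the remaining nodes is \<open>a'\<close>.\<close>
  define g where "g = (\<lambda>x. poly a' x + (\<Prod>z\<leftarrow>zs. x - z) * H x)"
  define K where "K = 1 + 8 * R / (R - r)"
  have R: "R > 0" using assms by linarith
  have K: "K \<ge> 1" unfolding K_def using assms by simp
  have w: "norm w \<le> r" using Cons.prems(1) by simp
  then have wb: "w \<in> ball 0 R" using assms by simp
  have a: "poly a x = (x - w) * poly a' x + poly a w" for x
  proof -
    have "poly a x = poly ([:-w, 1:] * synthetic_div a w + [:poly a w:]) x"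
      using synthetic_div_correct'[of w a] by simp
    then show ?thesis by (simp add: a'_def algebra_simps)
  qed
  have aw: "norm (poly a w) \<le> B" using Cons.prems(2)[OF wb] by simp
  then have "0 \<le> B" using order_trans[OF norm_ge_zero aw] by simp
  have ghol: "g holomorphic_on ball 0 R"
  proof -
    have "(\<lambda>x. \<Prod>z\<leftarrow>zs. x - z) holomorphic_on ball 0 R"
      by (induction zs) (auto intro!: holomorphic_intros)
    then show ?thesis unfolding g_def by (intro holomorphic_intros H)
  qed
  have g2: "norm ((x - w) * g x) \<le> 2 * B" if "x \<in> ball 0 R" for x
  proof -
    have "(x - w) * g x = (poly a x + (\<Prod>z\<leftarrow>w # zs. x - z) * H x) - poly a w"
      by (simp add: g_def a[of x] algebra_simps)
    then show ?thesis
      using norm_triangle_ineq4[of "poly a x + (\<Prod>z\<leftarrow>w # zs. x - z) * H x" "poly a w"]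
        Cons.prems(2)[OF that] aw by (smt (verit))
  qed
  have g3: "norm (g x) \<le> 4 * B / (R - r)" if "x \<in> ball 0 R" for x
    using factor_bound[OF ghol w \<open>r < R\<close> g2 that] by simp
  have deg: "a' = 0 \<or> degree a' < length zs"
    using Cons.prems(3) by (auto simp: a'_def synthetic_div_eq_0_iff degree_synthetic_div)
  have IH: "norm (poly a' x) \<le> K ^ length zs * (4 * B / (R - r))"
    using Cons.IH[of a' "4 * B / (R - r)" x] Cons.prems(1,4) g3 deg
    by (auto simp: g_def K_def)
  have "norm (poly a x) \<le> norm (x - w) * norm (poly a' x) + B"
    unfolding a[of x] using aw norm_triangle_ineq[of "(x - w) * poly a' x" "poly a w"]
    by (simp add: norm_mult)
  also have "\<dots> \<le> (2 * R) * (K ^ length zs * (4 * B / (R - r))) + B"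
  proof -
    have "norm (x - w) \<le> 2 * R"
      using norm_triangle_ineq4[of x w] Cons.prems(4) w \<open>r < R\<close> by simp
    then show ?thesis using IH R by (intro add_mono mult_mono) auto
  qed
  also have "\<dots> = K ^ length zs * B * (8 * R / (R - r)) + B" by (simp add: field_simps)
  also have "\<dots> \<le> K ^ length zs * B * (8 * R / (R - r)) + K ^ length zs * B"
    using one_le_power[OF K, of "length zs"] \<open>0 \<le> B\<close> by (simp add: mult_le_cancel_right1)
  also have "\<dots> = K ^ length (w # zs) * B"
    by (simp add: K_def algebra_simps)
  finally show ?case by (simp add: K_def)
qed

text \<open>Here only values at the nodes are known, so the separation \<sigma> has to control the
  divided differences: each step gives at most \<open>2 * B / \<sigma>\<close>, and multiplying back
  by \<open>y - w\<close>, of modulus at most \<open>2 * \<rho>\<close>, produces the factor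
  \<open>4 * \<rho> / \<sigma>\<close> per node.\<close>

lemma newton_interpolation_bound:
  fixes p :: "complex poly"
  assumes "\<sigma> > 0" and "\<rho> \<ge> 0"
  shows "\<lbrakk>distinct cs; \<And>c. c \<in> set cs \<Longrightarrow> norm c \<le> \<rho>;
     \<And>c c'. \<lbrakk>c \<in> set cs; c' \<in> set cs; c \<noteq> c'\<rbrakk> \<Longrightarrow> \<sigma> \<le> norm (c - c');
     \<And>c. c \<in> set cs \<Longrightarrow> norm (poly p c) \<le> B;
     p = 0 \<or> degree p < length cs; norm y \<le> \<rho>; 0 \<le> B\<rbrakk>
    \<Longrightarrow> norm (poly p y) \<le> (1 + 4 * \<rho> / \<sigma>) ^ length cs * B"
proof (induction cs arbitrary: p B)
  case Nil
  then show ?case by auto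
next
  case (Cons w cs)
  define p' where "p' = synthetic_div p w"
  define K where "K = 1 + 4 * \<rho> / \<sigma>"
  have K: "K \<ge> 1" using assms by (simp add: K_def)
  have p: "poly p x = (x - w) * poly p' x + poly p w" for x
  proof -
    have "poly p x = poly ([:-w, 1:] * synthetic_div p w + [:poly p w:]) x"
      using synthetic_div_correct'[of w p] by simp
    then show ?thesis by (simp add: p'_def algebra_simps)
  qed
  have pw: "norm (poly p w) \<le> B" using Cons.prems(4) by simp
  have p'c: "norm (poly p' c) \<le> 2 * B / \<sigma>" if c: "c \<in> set cs" for c
  proof -
    have "c \<noteq> w" using Cons.prems(1) c by auto
    then have "\<sigma> \<le> norm (c - w)" using Cons.prems(3)[of c w] c by auto
    then have "\<sigma> * norm (poly p' c) \<le> norm (c - w) * norm (poly p' c)"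
      by (intro mult_right_mono) auto
    also have "\<dots> = norm (poly p c - poly p w)" by (simp add: p[of c] norm_mult)
    also have "\<dots> \<le> 2 * B"
      using norm_triangle_ineq4[of "poly p c" "poly p w"] pw Cons.prems(4)[of c] c by simp
    finally show ?thesis using assms by (simp add: field_simps)
  qed
  have deg: "p' = 0 \<or> degree p' < length cs"
    using Cons.prems(5) by (auto simp: p'_def synthetic_div_eq_0_iff degree_synthetic_div)
  have "norm (poly p' y) \<le> K ^ length cs * (2 * B / \<sigma>)"
    unfolding K_def
  proof (rule Cons.IH)
    show "distinct cs" using Cons.prems(1) by simp
    show "norm c \<le> \<rho>" if "c \<in> set cs" for c using that Cons.prems(2) by simp
    show "\<sigma> \<le> norm (c - c')" if "c \<in> set cs" "c' \<in> set cs" "c \<noteq> c'" for c c'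
      using that Cons.prems(3) by simp
    show "0 \<le> 2 * B / \<sigma>" using Cons.prems(7) assms by simp
  qed (use p'c deg Cons.prems in auto)
  then have "norm (y - w) * norm (poly p' y) \<le> (2 * \<rho>) * (K ^ length cs * (2 * B / \<sigma>))"
    using Cons.prems(2)[of w] Cons.prems(6) norm_triangle_ineq4[of y w] assms
    by (intro mult_mono) auto
  moreover have "norm (poly p y) \<le> norm (y - w) * norm (poly p' y) + B"
    unfolding p[of y] using pw norm_triangle_ineq[of "(y - w) * poly p' y" "poly p w"]
    by (simp add: norm_mult)
  ultimately have "norm (poly p y) \<le> K ^ length cs * B * (4 * \<rho> / \<sigma>) + B"
    by (simp add: mult_ac)
  also have "\<dots> \<le> K ^ length cs * B * (4 * \<rho> / \<sigma>) + K ^ length cs * B"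
    using one_le_power[OF K, of "length cs"] Cons.prems(7) by (simp add: mult_le_cancel_right1)
  also have "\<dots> = K ^ length (w # cs) * B" by (simp add: K_def algebra_simps)
  finally show ?case by (simp add: K_def)
qed

text \<open>The cap \<open>N\<close> makes this a dichotomy: either \<open>N\<close> zeros have been
  divided out, or the zeros in the smaller disc are exhausted. With \<open>N = k + 1\<close> the
  first case supplies interpolation nodes and the second feeds the Harnack argument.\<close>

lemma factor_zeros:
  fixes F :: "complex \<Rightarrow> complex"
  assumes "r < R"
  shows "F holomorphic_on ball 0 R \<Longrightarrow>
    \<exists>zs H. H holomorphic_on ball 0 R \<and> (\<forall>z\<in>set zs. norm z \<le> r) \<and>
      (\<forall>x\<in>ball 0 R. F x = (\<Prod>z\<leftarrow>zs. x - z) * H x) \<and> length zs \<le> N \<and>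
      (length zs = N \<or> (\<forall>x\<in>cball 0 r. H x \<noteq> 0))"
proof (induction N arbitrary: F)
  case 0
  then show ?case by (intro exI[of _ "[]"] exI[of _ F]) auto
next
  case (Suc N)
  show ?case
  proof (cases "\<exists>w\<in>cball 0 r. F w = 0")
    case False
    then show ?thesis using Suc.prems by (intro exI[of _ "[]"] exI[of _ F]) auto
  next
    case True
    then obtain w where w: "norm w \<le> r" "F w = 0" by auto
    define F1 where "F1 = (\<lambda>z. if z = w then deriv F w else (F z - F w) / (z - w))"
    have "F1 holomorphic_on ball 0 R"
      unfolding F1_def using w assms Suc.prems by (intro pole_lemma_open) auto
    from Suc.IH[OF this] obtain zs H where H: "H holomorphic_on ball 0 R"
      "\<forall>z\<in>set zs. norm z \<le> r" "\<forall>x\<in>ball 0 R. F1 x = (\<Prod>z\<leftarrow>zs. x - z) * H x" "length zs \<le> N"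
      "length zs = N \<or> (\<forall>x\<in>cball 0 r. H x \<noteq> 0)" by blast
    have "F x = (\<Prod>z\<leftarrow>w # zs. x - z) * H x" if "x \<in> ball 0 R" for x
    proof -
      have "F x = (x - w) * F1 x" using w by (simp add: F1_def)
      then show ?thesis using H(3) that by simp
    qed
    then show ?thesis using H w by (intro exI[of _ "w # zs"] exI[of _ H]) auto
  qed
qed

lemma harnack_Re_pos:
  fixes L :: "complex \<Rightarrow> complex"
  assumes L: "L holomorphic_on ball 0 r" and pos: "\<And>x. x \<in> ball 0 r \<Longrightarrow> 0 < Re (L x)"
    and r: "r > 0" and x: "norm x \<le> t * r" and t: "t < 1"
  shows "Re (L x) \<le> (1 + t) / (1 - t) * Re (L 0)"
proof -
  define \<xi> where "\<xi> = x / of_real r"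
  \<comment> \<open>The Cayley transform of the right half plane that sends \<open>L 0\<close> to 0,
    on the disc rescaled to radius 1, so that the Schwarz lemma applies.\<close>
  define G where "G = (\<lambda>\<xi>. (L (of_real r * \<xi>) - L 0) / (L (of_real r * \<xi>) + cnj (L 0)))"
  have xi: "norm \<xi> \<le> t" using x r by (simp add: \<xi>_def norm_divide field_simps)
  have t0: "0 \<le> t" using xi norm_ge_zero order_trans by blast
  have in_ball: "of_real r * y \<in> ball 0 r" if "norm y < 1" for y :: complex
    using that r by (simp add: norm_mult)
  have p: "0 < Re (L 0)" using pos r by simp
  have key: "norm (X - L 0) < norm (X + cnj (L 0))" if "0 < Re X" for X
  proof -
    have "(norm (X - L 0))\<^sup>2 < (norm (X + cnj (L 0)))\<^sup>2"
      unfolding cmod_power2 using mult_pos_pos[OF that p]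
      by (simp add: power2_eq_square algebra_simps)
    then show ?thesis by (rule power_less_imp_less_base) simp
  qed
  have nz: "L (of_real r * y) + cnj (L 0) \<noteq> 0" if "norm y < 1" for y
    using key[OF pos[OF in_ball[OF that]]] by auto
  have "norm (G \<xi>) \<le> norm \<xi>"
  proof (rule Schwarz_Lemma(1))
    have "(L \<circ> (\<lambda>y. of_real r * y)) holomorphic_on ball 0 1"
      by (rule holomorphic_on_compose_gen[OF _ L]) (use in_ball in \<open>auto intro!: holomorphic_intros\<close>)
    then have "(\<lambda>y. L (of_real r * y)) holomorphic_on ball 0 1" by (simp add: o_def)
    then show "G holomorphic_on ball 0 1"
      unfolding G_def using nz by (intro holomorphic_intros) auto
    show "G 0 = 0" by (simp add: G_def)
    show "norm (G z) < 1" if "norm z < 1" for z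
      using key[OF pos[OF in_ball[OF that]]] nz[OF that] by (simp add: G_def norm_divide)
    show "norm \<xi> < 1" using xi t by simp
  qed
  then have "norm (G \<xi>) \<le> t" using xi by simp
  moreover have rx: "of_real r * \<xi> = x" using r by (simp add: \<xi>_def)
  moreover have "norm \<xi> < 1" using xi t by simp
  ultimately have "norm (L x - L 0) \<le> t * norm (L x + cnj (L 0))"
    using nz[of \<xi>] by (simp add: G_def norm_divide field_simps)
  then have "(norm (L x - L 0))\<^sup>2 \<le> (t * norm (L x + cnj (L 0)))\<^sup>2"
    by (intro power_mono) auto
  then have *: "(Re (L x) - Re (L 0))\<^sup>2 + (Im (L x) - Im (L 0))\<^sup>2
      \<le> t\<^sup>2 * ((Re (L x) + Re (L 0))\<^sup>2 + (Im (L x) - Im (L 0))\<^sup>2)"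
    by (simp add: power_mult_distrib cmod_power2)
  have le: "t\<^sup>2 * (Im (L x) - Im (L 0))\<^sup>2 \<le> 1 * (Im (L x) - Im (L 0))\<^sup>2"
    using t0 t by (intro mult_right_mono) (auto simp: power_le_one)
  have cancel: "a \<le> t\<^sup>2 * b" if "a + d \<le> t\<^sup>2 * (b + d)" "t\<^sup>2 * d \<le> 1 * d" for a b d :: real
    using that by (simp add: distrib_left)
  have "(Re (L x) - Re (L 0))\<^sup>2 \<le> (t * (Re (L x) + Re (L 0)))\<^sup>2"
    using cancel[OF * le] by (simp only: power_mult_distrib)
  moreover have "0 \<le> t * (Re (L x) + Re (L 0))"
    using t0 p pos[OF in_ball[OF \<open>norm \<xi> < 1\<close>]] rx by simp
  ultimately have "Re (L x) - Re (L 0) \<le> t * (Re (L x) + Re (L 0))"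
    by (rule power2_le_imp_le)
  then have "(1 - t) * Re (L x) \<le> (1 + t) * Re (L 0)" by (simp add: algebra_simps)
  then show ?thesis using t by (simp add: pos_le_divide_eq mult.commute)
qed

lemma harnack_Re:
  fixes L :: "complex \<Rightarrow> complex"
  assumes L: "L holomorphic_on ball 0 r" and pos: "\<And>x. x \<in> ball 0 r \<Longrightarrow> 0 \<le> Re (L x)"
    and r: "r > 0" and x: "norm x \<le> t * r" and t: "t < 1"
  shows "Re (L x) \<le> (1 + t) / (1 - t) * Re (L 0)"
proof (rule field_le_epsilon)
  fix e :: real assume e: "e > 0"
  have t0: "0 \<le> t" using order_trans[OF norm_ge_zero x] r by (simp add: zero_le_mult_iff)
  \<comment> \<open>Harnack's inequality multiplies the shift by \<open>(1 + t) / (1 - t)\<close>,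
    so this shift costs exactly \<open>e\<close>.\<close>
  define d where "d = e * (1 - t) / (1 + t)"
  have d: "d > 0" using e t t0 by (simp add: d_def)
  have "Re (L x + of_real d) \<le> (1 + t) / (1 - t) * Re (L 0 + of_real d)"
    by (rule harnack_Re_pos[of "\<lambda>x. L x + of_real d" r])
      (use L pos d r x t in \<open>auto intro!: holomorphic_intros add_nonneg_pos\<close>)
  also have "\<dots> = (1 + t) / (1 - t) * Re (L 0) + e"
    using t t0 by (simp add: d_def distrib_left)
  finally show "Re (L x) \<le> (1 + t) / (1 - t) * Re (L 0) + e" using d by simp
qed

section \<open>Preimages of separated values\<close>

lemma norm_prod_list_le:
  fixes f :: "'a \<Rightarrow> complex"
  assumes "\<And>z. z \<in> set zs \<Longrightarrow> norm (f z) \<le> c" and "1 \<le> c" and "length zs \<le> k"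
  shows "norm (\<Prod>z\<leftarrow>zs. f z) \<le> c ^ k"
proof -
  have "norm (\<Prod>z\<leftarrow>zs. f z) \<le> c ^ length zs"
    using assms(1)
  proof (induction zs)
    case (Cons a zs)
    then show ?case using assms(2) by (auto simp: norm_mult intro!: mult_mono)
  qed simp
  also have "\<dots> \<le> c ^ k" using assms by (intro power_increasing) auto
  finally show ?thesis .
qed

lemma norm_prod_list_ge:
  fixes f :: "'a \<Rightarrow> complex"
  assumes "\<And>z. z \<in> set zs \<Longrightarrow> c \<le> norm (f z)" and "0 \<le> c" "c \<le> 1" and "length zs \<le> k"
  shows "c ^ k \<le> norm (\<Prod>z\<leftarrow>zs. f z)"
proof -
  have "c ^ k \<le> c ^ length zs" using assms by (intro power_decreasing) auto
  also have "\<dots> \<le> norm (\<Prod>z\<leftarrow>zs. f z)"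
    using assms(1)
  proof (induction zs)
    case (Cons a zs)
    then show ?case using assms(2) by (auto simp: norm_mult intro!: mult_mono)
  qed simp
  finally show ?thesis .
qed

text \<open>Each radius has its own job. The zeros \<open>zs\<close> lie within
  \<open>1 + 2 * s\<close>; \<open>H\<close> is estimated on the circle of radius
  \<open>1 + 5/2 * s\<close>, at distance \<open>s / 2\<close> from them; its logarithm lives on the
  disc of radius \<open>1 + 2 * s\<close>, and Harnack's inequality leads from there to
  \<open>1 + s\<close>. The first lower bound holds everywhere but involves \<open>A\<close>; the
  second does not, but degenerates where \<open>v\<close> is close to \<open>c\<close>.\<close>

lemma zero_free_factor_log:
  fixes v :: "complex \<Rightarrow> complex" and c :: complex and k :: nat
  assumes s: "0 < s" "s \<le> 1/10" and A: "0 \<le> A"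
    and v: "v holomorphic_on ball 0 (1 + 3 * s)"
    and v_small: "\<And>x. norm x \<le> 1/10 \<Longrightarrow> norm (v x) \<le> 1"
    and v_le: "\<And>x. x \<in> ball 0 (1 + 3 * s) \<Longrightarrow> norm (v x) \<le> exp A"
    and c: "2 \<le> norm c" "norm c \<le> 3"
    and H: "H holomorphic_on ball 0 (1 + 3 * s)"
    and zs: "length zs \<le> k" "\<And>z. z \<in> set zs \<Longrightarrow> norm z \<le> 1 + 2 * s"
    and eq: "\<And>x. x \<in> ball 0 (1 + 3 * s) \<Longrightarrow> v x - c = (\<Prod>z\<leftarrow>zs. x - z) * H x"
    and H_nz: "\<And>x. norm x \<le> 1 + 2 * s \<Longrightarrow> H x \<noteq> 0"
  obtains L where "L holomorphic_on ball 0 (1 + 2 * s)"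
    and "Re (L 0) \<le> ln 4 + k * ln 10"
    and "\<And>x. norm x \<le> 1 + s \<Longrightarrow> - (3 / s) * (A + ln 4 + k * ln (2 / s) + k * ln 2) \<le> Re (L x)"
    and "\<And>x. norm x \<le> 1 + s \<Longrightarrow> v x \<noteq> c \<Longrightarrow> ln (norm (v x - c)) - k * ln 3 \<le> Re (L x)"
proof -
  let ?R = "1 + 3 * s" and ?r = "1 + 2 * s"
  let ?W = "\<lambda>x. \<Prod>z\<leftarrow>zs. x - z"
  have sub: "ball 0 ?r \<subseteq> ball (0::complex) ?R" using s by auto
  have "\<exists>L. L holomorphic_on ball 0 ?r \<and> (\<forall>x\<in>ball 0 ?r. H x = exp (L x))"
  proof -
    obtain L where "L holomorphic_on ball 0 ?r" "\<And>x. x \<in> ball 0 ?r \<Longrightarrow> H x = exp (L x)"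
      by (rule contractible_imp_holomorphic_log[of H "ball 0 ?r"])
        (use H sub H_nz in \<open>auto intro: holomorphic_on_subset convex_imp_contractible\<close>)
    then show ?thesis by blast
  qed
  then obtain L where L: "L holomorphic_on ball 0 ?r" "\<And>x. norm x < ?r \<Longrightarrow> H x = exp (L x)" by auto
  have lnH: "Re (L x) = ln (norm (H x))" if "norm x < ?r" for x
    using L(2)[OF that] by simp
  \<comment> \<open>Near 0 the modulus of \<open>v\<close> is at most 1 and that of \<open>c\<close>
    at least 2, so \<open>v - c\<close> has no zero there. Hence the product of the linear factors
    is at least \<open>(1/10) ^ k\<close> at 0.\<close>
  have zs_big: "1/10 \<le> norm z" if "z \<in> set zs" for z
  proof (rule ccontr)
    assume "\<not> 1/10 \<le> norm z"
    then have vz: "norm (v z) \<le> 1" "z \<in> ball 0 ?R" using v_small[of z] s by auto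
    have "?W z = 0" using that by (auto simp: prod_list_zero_iff)
    then have "v z - c = 0" using eq[OF vz(2)] by (simp only: mult_zero_left)
    then show False using vz(1) c by auto
  qed
  have H0: "norm (H 0) \<le> 4 * 10 ^ k" "1 / 2 ^ k \<le> norm (H 0)"
  proof -
    have "v 0 - c = ?W 0 * H 0" using eq[of 0] s by simp
    then have e: "norm (v 0 - c) = norm (?W 0) * norm (H 0)" by (simp only: norm_mult)
    have v0: "norm (v 0 - c) \<le> 4" "1 \<le> norm (v 0 - c)"
      using norm_triangle_ineq4[of "v 0" c] norm_triangle_ineq2[of c "v 0"] v_small[of 0] c
      by (auto simp: norm_minus_commute)
    have W: "(1/10) ^ k \<le> norm (?W 0)" "norm (?W 0) \<le> 2 ^ k"
    proof -
      show "(1/10) ^ k \<le> norm (?W 0)"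
        by (rule norm_prod_list_ge) (use zs_big zs in auto)
      show "norm (?W 0) \<le> 2 ^ k"
      proof (rule norm_prod_list_le)
        show "norm (0 - z) \<le> 2" if "z \<in> set zs" for z using zs(2)[OF that] s by simp
      qed (use zs in auto)
    qed
    have "(1/10) ^ k * norm (H 0) \<le> norm (?W 0) * norm (H 0)"
      using W by (intro mult_right_mono) auto
    also have "\<dots> \<le> 4" using e v0 by simp
    finally show "norm (H 0) \<le> 4 * 10 ^ k" by (simp add: field_simps)
    have "1 \<le> norm (?W 0) * norm (H 0)" using e v0 by simp
    also have "\<dots> \<le> 2 ^ k * norm (H 0)" using W by (intro mult_right_mono) auto
    finally show "1 / 2 ^ k \<le> norm (H 0)" by (simp add: field_simps)
  qed
  have H0pos: "0 < norm (H 0)" using H_nz[of 0] s by simp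
  have L0: "Re (L 0) \<le> ln 4 + k * ln 10"
  proof -
    have "ln (norm (H 0)) \<le> ln (4 * 10 ^ k)" using H0 H0pos by simp
    then show ?thesis using lnH[of 0] s by (simp add: ln_mult ln_realpow)
  qed
  have L0': "- (k * ln 2) \<le> Re (L 0)"
  proof -
    have "ln (1 / 2 ^ k) \<le> ln (norm (H 0))" using H0 H0pos by (subst ln_le_cancel_iff) auto
    then show ?thesis using lnH[of 0] s by (simp add: ln_div ln_realpow)
  qed
  have H_le: "norm (H x) \<le> 4 * exp A * (2 / s) ^ k" if x: "norm x < ?r" for x
  proof (rule maximum_modulus_frontier[where S = "cball 0 (1 + 5/2 * s)" and f = H and \<xi> = x])
    have sub': "cball 0 (1 + 5/2 * s) \<subseteq> ball (0::complex) ?R" using s by auto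
    show "H holomorphic_on interior (cball 0 (1 + 5/2 * s))"
      using H sub' by (meson holomorphic_on_subset interior_subset)
    show "continuous_on (closure (cball 0 (1 + 5/2 * s))) H"
      using H sub' holomorphic_on_imp_continuous_on continuous_on_subset
      by (metis closed_cball closure_closed)
    show "x \<in> cball 0 (1 + 5/2 * s)" using x s by auto
    fix y :: complex assume "y \<in> frontier (cball 0 (1 + 5/2 * s))"
    then have y: "norm y = 1 + 5/2 * s" by simp
    have yR: "y \<in> ball 0 ?R" using y s by auto
    have W: "(s/2) ^ k \<le> norm (?W y)"
    proof (rule norm_prod_list_ge)
      show "s/2 \<le> norm (y - z)" if "z \<in> set zs" for z
        using norm_triangle_ineq2[of y z] y zs(2)[OF that] by simp
    qed (use zs s in auto)
    have "(s/2) ^ k * norm (H y) \<le> norm (?W y) * norm (H y)"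
      using W by (intro mult_right_mono) auto
    also have "\<dots> = norm (v y - c)" using eq[OF yR] by (simp only: norm_mult)
    also have "\<dots> \<le> exp A + 3" using norm_triangle_ineq4[of "v y" c] v_le[OF yR] c by simp
    also have "\<dots> \<le> 4 * exp A" using A by simp
    finally show "norm (H y) \<le> 4 * exp A * (2 / s) ^ k" using s by (simp add: field_simps)
  qed auto
  define A1 where "A1 = A + ln 4 + k * ln (2 / s)"
  have A1: "0 \<le> A1" using s A by (auto simp: A1_def intro!: add_nonneg_nonneg mult_nonneg_nonneg)
  have L_le: "Re (L x) \<le> A1" if "norm x < ?r" for x
  proof -
    have "ln (norm (H x)) \<le> ln (4 * exp A * (2 / s) ^ k)"
      using H_le[OF that] H_nz[of x] that s by (subst ln_le_cancel_iff) auto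
    also have "\<dots> = A1" using s by (simp add: A1_def ln_mult ln_realpow)
    finally show ?thesis using lnH[OF that] by simp
  qed
  have low: "- (3 / s) * (A1 + k * ln 2) \<le> Re (L x)" if x: "norm x \<le> 1 + s" for x
  proof -
    define t where "t = (1 + s) / ?r"
    have t: "t < 1" "t * ?r = 1 + s" using s by (auto simp: t_def)
    \<comment> \<open>\<open>A1 - L\<close> has nonnegative real part, so a bound of Harnack type
      from above becomes one from below for \<open>L\<close>. The ratio of the radii yields the
      constant \<open>(2 + 3 * s) / s\<close>.\<close>
    have h: "Re (of_real A1 - L x) \<le> (1 + t) / (1 - t) * Re (of_real A1 - L 0)"
      by (rule harnack_Re[where r = ?r and L = "\<lambda>x. of_real A1 - L x"])
        (use L L_le s x t in \<open>auto intro!: holomorphic_intros\<close>)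
    have "1 + t = (2 + 3 * s) / ?r" "1 - t = s / ?r" using s by (auto simp: t_def field_simps)
    then have "(1 + t) / (1 - t) = (2 + 3 * s) / s" using s by simp
    also have "\<dots> \<le> 3 / s" using s by (simp add: divide_right_mono)
    finally have t3: "(1 + t) / (1 - t) \<le> 3 / s" .
    have "(1 + t) / (1 - t) * (A1 - Re (L 0)) \<le> 3 / s * (A1 + k * ln 2)"
      using L_le[of 0] L0' t3 s by (intro mult_mono) auto
    then show ?thesis using h A1 by simp
  qed
  have near: "ln (norm (v x - c)) - k * ln 3 \<le> Re (L x)" if x: "norm x \<le> 1 + s" and ne: "v x \<noteq> c" for x
  proof -
    have xr: "norm x < ?r" "x \<in> ball 0 ?R" using x s by auto
    have "norm (?W x) \<le> 3 ^ k"
    proof (rule norm_prod_list_le)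
      show "norm (x - z) \<le> 3" if "z \<in> set zs" for z
        using norm_triangle_ineq4[of x z] x zs(2)[OF that] s by simp
    qed (use zs in auto)
    then have "norm (v x - c) \<le> 3 ^ k * norm (H x)"
      unfolding eq[OF xr(2)] norm_mult by (intro mult_right_mono) auto
    then have "ln (norm (v x - c)) \<le> ln (3 ^ k * norm (H x))"
      using ne H_nz[of x] xr by (subst ln_le_cancel_iff) auto
    also have "\<dots> = k * ln 3 + Re (L x)"
      using H_nz[of x] xr lnH[of x] by (simp add: ln_mult ln_realpow)
    finally show ?thesis by simp
  qed
  show thesis
    by (rule that[OF L(1) L0]) (use low near in \<open>auto simp: A1_def\<close>)
qed


text \<open>\<open>U\<close> adds the logarithms of the zero-free factors for all values in
  \<open>I\<close>. It is bounded above at 0 and large at 1, so Harnack's inequality limits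
  \<open>B\<close> as soon as \<open>U\<close> is bounded below. At any point at most one value lies
  within \<open>\<sigma> / 2\<close> of \<open>v\<close>; only that summand can be as low as
  \<open>- E\<close>, and the size of \<open>I\<close> makes this at most \<open>k\<close> per
  summand.\<close>

lemma few_preimages_growth_bound:
  fixes v :: "complex \<Rightarrow> complex" and c :: "nat \<Rightarrow> complex" and k :: nat
  assumes s: "0 < s" "s \<le> 1/10" and A: "0 \<le> A" and k: "1 \<le> k"
    and v: "v holomorphic_on ball 0 (1 + 3 * s)"
    and v_small: "\<And>x. norm x \<le> 1/10 \<Longrightarrow> norm (v x) \<le> 1"
    and v_le: "\<And>x. x \<in> ball 0 (1 + 3 * s) \<Longrightarrow> norm (v x) \<le> exp A"
    and c: "\<And>i. i \<in> I \<Longrightarrow> 2 \<le> norm (c i)" "\<And>i. i \<in> I \<Longrightarrow> norm (c i) \<le> 3"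
    and sep: "\<And>i j. i \<in> I \<Longrightarrow> j \<in> I \<Longrightarrow> i \<noteq> j \<Longrightarrow> \<sigma> \<le> norm (c i - c j)" and \<sigma>: "0 < \<sigma>" "\<sigma> \<le> 1"
    and few: "\<And>i. i \<in> I \<Longrightarrow> \<exists>H zs. H holomorphic_on ball 0 (1 + 3 * s) \<and> length zs \<le> k \<and>
        (\<forall>z\<in>set zs. norm z \<le> 1 + 2 * s) \<and>
        (\<forall>x\<in>ball 0 (1 + 3 * s). v x - c i = (\<Prod>z\<leftarrow>zs. x - z) * H x) \<and>
        (\<forall>x\<in>cball 0 (1 + 2 * s). H x \<noteq> 0)"
    and I: "3 / s * (A + 3 + 2 / s) \<le> card I"
    and v1: "exp B \<le> norm (v 1)"
  shows "B \<le> 40 / s * (k + ln (1 / \<sigma>))"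
proof (rule ccontr)
  assume "\<not> B \<le> 40 / s * (k + ln (1 / \<sigma>))"
  then have B: "40 / s * (k + ln (1 / \<sigma>)) < B" by simp
  have "\<forall>i\<in>I. \<exists>L. L holomorphic_on ball 0 (1 + 2 * s) \<and> Re (L 0) \<le> ln 4 + k * ln 10 \<and>
     (\<forall>x. norm x \<le> 1 + s \<longrightarrow> - (3 / s) * (A + ln 4 + k * ln (2 / s) + k * ln 2) \<le> Re (L x)) \<and>
     (\<forall>x. norm x \<le> 1 + s \<longrightarrow> v x \<noteq> c i \<longrightarrow> ln (norm (v x - c i)) - k * ln 3 \<le> Re (L x))"
  proof
    fix i assume i: "i \<in> I"
    obtain H zs where H: "H holomorphic_on ball 0 (1 + 3 * s)" "length zs \<le> k"
        "\<forall>z\<in>set zs. norm z \<le> 1 + 2 * s"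
        "\<forall>x\<in>ball 0 (1 + 3 * s). v x - c i = (\<Prod>z\<leftarrow>zs. x - z) * H x"
        "\<forall>x\<in>cball 0 (1 + 2 * s). H x \<noteq> 0"
      using few[OF i] by blast
    obtain L where "L holomorphic_on ball 0 (1 + 2 * s)" "Re (L 0) \<le> ln 4 + k * ln 10"
      "\<And>x. norm x \<le> 1 + s \<Longrightarrow> - (3 / s) * (A + ln 4 + k * ln (2 / s) + k * ln 2) \<le> Re (L x)"
      "\<And>x. norm x \<le> 1 + s \<Longrightarrow> v x \<noteq> c i \<Longrightarrow> ln (norm (v x - c i)) - k * ln 3 \<le> Re (L x)"
      by (rule zero_free_factor_log[OF s A v v_small v_le c[OF i] H(1,2)]) (use H in auto)
    then show "\<exists>L. L holomorphic_on ball 0 (1 + 2 * s) \<and> Re (L 0) \<le> ln 4 + k * ln 10 \<and>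
     (\<forall>x. norm x \<le> 1 + s \<longrightarrow> - (3 / s) * (A + ln 4 + k * ln (2 / s) + k * ln 2) \<le> Re (L x)) \<and>
     (\<forall>x. norm x \<le> 1 + s \<longrightarrow> v x \<noteq> c i \<longrightarrow> ln (norm (v x - c i)) - k * ln 3 \<le> Re (L x))"
      by blast
  qed
  then obtain L where L: "\<And>i. i \<in> I \<Longrightarrow> L i holomorphic_on ball 0 (1 + 2 * s)"
     "\<And>i. i \<in> I \<Longrightarrow> Re (L i 0) \<le> ln 4 + k * ln 10"
     "\<And>i x. i \<in> I \<Longrightarrow> norm x \<le> 1 + s \<Longrightarrow>
        - (3 / s) * (A + ln 4 + k * ln (2 / s) + k * ln 2) \<le> Re (L i x)"
     "\<And>i x. i \<in> I \<Longrightarrow> norm x \<le> 1 + s \<Longrightarrow> v x \<noteq> c i \<Longrightarrow>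
        ln (norm (v x - c i)) - k * ln 3 \<le> Re (L i x)"
    by metis
  define E where "E = 3 / s * (A + ln 4 + k * ln (2 / s) + k * ln 2)"
  define M where "M = real (card I)"
  define D1 where "D1 = ln (2 / \<sigma>) + k * ln 3"
  define D where "D = D1 + k"
  define U where "U = (\<lambda>x. \<Sum>i\<in>I. L i x)"
  have logs: "ln 2 \<le> (1::real)" "ln 3 \<le> (2::real)" "ln 4 \<le> (2::real)" "ln 10 \<le> (4::real)"
  proof -
    show l2: "ln 2 \<le> (1::real)" and "ln 3 \<le> (2::real)" using ln_le_minus_one[of 2] ln_le_minus_one[of 3] by auto
    show "ln 4 \<le> (2::real)" using l2 ln_realpow[of 2 2] by simp
    have "ln 10 \<le> ln (16::real)" by simp
    moreover have "ln (16::real) = 4 * ln 2" using ln_realpow[of 2 4] by simp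
    ultimately show "ln 10 \<le> (4::real)" using l2 by linarith
  qed
  have E0: "0 \<le> E" unfolding E_def using s A by (intro mult_nonneg_nonneg add_nonneg_nonneg) auto
  have D1: "0 \<le> D1" unfolding D1_def using \<sigma> by (intro mult_nonneg_nonneg add_nonneg_nonneg) auto
  have "0 < 3 / s * (A + 3 + 2 / s)" using s A by (intro mult_pos_pos add_nonneg_pos) auto
  then have "0 < card I" using I by linarith
  then have M: "0 < M" and fin: "finite I" by (auto simp: M_def card_gt_0_iff)
  \<comment> \<open>This is the origin of the required size of \<open>I\<close>: \<open>E\<close>,
    which contains \<open>A\<close>, must not exceed \<open>k\<close> for each of the
    \<open>M\<close> values.\<close>
  have EM: "E \<le> M * k"
  proof -
    have "A + ln 4 + k * ln (2 / s) + k * ln 2 \<le> k * A + real k * 2 + k * (2 / s) + real k * 1"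
    proof (intro add_mono mult_left_mono)
      show "A \<le> k * A" using k A by (simp add: mult_le_cancel_right1)
      show "ln 4 \<le> real k * 2" using logs k by (smt (verit) of_nat_1 of_nat_mono)
      show "ln (2 / s) \<le> 2 / s" using ln_bound[of "2/s"] s by simp
    qed (use logs in auto)
    also have "\<dots> = (A + 3 + 2 / s) * k" by (simp add: algebra_simps)
    finally have "E \<le> 3 / s * ((A + 3 + 2 / s) * k)" unfolding E_def using s by (intro mult_left_mono) auto
    also have "\<dots> \<le> M * k" unfolding M_def mult.assoc[symmetric] using I by (intro mult_right_mono) auto
    finally show ?thesis .
  qed
  have low: "- (M * D) \<le> Re (U x)" if x: "norm x \<le> 1 + s" for x
  proof -
    let ?bad = "\<lambda>i. norm (v x - c i) < \<sigma> / 2"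
    have each: "(if ?bad i then - E else 0) - D1 \<le> Re (L i x)" if i: "i \<in> I" for i
    proof (cases "?bad i")
      case True
      then show ?thesis using L(3)[OF i x] D1 by (simp add: E_def)
    next
      case False
      then have "ln (\<sigma> / 2) \<le> ln (norm (v x - c i))" using \<sigma> by (subst ln_le_cancel_iff) auto
      moreover have "v x \<noteq> c i" using False \<sigma> by auto
      ultimately have "ln (\<sigma> / 2) - k * ln 3 \<le> Re (L i x)" using L(4)[OF i x] by linarith
      then show ?thesis using False \<sigma> by (simp add: D1_def ln_div)
    qed
    have "card {i \<in> I. ?bad i} \<le> 1"
    proof (rule ccontr)
      assume "\<not> card {i \<in> I. ?bad i} \<le> 1"
      then obtain i j where ij: "i \<in> I" "j \<in> I" "i \<noteq> j" "?bad i" "?bad j"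
        using card_le_Suc0_iff_eq[of "{i \<in> I. ?bad i}"] fin by auto
      have "norm (c i - c j) \<le> norm (v x - c j) + norm (v x - c i)"
        using norm_triangle_ineq4[of "v x - c j" "v x - c i"] by simp
      then show False using sep[OF ij(1-3)] ij(4,5) by linarith
    qed
    then have "card {i \<in> I. ?bad i} * E \<le> 1 * E" using E0 by (intro mult_right_mono) auto
    then have "- (M * D1) - E \<le> (\<Sum>i\<in>I. (if ?bad i then - E else 0) - D1)"
      using fin by (simp add: sum_subtractf sum.If_cases M_def Int_def)
    also have "\<dots> \<le> (\<Sum>i\<in>I. Re (L i x))" by (intro sum_mono each)
    finally show ?thesis using EM by (simp add: U_def D_def distrib_left)
  qed
  have U0: "Re (U 0) \<le> M * (ln 4 + k * ln 10)"
    unfolding U_def M_def Re_sum using sum_bounded_above[of I "\<lambda>i. Re (L i 0)"] L(2) by auto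
  \<comment> \<open>Makes \<open>norm (v 1)\<close> so large that subtracting a value of modulus at
    most 3 loses no more than half of it.\<close>
  have B6: "6 \<le> exp B"
  proof -
    have "40 * 1 \<le> 40 / s * (k + ln (1 / \<sigma>))"
    proof (intro mult_mono)
      have "0 \<le> ln (1 / \<sigma>)" using \<sigma> by simp
      then show "1 \<le> k + ln (1 / \<sigma>)" using k by linarith
    qed (use s in \<open>auto simp: field_simps\<close>)
    then show ?thesis using B exp_ge_add_one_self[of B] by linarith
  qed
  have U1: "M * (B - ln 2 - k * ln 3) \<le> Re (U 1)"
  proof -
    have "B - ln 2 - k * ln 3 \<le> Re (L i 1)" if i: "i \<in> I" for i
    proof -
      have *: "exp B / 2 \<le> norm (v 1 - c i)"
        using norm_triangle_ineq2[of "v 1" "c i"] v1 c(2)[OF i] B6 by simp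
      have ne: "v 1 \<noteq> c i" using * B6 by auto
      have "ln (exp B / 2) \<le> ln (norm (v 1 - c i))" using * exp_gt_zero[of B]
        by (subst ln_le_cancel_iff) (auto intro: less_le_trans[OF _ *])
      moreover have "ln (norm (v 1 - c i)) - k * ln 3 \<le> Re (L i 1)"
        using L(4)[OF i _ ne] s by simp
      ultimately have "ln (exp B / 2) - k * ln 3 \<le> Re (L i 1)" by linarith
      then show ?thesis by (simp add: ln_div)
    qed
    then show ?thesis unfolding U_def M_def Re_sum using sum_bounded_below[of I _ "\<lambda>i. Re (L i 1)"] by blast
  qed
  \<comment> \<open>The lower bound is known on the disc of radius \<open>1 + s\<close> only, so the
    passage from 0 to 1 has \<open>t = 1 / (1 + s)\<close> and the constant
    \<open>(2 + s) / s\<close>.\<close>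
  have "Re (U 1 + of_real (M * D)) \<le> (1 + 1 / (1 + s)) / (1 - 1 / (1 + s)) * Re (U 0 + of_real (M * D))"
  proof (rule harnack_Re[where r = "1 + s" and L = "\<lambda>x. U x + of_real (M * D)"])
    have "U holomorphic_on ball 0 (1 + 2 * s)" unfolding U_def using L(1) by (intro holomorphic_intros) auto
    moreover have "ball 0 (1 + s) \<subseteq> ball (0::complex) (1 + 2 * s)" using s by auto
    ultimately show "(\<lambda>x. U x + of_real (M * D)) holomorphic_on ball 0 (1 + s)"
      by (intro holomorphic_intros) (rule holomorphic_on_subset)
    show "0 \<le> Re (U x + of_real (M * D))" if "x \<in> ball 0 (1 + s)" for x
      using low[of x] that by simp
  qed (use s in auto)
  also have "\<dots> \<le> 3 / s * (M * (ln 4 + k * ln 10) + M * D)"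
  proof (rule mult_mono)
    have "1 + 1 / (1 + s) = (2 + s) / (1 + s)" "1 - 1 / (1 + s) = s / (1 + s)"
      using s by (auto simp: field_simps)
    then have "(1 + 1 / (1 + s)) / (1 - 1 / (1 + s)) = (2 + s) / s" using s by simp
    then show "(1 + 1 / (1 + s)) / (1 - 1 / (1 + s)) \<le> 3 / s" using s by (simp add: divide_right_mono)
    show "Re (U 0 + of_real (M * D)) \<le> M * (ln 4 + k * ln 10) + M * D" using U0 by simp
    show "0 \<le> Re (U 0 + of_real (M * D))" using low[of 0] s by simp
  qed (use s in auto)
  finally have "M * (B - ln 2 - k * ln 3) + M * D \<le> M * (3 / s * (ln 4 + k * ln 10 + D))"
    using U1 by (simp add: algebra_simps)
  moreover have "0 \<le> M * D" using M D1 by (simp add: D_def)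
  ultimately have "M * (B - ln 2 - k * ln 3) \<le> M * (3 / s * (ln 4 + k * ln 10 + D))" by linarith
  then have "B - ln 2 - k * ln 3 \<le> 3 / s * (ln 4 + k * ln 10 + D)"
    using M by (rule mult_left_le_imp_le)
  also have "\<dots> \<le> 3 / s * (2 + k * 4 + (1 + ln (1 / \<sigma>) + k * 2 + k))"
  proof -
    have "ln (2 / \<sigma>) \<le> 1 + ln (1 / \<sigma>)" using \<sigma> logs by (simp add: ln_div)
    moreover have "k * ln 10 \<le> k * (4::real)" "k * ln 3 \<le> k * (2::real)" using logs by (auto intro!: mult_left_mono)
    ultimately show ?thesis unfolding D_def D1_def using s logs by (intro mult_left_mono) auto
  qed
  finally have "B \<le> 3 / s * (3 + k * 7 + ln (1 / \<sigma>)) + ln 2 + k * ln 3" by (simp add: algebra_simps)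
  moreover have "ln 2 + k * ln 3 \<le> 3 / s * k"
  proof -
    have "ln 2 + k * ln 3 \<le> 1 + k * (2::real)" using logs by (intro add_mono mult_left_mono) auto
    also have "\<dots> \<le> 3 * real k" using k by simp
    also have "\<dots> \<le> 3 / s * k" using s by (intro mult_right_mono) (auto simp: field_simps)
    finally show ?thesis .
  qed
  moreover have "3 / s * (3 + k * 7 + ln (1 / \<sigma>)) + 3 / s * k = 3 / s * (3 + real k * 8 + ln (1 / \<sigma>))"
    unfolding distrib_left[symmetric] by (simp add: algebra_simps)
  ultimately have "B \<le> 3 / s * (3 + real k * 8 + ln (1 / \<sigma>))" by linarith
  also have "\<dots> \<le> 3 / s * (11 * (k + ln (1 / \<sigma>)))"
  proof (rule mult_left_mono)
    have *: "3 + a * 8 + l \<le> 11 * (a + l)" if "0 \<le> l" "1 \<le> a" for a l :: real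
      using that by simp
    show "3 + real k * 8 + ln (1 / \<sigma>) \<le> 11 * (k + ln (1 / \<sigma>))"
      by (rule *) (use k \<sigma> in auto)
  qed (use s in simp)
  also have "\<dots> = 33 / s * (k + ln (1 / \<sigma>))" by simp
  also have "\<dots> \<le> 40 / s * (k + ln (1 / \<sigma>))"
    using s \<sigma> by (intro mult_right_mono divide_right_mono add_nonneg_nonneg) auto
  finally show False using B by simp
qed

text \<open>\<open>P\<close> is a polynomial in \<open>v\<close> with coefficients polynomial in
  \<open>x\<close>; evaluating it at the constant polynomial \<open>[:v:]\<close> leaves a
  polynomial in \<open>x\<close>. The two degrees are bounded separately, since the interpolations
  act in one variable at a time.\<close>

definition bideg :: "nat \<Rightarrow> (complex \<Rightarrow> complex \<Rightarrow> complex) \<Rightarrow> bool" where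
  "bideg d Q \<longleftrightarrow> (\<exists>P :: complex poly poly. degree P \<le> d \<and> (\<forall>j. degree (coeff P j) \<le> d) \<and>
     (\<forall>x v. Q x v = poly (poly P [:v:]) x))"

lemma poly_poly_const: "poly (poly P [:v:]) x = (\<Sum>i\<le>degree P. poly (coeff P i) x * v ^ i)"
  for P :: "complex poly poly"
  unfolding poly_altdef[of P] poly_sum poly_mult poly_power by simp

lemma bideg_fst:
  assumes "bideg d Q"
  obtains a where "degree a \<le> d" "\<And>x. Q x c = poly a x"
proof -
  from assms obtain P :: "complex poly poly" where P: "\<And>j. degree (coeff P j) \<le> d"
      "\<And>x v. Q x v = poly (poly P [:v:]) x" unfolding bideg_def by blast
  have "degree (poly P [:c:]) \<le> d"
    unfolding poly_altdef
  proof (rule degree_sum_le)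
    fix i
    have "degree ([:c:] ^ i) = 0" by (metis degree_linear_power degree_pCons_0 poly_const_pow)
    then show "degree (coeff P i * [:c:] ^ i) \<le> d"
      using degree_mult_le[of "coeff P i" "[:c:] ^ i"] P(1)[of i] by simp
  qed simp
  then show ?thesis using that P by blast
qed

lemma bideg_snd:
  assumes "bideg d Q"
  obtains a where "degree a \<le> d" "\<And>v. Q x v = poly a v"
proof -
  from assms obtain P :: "complex poly poly" where P: "degree P \<le> d"
      "\<And>x v. Q x v = poly (poly P [:v:]) x" unfolding bideg_def by blast
  have "degree (\<Sum>i\<le>degree P. monom (poly (coeff P i) x) i) \<le> d"
    by (rule degree_sum_le) (use P(1) in \<open>auto intro: order_trans[OF degree_monom_le]\<close>)
  moreover have "Q x v = poly (\<Sum>i\<le>degree P. monom (poly (coeff P i) x) i) v" for v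
    unfolding P(2) poly_poly_const poly_sum poly_monom ..
  ultimately show ?thesis using that by blast
qed

lemma holomorphic_poly_poly [holomorphic_intros]:
  fixes P :: "complex poly poly"
  assumes "h holomorphic_on A"
  shows "(\<lambda>x. poly (poly P [:h x:]) x) holomorphic_on A"
  unfolding poly_poly_const by (intro holomorphic_intros assms)

text \<open>The factor theorem over the ring of polynomials in \<open>x\<close>. It shows that
  \<open>Q x (h x)\<close> agrees with the polynomial \<open>Q x c\<close> at the preimages of
  \<open>c\<close> under \<open>h\<close>, with multiplicity.\<close>

lemma bideg_diff:
  assumes "bideg d Q"
  obtains S :: "complex poly poly" where "\<And>x v. Q x v - Q x c = (v - c) * poly (poly S [:v:]) x"
proof -
  from assms obtain P :: "complex poly poly" where P: "\<And>x v. Q x v = poly (poly P [:v:]) x"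
    unfolding bideg_def by blast
  have *: "poly P [:v:] - poly P [:c:] = [:v - c:] * poly (synthetic_div P [:c:]) [:v:]" for v
  proof -
    have "poly P [:v:] = poly ([:-[:c:], 1:] * synthetic_div P [:c:] + [:poly P [:c:]:]) [:v:]"
      by (subst synthetic_div_correct') (rule refl)
    then show ?thesis by (simp add: smult_diff_left)
  qed
  show ?thesis
  proof (rule that)
    fix x v
    have "Q x v - Q x c = poly (poly P [:v:] - poly P [:c:]) x" by (simp add: P)
    also have "\<dots> = (v - c) * poly (poly (synthetic_div P [:c:]) [:v:]) x"
      unfolding * by simp
    finally show "Q x v - Q x c = (v - c) * poly (poly (synthetic_div P [:c:]) [:v:]) x" .
  qed
qed

lemma bideg_holomorphic:
  assumes "bideg d Q" "h holomorphic_on A"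
  shows "(\<lambda>x. Q x (h x)) holomorphic_on A"
proof -
  from assms(1) obtain P :: "complex poly poly" where P: "\<And>x v. Q x v = poly (poly P [:v:]) x"
    unfolding bideg_def by blast
  show ?thesis unfolding P by (intro holomorphic_intros assms)
qed

section \<open>Polynomial bounds and the three circles theorem\<close>

text \<open>A count: if \<open>M\<close> of the \<open>M + k\<close> values were taken at most
  \<open>k\<close> times, \<open>few_preimages_growth_bound\<close> would contradict the hypothesis
  on \<open>B\<close>. So at least \<open>k + 1\<close> values are left, the number of nodes that
  Newton interpolation in degree \<open>k\<close> needs, and each of them has the
  \<open>k + 1\<close> preimages that Hermite interpolation needs.\<close>

lemma slice_polynomial_bound:
  fixes h :: "complex \<Rightarrow> complex" and k M :: nat
  assumes s: "0 < s" "s \<le> 1/10" and A: "0 \<le> A" and k: "1 \<le> k" and \<rho>: "0 < \<rho>"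
    and h: "h holomorphic_on ball 0 (1 + 3 * s)"
    and h_small: "\<And>x. norm x \<le> 1/10 \<Longrightarrow> norm (h x) \<le> \<rho>"
    and h_le: "\<And>x. x \<in> ball 0 (1 + 3 * s) \<Longrightarrow> norm (h x) \<le> \<rho> * exp A"
    and h1: "\<rho> * exp B \<le> norm (h 1)"
    and M: "3 / s * (A + 3 + 2 / s) \<le> M"
    and B: "40 / s * (k + ln (M + k)) < B"
    and Q: "bideg k Q" and G: "\<And>x. x \<in> ball 0 (1 + 3 * s) \<Longrightarrow> norm (Q x (h x)) \<le> G"
    and y: "norm y \<le> \<rho>"
  shows "norm (Q 0 y) \<le> (1 + 12 * (M + k)) ^ (k + 1) * ((1 + 8 * (1 + 3 * s) / s) ^ (k + 1) * G)"
proof -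
  let ?R = "1 + 3 * s" and ?N = "M + k"
  \<comment> \<open>The spacing \<open>1 / (M + k)\<close> enters twice: its logarithm in the
    hypothesis on \<open>B\<close>, its reciprocal in the factor \<open>12 * (M + k)\<close> from
    Newton interpolation.\<close>
  define c :: "nat \<Rightarrow> complex" where "c = (\<lambda>i. of_real (2 + real i / ?N))"
  have N: "0 < real ?N" using k by simp
  have c: "2 \<le> norm (c i)" "norm (c i) \<le> 3" if "i < ?N" for i
    using that N by (auto simp: c_def simp del: of_real_add of_nat_add)
  have sep: "1 / ?N \<le> norm (c i - c j)" if "i \<noteq> j" for i j
  proof -
    have "c i - c j = of_real ((real i - real j) / ?N)" by (simp add: c_def diff_divide_distrib)
    then have "norm (c i - c j) = \<bar>real i - real j\<bar> / ?N" by (simp only: norm_of_real) (simp add: abs_divide)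
    moreover have "1 \<le> \<bar>real i - real j\<bar>" using that by linarith
    ultimately show ?thesis using N by (simp add: divide_right_mono)
  qed
  define v where "v = (\<lambda>x. h x / of_real \<rho>)"
  have v: "v holomorphic_on ball 0 ?R" unfolding v_def using h \<rho> by (intro holomorphic_intros) auto
  define few where "few = (\<lambda>i. \<exists>H zs. H holomorphic_on ball 0 ?R \<and> length zs \<le> k \<and>
        (\<forall>z\<in>set zs. norm z \<le> 1 + 2 * s) \<and>
        (\<forall>x\<in>ball 0 ?R. v x - c i = (\<Prod>z\<leftarrow>zs. x - z) * H x) \<and>
        (\<forall>x\<in>cball 0 (1 + 2 * s). H x \<noteq> 0))"
  define I where "I = {i. i < ?N \<and> few i}"
  define J where "J = {i. i < ?N \<and> \<not> few i}"
  have "card I < M"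
  proof (rule ccontr)
    assume "\<not> card I < M"
    then have I: "3 / s * (A + 3 + 2 / s) \<le> card I" using M by linarith
    have "B \<le> 40 / s * (k + ln (1 / (1 / real ?N)))"
    proof (rule few_preimages_growth_bound[OF s A k v _ _ _ _ _ _ _ _ I])
      show "norm (v x) \<le> 1" if "norm x \<le> 1/10" for x
        using h_small[OF that] \<rho> by (simp add: v_def norm_divide)
      show "norm (v x) \<le> exp A" if "x \<in> ball 0 ?R" for x
        using h_le[OF that] \<rho> by (simp add: v_def norm_divide field_simps)
      show "exp B \<le> norm (v 1)" using h1 \<rho> by (simp add: v_def norm_divide field_simps)
      show "\<exists>H zs. H holomorphic_on ball 0 (1 + 3 * s) \<and> length zs \<le> k \<and>
        (\<forall>z\<in>set zs. norm z \<le> 1 + 2 * s) \<and>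
        (\<forall>x\<in>ball 0 (1 + 3 * s). v x - c i = (\<Prod>z\<leftarrow>zs. x - z) * H x) \<and>
        (\<forall>x\<in>cball 0 (1 + 2 * s). H x \<noteq> 0)" if "i \<in> I" for i
        using that unfolding I_def few_def by blast
    qed (use c sep N k in \<open>auto simp: I_def\<close>)
    then show False using B by simp
  qed
  moreover have "card I + card J = ?N"
  proof -
    have "card (I \<union> J) = card I + card J" by (rule card_Un_disjoint) (auto simp: I_def J_def)
    moreover have "I \<union> J = {..<?N}" by (auto simp: I_def J_def)
    ultimately show ?thesis by simp
  qed
  ultimately have "k + 1 \<le> card J" by simp
  then obtain J' where J': "J' \<subseteq> J" "card J' = k + 1" by (rule obtain_subset_with_card_n)
  then have "finite J'" by (intro card_ge_0_finite) simp
  then obtain js where js: "set js = J'" "distinct js" using finite_distinct_list by blast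
  have len: "length js = k + 1" using js J' distinct_card by metis
  define d where "d = (\<lambda>i. of_real \<rho> * c i)"
  have d_diff: "norm (d i - d j) = \<rho> * norm (c i - c j)" for i j
    using \<rho> by (simp add: d_def norm_mult flip: right_diff_distrib)
  have G0: "0 \<le> G" using order_trans[OF norm_ge_zero G[of 0]] s by simp
  define G' where "G' = (1 + 8 * ?R / s) ^ (k + 1) * G"
  have G'0: "0 \<le> G'" unfolding G'_def using G0 s by simp
  have good: "norm (Q 0 (d i)) \<le> G'" if i: "i \<in> J" for i
  proof -
    have "(\<lambda>x. v x - c i) holomorphic_on ball 0 ?R" by (intro holomorphic_intros v)
    from factor_zeros[OF _ this, of "1 + 2 * s" "k + 1"] s obtain zs H where
      H: "H holomorphic_on ball 0 ?R" "\<forall>z\<in>set zs. norm z \<le> 1 + 2 * s"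
        "\<forall>x\<in>ball 0 ?R. v x - c i = (\<Prod>z\<leftarrow>zs. x - z) * H x" "length zs \<le> k + 1"
        "length zs = k + 1 \<or> (\<forall>x\<in>cball 0 (1 + 2 * s). H x \<noteq> 0)" by auto
    have lz: "length zs = k + 1"
    proof (rule ccontr)
      assume "length zs \<noteq> k + 1"
      then have "few i" unfolding few_def using H by (intro exI[of _ H] exI[of _ zs]) auto
      then show False using i by (simp add: J_def)
    qed
    obtain S :: "complex poly poly" where S: "\<And>x v. Q x v - Q x (d i) = (v - d i) * poly (poly S [:v:]) x"
      using bideg_diff[OF Q] by blast
    obtain a where a: "degree a \<le> k" "\<And>x. Q x (d i) = poly a x" using bideg_fst[OF Q] by blast
    \<comment> \<open>Up to sign the cofactor that exhibits \<open>Q x (d i)\<close>, that is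
      \<open>a\<close>, as the Hermite interpolant of \<open>Q x (h x)\<close> at \<open>zs\<close>.
      The nodes keep distance \<open>s\<close> from the boundary, which is the denominator in the
      bound.\<close>
    define H' where "H' = (\<lambda>x. - (of_real \<rho> * H x * poly (poly S [:h x:]) x))"
    have "norm (poly a 0) \<le> (1 + 8 * ?R / (?R - (1 + 2 * s))) ^ length zs * G"
    proof (rule hermite_interpolation_bound)
      show "(\<lambda>x. - H' x) holomorphic_on ball 0 ?R"
        unfolding H'_def by (intro holomorphic_intros H h)
      show "norm (poly a x + (\<Prod>z\<leftarrow>zs. x - z) * (- H' x)) \<le> G" if x: "x \<in> ball 0 ?R" for x
      proof -
        have "h x - d i = of_real \<rho> * (v x - c i)" using \<rho> by (simp add: v_def d_def right_diff_distrib)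
        then have "Q x (h x) - poly a x = of_real \<rho> * ((\<Prod>z\<leftarrow>zs. x - z) * H x) * poly (poly S [:h x:]) x"
          using S[of x "h x"] a(2)[of x] H(3) x by simp
        then have "poly a x + (\<Prod>z\<leftarrow>zs. x - z) * (- H' x) = Q x (h x)"
          by (simp add: H'_def algebra_simps)
        then show ?thesis using G[OF x] by simp
      qed
    qed (use s H lz a in auto)
    then show ?thesis using a(2)[of 0] lz by (simp add: G'_def)
  qed
  obtain p where p: "degree p \<le> k" "\<And>w. Q 0 w = poly p w" using bideg_snd[OF Q] by blast
  have "norm (poly p y) \<le> (1 + 4 * (3 * \<rho>) / (\<rho> / ?N)) ^ length (map d js) * G'"
  proof (rule newton_interpolation_bound)
    show "0 < \<rho> / ?N" using \<rho> N by simp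
    have inj: "d i \<noteq> d j" if "i \<noteq> j" for i j
    proof -
      have "0 < norm (d i - d j)" unfolding d_diff using sep[OF that] \<rho> N
        by (intro mult_pos_pos) (auto intro: less_le_trans[of _ "1 / real ?N"])
      then show ?thesis by auto
    qed
    show "distinct (map d js)" using js(2) inj by (auto simp: distinct_map inj_on_def)
    have lt: "i < ?N" "i \<in> J" if "i \<in> set js" for i using that js J' by (auto simp: J_def)
    show "norm w \<le> 3 * \<rho>" if "w \<in> set (map d js)" for w
      using that c(2) lt \<rho> by (auto simp: d_def norm_mult)
    show "\<rho> / ?N \<le> norm (w - w')" if "w \<in> set (map d js)" "w' \<in> set (map d js)" "w \<noteq> w'" for w w'
    proof -
      from that obtain i j where ij: "w = d i" "w' = d j" "i \<noteq> j" by auto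
      have "\<rho> * (1 / ?N) \<le> \<rho> * norm (c i - c j)"
        using sep[OF ij(3)] \<rho> by (intro mult_left_mono) auto
      then show ?thesis unfolding ij d_diff by simp
    qed
    show "norm (poly p w) \<le> G'" if "w \<in> set (map d js)" for w
      using that good lt p(2) by auto
  qed (use p len y \<rho> G'0 in auto)
  moreover have "1 + 4 * (3 * \<rho>) / (\<rho> / ?N) = 1 + 12 * (M + k)" using \<rho> N by (simp add: field_simps)
  ultimately show ?thesis using len by (simp only: G'_def p(2)[of y] length_map of_nat_power)
qed

text \<open>Pulled back by \<open>exp\<close>, the annulus becomes a strip on which the function is periodic in the
  imaginary direction, so that its modulus attains its maximum there.\<close>

lemma three_circles_weighted:
  fixes g :: "complex \<Rightarrow> complex"
  assumes g: "g holomorphic_on UNIV" and t: "t1 \<le> t" "t \<le> t2"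
    and g1: "\<And>x. norm x = exp t1 \<Longrightarrow> exp (a * t1) * norm (g x) \<le> B"
    and g2: "\<And>x. norm x = exp t2 \<Longrightarrow> exp (a * t2) * norm (g x) \<le> B"
    and x: "norm x = exp t"
  shows "exp (a * t) * norm (g x) \<le> B"
proof -
  \<comment> \<open>The exponential factor stands for the power of \<open>x\<close> with real
    exponent \<open>a\<close>, which is multivalued on the annulus but not on the strip; its modulus
    is still periodic.\<close>
  define h where "h = (\<lambda>\<zeta>. exp (of_real a * \<zeta>) * g (exp \<zeta>))"
  have hol: "h holomorphic_on UNIV"
  proof -
    have "(g \<circ> exp) holomorphic_on UNIV"
      by (rule holomorphic_on_compose_gen[OF _ g]) (auto intro: holomorphic_intros)
    then show ?thesis unfolding h_def o_def by (intro holomorphic_intros)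
  qed
  have nh: "norm (h \<zeta>) = exp (a * Re \<zeta>) * norm (g (exp \<zeta>))" for \<zeta>
    by (simp add: h_def norm_mult)
  define K where "K = cbox (Complex t1 0) (Complex t2 (2 * pi))"
  have strip: "\<exists>\<zeta>'\<in>K. norm (h \<zeta>') = norm (h \<zeta>) \<and> Re \<zeta>' = Re \<zeta>" if "t1 \<le> Re \<zeta>" "Re \<zeta> \<le> t2" for \<zeta>
  proof -
    define \<theta> where "\<theta> = Arg2pi (exp \<zeta>)"
    have "0 \<le> \<theta>" "\<theta> < 2 * pi" using Arg2pi by (auto simp: \<theta>_def)
    have "exp (Complex (Re \<zeta>) \<theta>) = exp \<zeta>"
    proof -
      have "exp (Complex (Re \<zeta>) \<theta>) = of_real (exp (Re \<zeta>)) * exp (\<i> * of_real \<theta>)"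
        by (simp add: Complex_eq exp_add exp_of_real)
      also have "\<dots> = exp \<zeta>" using Arg2pi_eq[of "exp \<zeta>"] by (simp only: \<theta>_def norm_exp_eq_Re)
      finally show ?thesis .
    qed
    then have "norm (h (Complex (Re \<zeta>) \<theta>)) = norm (h \<zeta>)" unfolding nh by simp
    then show ?thesis using that \<open>0 \<le> \<theta>\<close> \<open>\<theta> < 2 * pi\<close>
      by (intro bexI[of _ "Complex (Re \<zeta>) \<theta>"]) (auto simp: K_def in_cbox_complex_iff)
  qed
  have edge: "norm (h \<zeta>) \<le> B" if "Re \<zeta> = t1 \<or> Re \<zeta> = t2" for \<zeta>
    using that g1[of "exp \<zeta>"] g2[of "exp \<zeta>"] unfolding nh by auto
  have "compact K" "K \<noteq> {}" using t by (auto simp: K_def box_ne_empty Basis_complex_def inner_complex_def)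
  moreover have "continuous_on K (\<lambda>\<zeta>. norm (h \<zeta>))"
    using hol holomorphic_on_imp_continuous_on continuous_on_subset by (intro continuous_intros) blast
  ultimately obtain \<zeta>0 where z0: "\<zeta>0 \<in> K" "\<And>\<zeta>. \<zeta> \<in> K \<Longrightarrow> norm (h \<zeta>) \<le> norm (h \<zeta>0)"
    using continuous_attains_sup[of K] by metis
  have max: "norm (h \<zeta>) \<le> norm (h \<zeta>0)" if "t1 \<le> Re \<zeta>" "Re \<zeta> \<le> t2" for \<zeta>
    using strip[OF that] z0(2) by metis
  have "norm (h \<zeta>0) \<le> B"
  proof (cases "Re \<zeta>0 = t1 \<or> Re \<zeta>0 = t2")
    case True
    then show ?thesis by (rule edge)
  next
    case False
    \<comment> \<open>A maximum in the open strip forces \<open>h\<close> to be constant there; by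
      continuity the constant is a value on the edge, where the bound is known.\<close>
    define S where "S = {\<zeta>::complex. t1 < Re \<zeta> \<and> Re \<zeta> < t2}"
    have S: "S = {\<zeta>. t1 < Re \<zeta>} \<inter> {\<zeta>. Re \<zeta> < t2}" by (auto simp: S_def)
    have zS: "\<zeta>0 \<in> S" using z0(1) False by (auto simp: K_def S_def in_cbox_complex_iff)
    have opS: "open S" unfolding S by (intro open_Int open_halfspace_Re_gt open_halfspace_Re_lt)
    have "convex S" unfolding S by (intro convex_Int convex_halfspace_Re_gt convex_halfspace_Re_lt)
    then have "connected S" by (rule convex_connected)
    have "h constant_on S"
    proof (rule maximum_modulus_principle[OF _ opS \<open>connected S\<close> opS _ zS])
      show "h holomorphic_on S" using hol holomorphic_on_subset by blast
      show "norm (h z) \<le> norm (h \<zeta>0)" if "z \<in> S" for z using max[of z] that by (auto simp: S_def)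
    qed auto
    then have const: "h z = h \<zeta>0" if "z \<in> S" for z using that zS unfolding constant_on_def by metis
    have t12: "t1 < t2" using zS by (auto simp: S_def)
    have "((\<lambda>\<tau>. h (of_real \<tau>)) \<longlongrightarrow> h (of_real t1)) (at_right t1)"
    proof -
      have "isCont h (of_real t1)"
        using hol holomorphic_on_imp_continuous_on continuous_on_eq_continuous_at by blast
      moreover have "((\<lambda>\<tau>. of_real \<tau>) \<longlongrightarrow> (of_real t1 :: complex)) (at_right t1)"
        by (intro tendsto_intros)
      ultimately show ?thesis using isCont_tendsto_compose by blast
    qed
    moreover have "\<forall>\<^sub>F \<tau> in at_right t1. h (of_real \<tau>) = h \<zeta>0"
      using eventually_at_right_real[OF t12] by eventually_elim (auto intro!: const simp: S_def)
    ultimately have "((\<lambda>\<tau>. h \<zeta>0) \<longlongrightarrow> h (of_real t1)) (at_right t1)"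
      by (rule Lim_transform_eventually)
    then have "h \<zeta>0 = h (of_real t1)" by (simp add: tendsto_const_iff)
    then show ?thesis using edge[of "of_real t1"] by simp
  qed
  have "x \<noteq> 0" using x by auto
  then have "exp (Ln x) = x" "Re (Ln x) = t" using x by auto
  then have "exp (a * t) * norm (g x) = norm (h (Ln x))" by (simp add: nh)
  also have "\<dots> \<le> norm (h \<zeta>0)" using max[of "Ln x"] \<open>Re (Ln x) = t\<close> t by simp
  finally show ?thesis using \<open>norm (h \<zeta>0) \<le> B\<close> by simp
qed

lemma three_circles:
  fixes g :: "complex \<Rightarrow> complex"
  assumes g: "g holomorphic_on UNIV" and u: "0 \<le> u" "u \<le> 1" and t: "t1 < t2"
    and m: "0 < m1" "0 < m2"
    and g1: "\<And>x. norm x = exp t1 \<Longrightarrow> norm (g x) \<le> m1"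
    and g2: "\<And>x. norm x = exp t2 \<Longrightarrow> norm (g x) \<le> m2"
    and x: "norm x = exp ((1 - u) * t1 + u * t2)"
  shows "norm (g x) \<le> exp ((1 - u) * ln m1 + u * ln m2)"
proof -
  \<comment> \<open>With this exponent the weighted bounds on the two circles coincide.\<close>
  define a where "a = (ln m1 - ln m2) / (t2 - t1)"
  define t where "t = (1 - u) * t1 + u * t2"
  have t_eq: "t = t1 + u * (t2 - t1)" by (simp add: t_def algebra_simps)
  have at: "a * (t2 - t1) = ln m1 - ln m2" using t by (simp add: a_def)
  have "exp (a * t) * norm (g x) \<le> exp (a * t1 + ln m1)"
  proof (rule three_circles_weighted[OF g])
    show "t1 \<le> t" using u t unfolding t_eq by simp
    have "u * (t2 - t1) \<le> 1 * (t2 - t1)" using u t by (intro mult_right_mono) auto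
    then show "t \<le> t2" unfolding t_eq by simp
    show "norm x = exp t" using x by (simp add: t_def)
    show "exp (a * t1) * norm (g x) \<le> exp (a * t1 + ln m1)" if "norm x = exp t1" for x
      using g1[OF that] m by (simp add: exp_add)
    show "exp (a * t2) * norm (g x) \<le> exp (a * t1 + ln m1)" if "norm x = exp t2" for x
    proof -
      have "exp (a * t1 + ln m1) = exp (a * t2 + ln m2)" using at by (simp add: algebra_simps)
      then show ?thesis using g2[OF that] m by (simp add: exp_add)
    qed
  qed
  then have "norm (g x) \<le> exp (a * t1 + ln m1) / exp (a * t)" by (simp add: field_simps)
  also have "\<dots> = exp (a * t1 + ln m1 - a * t)" by (simp add: exp_diff)
  also have "a * t1 + ln m1 - a * t = ln m1 - u * (a * (t2 - t1))" by (simp add: t_eq algebra_simps)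
  also have "\<dots> = (1 - u) * ln m1 + u * ln m2" unfolding at by (simp add: algebra_simps)
  finally show ?thesis .
qed

text \<open>Cauchy's estimates bound the coefficient of index \<open>i\<close> by
  \<open>B / r ^ i\<close>. The factor \<open>k + 1\<close> from the summation is later absorbed in
  an exponential of \<open>k\<close>.\<close>

lemma poly_growth_bound:
  fixes p :: "complex poly"
  assumes "degree p \<le> k" "0 < r" and B: "\<And>x. norm x \<le> r \<Longrightarrow> norm (poly p x) \<le> B"
    and y: "norm y \<le> R" "r \<le> R"
  shows "norm (poly p y) \<le> (k + 1) * (R / r) ^ k * B"
proof -
  have B0: "0 \<le> B" using order_trans[OF norm_ge_zero B[of 0]] \<open>0 < r\<close> by simp
  have co: "norm (coeff p i) \<le> B / r ^ i" for i
  proof -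
    have "norm ((deriv ^^ i) (poly p) 0) \<le> fact i * B / r ^ i"
      by (rule Cauchy_inequality) (use assms in \<open>auto intro!: holomorphic_intros continuous_intros\<close>)
    moreover have "(deriv ^^ i) (poly p) 0 = fact i * coeff p i"
    proof -
      have d: "(deriv ^^ i) (poly p) = poly ((pderiv ^^ i) p)" for i
      proof (induction i)
        case (Suc i)
        have "(deriv ^^ Suc i) (poly p) = deriv (poly ((pderiv ^^ i) p))" by (simp add: Suc)
        also have "\<dots> = poly ((pderiv ^^ Suc i) p)"
          using poly_DERIV by (auto intro!: ext DERIV_imp_deriv)
        finally show ?case .
      qed simp
      show ?thesis unfolding d poly_0_coeff_0 coeff_higher_pderiv by (simp add: pochhammer_fact)
    qed
    ultimately have "fact i * norm (coeff p i) \<le> fact i * (B / r ^ i)" by (simp add: norm_mult)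
    then show ?thesis by (subst (asm) mult_le_cancel_left_pos) auto
  qed
  have "norm (poly p y) \<le> (\<Sum>i\<le>degree p. norm (coeff p i * y ^ i))"
    unfolding poly_altdef by (rule norm_sum)
  also have "\<dots> \<le> (\<Sum>i\<le>degree p. (R / r) ^ k * B)"
  proof (rule sum_mono)
    fix i assume "i \<in> {..degree p}"
    then have i: "i \<le> k" using assms(1) by simp
    have "norm (coeff p i * y ^ i) \<le> B / r ^ i * R ^ i"
      unfolding norm_mult norm_power using co y B0 \<open>0 < r\<close> by (intro mult_mono power_mono) auto
    also have "\<dots> = (R / r) ^ i * B" by (simp add: power_divide)
    also have "\<dots> \<le> (R / r) ^ k * B" using i y \<open>0 < r\<close> B0
      by (intro mult_right_mono power_increasing) auto
    finally show "norm (coeff p i * y ^ i) \<le> (R / r) ^ k * B" .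
  qed
  also have "\<dots> = (degree p + 1) * ((R / r) ^ k * B)" by simp
  also have "\<dots> \<le> (k + 1) * ((R / r) ^ k * B)"
    using assms B0 by (intro mult_right_mono) auto
  finally show ?thesis by (simp add: mult.assoc add.commute)
qed

section \<open>Functions on complex coordinate spaces and their slices\<close>

notation Matrix.vec_index (infixl \<open>!\<^sub>v\<close> 100)

text \<open>Apart from complex lines this also provides vector arithmetic:
  \<open>line n a b (- 1)\<close> is the difference of \<open>a\<close> and \<open>b\<close>, and
  \<open>line n w0 u 1\<close> is the translate of \<open>u\<close> by \<open>w0\<close>.\<close>

definition line :: "nat \<Rightarrow> cvec \<Rightarrow> cvec \<Rightarrow> complex \<Rightarrow> cvec" where
  "line n a b x = Matrix.vec n (\<lambda>i. a !\<^sub>v i + x * b !\<^sub>v i)"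

lemma line_carrier [simp]: "line n a b x \<in> carrier_vec n"
  by (simp add: line_def)

lemma line_index [simp]: "i < n \<Longrightarrow> line n a b x !\<^sub>v i = a !\<^sub>v i + x * b !\<^sub>v i"
  by (simp add: line_def)

lemma dim_line [simp]: "dim_vec (line n a b x) = n"
  by (simp add: line_def)

lemma carrier_vec_eqI:
  fixes x y :: cvec
  assumes "x \<in> carrier_vec n" "y \<in> carrier_vec n" "\<And>i. i < n \<Longrightarrow> x !\<^sub>v i = y !\<^sub>v i"
  shows "x = y"
  using assms by (intro eq_vecI) auto

lemma line_zero [simp]: "a \<in> carrier_vec n \<Longrightarrow> line n a b 0 = a"
  by (rule carrier_vec_eqI[of _ n]) auto

lemma line_origin_one [simp]: "b \<in> carrier_vec n \<Longrightarrow> line n (0\<^sub>v n) b 1 = b"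
  by (rule carrier_vec_eqI[of _ n]) auto

lemma euclid_norm_nonneg [simp]: "0 \<le> euclid_norm z"
  by (simp add: euclid_norm_def L2_set_nonneg)

lemma euclid_norm_carrier: "z \<in> carrier_vec n \<Longrightarrow> euclid_norm z = L2_set (\<lambda>i. cmod (z !\<^sub>v i)) {..<n}"
  by (auto simp: euclid_norm_def)

lemma cmod_index_le: "z \<in> carrier_vec n \<Longrightarrow> i < n \<Longrightarrow> cmod (z !\<^sub>v i) \<le> euclid_norm z"
  unfolding euclid_norm_carrier by (rule member_le_L2_set) auto

lemma euclid_norm_le_sum: "z \<in> carrier_vec n \<Longrightarrow> euclid_norm z \<le> (\<Sum>i<n. cmod (z !\<^sub>v i))"
  unfolding euclid_norm_carrier by (rule L2_set_le_sum) auto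

lemma euclid_norm_zero [simp]: "euclid_norm (0\<^sub>v n) = 0"
  by (simp add: euclid_norm_def L2_set_def)

lemma euclid_norm_line_le:
  assumes "a \<in> carrier_vec n" "b \<in> carrier_vec n"
  shows "euclid_norm (line n a b x) \<le> euclid_norm a + cmod x * euclid_norm b"
proof -
  have "euclid_norm (line n a b x) \<le> L2_set (\<lambda>i. cmod (a !\<^sub>v i) + cmod x * cmod (b !\<^sub>v i)) {..<n}"
    unfolding euclid_norm_carrier[OF line_carrier]
    by (rule L2_set_mono) (auto simp: norm_mult intro: order_trans[OF norm_triangle_ineq])
  also have "\<dots> \<le> L2_set (\<lambda>i. cmod (a !\<^sub>v i)) {..<n} + L2_set (\<lambda>i. cmod x * cmod (b !\<^sub>v i)) {..<n}"
    by (rule L2_set_triangle_ineq)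
  also have "\<dots> = euclid_norm a + cmod x * euclid_norm b"
    by (simp add: euclid_norm_carrier[OF assms(1)] euclid_norm_carrier[OF assms(2)] L2_set_right_distrib)
  finally show ?thesis .
qed

lemma euclid_norm_line_origin:
  assumes "b \<in> carrier_vec n"
  shows "euclid_norm (line n (0\<^sub>v n) b x) = cmod x * euclid_norm b"
proof -
  have "euclid_norm (line n (0\<^sub>v n) b x) = L2_set (\<lambda>i. cmod x * cmod (b !\<^sub>v i)) {..<n}"
    unfolding euclid_norm_carrier[OF line_carrier] by (rule L2_set_cong) (auto simp: norm_mult)
  then show ?thesis by (simp add: euclid_norm_carrier[OF assms] L2_set_right_distrib)
qed

text \<open>Compactness is taken from the space of sequences: padded with zeros, the ball lies in a
  product of discs of radius \<open>r\<close> over all indices, compact by Tychonoff's theorem, and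
  the neighbourhoods constrain only the first \<open>n\<close> coordinates.\<close>

lemma locally_bounded_imp_bounded:
  fixes f :: "cvec \<Rightarrow> complex"
  assumes loc: "\<And>z. z \<in> carrier_vec n \<Longrightarrow>
    \<exists>\<delta>>0. \<exists>B. \<forall>w\<in>carrier_vec n. (\<forall>i<n. cmod (w !\<^sub>v i - z !\<^sub>v i) < \<delta>) \<longrightarrow> cmod (f w) \<le> B"
  shows "\<exists>B. \<forall>z\<in>carrier_vec n. euclid_norm z \<le> r \<longrightarrow> cmod (f z) \<le> B"
proof -
  define K where "K = (UNIV :: nat set) \<rightarrow>\<^sub>E cball (0::complex) r"
  have "compactin (product_topology (\<lambda>i. euclidean) UNIV) K"
    unfolding K_def compactin_PiE by (auto simp: compactin_euclidean_iff)
  then have "compact K" by (simp add: euclidean_product_topology compactin_euclidean_iff)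
  have "\<forall>z\<in>carrier_vec n. \<exists>d B. d > 0 \<and>
      (\<forall>w\<in>carrier_vec n. (\<forall>i<n. cmod (w !\<^sub>v i - z !\<^sub>v i) < d) \<longrightarrow> cmod (f w) \<le> B)"
    using loc by blast
  then obtain \<delta> B where dB: "\<And>z. z \<in> carrier_vec n \<Longrightarrow> \<delta> z > 0"
    "\<And>z w. z \<in> carrier_vec n \<Longrightarrow> w \<in> carrier_vec n \<Longrightarrow> (\<forall>i<n. cmod (w !\<^sub>v i - z !\<^sub>v i) < \<delta> z) \<Longrightarrow>
       cmod (f w) \<le> B z" by metis
  define V where "V = (\<lambda>z. {x :: nat \<Rightarrow> complex. \<forall>i\<in>{..<n}. cmod (x i - z !\<^sub>v i) < \<delta> z})"
  have opn: "open (V z)" for z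
  proof -
    have "V z = (\<Inter>i\<in>{..<n}. {x. cmod (x i - z !\<^sub>v i) < \<delta> z})" by (auto simp: V_def)
    moreover have "open {x :: nat \<Rightarrow> complex. cmod (x i - z !\<^sub>v i) < \<delta> z}" for i
    proof (rule open_Collect_less)
      show "continuous_on UNIV (\<lambda>x :: nat \<Rightarrow> complex. cmod (x i - z !\<^sub>v i))"
        by (intro continuous_on_norm continuous_on_diff continuous_on_product_coordinates continuous_on_const)
    qed simp
    ultimately show ?thesis by auto
  qed
  have "K \<subseteq> (\<Union>z\<in>carrier_vec n. V z)"
  proof
    fix x assume "x \<in> K"
    then show "x \<in> (\<Union>z\<in>carrier_vec n. V z)"
      using dB(1)[of "Matrix.vec n x"] by (intro UN_I[of "Matrix.vec n x"]) (auto simp: V_def)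
  qed
  then obtain C where C: "C \<subseteq> carrier_vec n" "finite C" "K \<subseteq> (\<Union>z\<in>C. V z)"
    by (rule compactE_image[OF \<open>compact K\<close> opn])
  have "cmod (f z) \<le> (\<Sum>z\<in>C. \<bar>B z\<bar>)" if z: "z \<in> carrier_vec n" "euclid_norm z \<le> r" for z
  proof -
    have r: "0 \<le> r" using order_trans[OF euclid_norm_nonneg z(2)] .
    have "(\<lambda>i. if i < n then z !\<^sub>v i else 0) \<in> K"
      using order_trans[OF cmod_index_le[OF z(1)] z(2)] r by (auto simp: K_def)
    then obtain w where w: "w \<in> C" "(\<lambda>i. if i < n then z !\<^sub>v i else 0) \<in> V w" using C by auto
    then have "cmod (f z) \<le> B w" using dB(2)[of w z] z C by (auto simp: V_def)
    also have "\<dots> \<le> \<bar>B w\<bar>" by simp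
    also have "\<dots> \<le> (\<Sum>z\<in>C. \<bar>B z\<bar>)" using w C by (intro member_le_sum) auto
    finally show ?thesis .
  qed
  then show ?thesis by blast
qed

text \<open>The form in which entire functions enter the estimates. Holomorphy on lines and
  boundedness on balls pass to translates and to polynomials in \<open>w\<close> and
  \<open>f w\<close> by arguments in one variable.\<close>

definition slice_entire :: "nat \<Rightarrow> (cvec \<Rightarrow> complex) \<Rightarrow> bool" where
  "slice_entire n G \<longleftrightarrow>
    (\<forall>a\<in>carrier_vec n. \<forall>b\<in>carrier_vec n. (\<lambda>x. G (line n a b x)) holomorphic_on UNIV) \<and>
    (\<forall>r. \<exists>B. \<forall>z\<in>carrier_vec n. euclid_norm z \<le> r \<longrightarrow> cmod (G z) \<le> B)"

lemma slice_entireD: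
  assumes "slice_entire n G" "a \<in> carrier_vec n" "b \<in> carrier_vec n"
  shows "(\<lambda>x. G (line n a b x)) holomorphic_on A"
  using assms holomorphic_on_subset unfolding slice_entire_def by blast

lemma entire_imp_slice_entire:
  assumes f: "entire n f"
  shows "slice_entire n f"
  unfolding slice_entire_def
proof (intro conjI ballI allI)
  fix u b :: cvec assume u: "u \<in> carrier_vec n" and b: "b \<in> carrier_vec n"
  have "(\<lambda>x. f (line n u b x)) field_differentiable at x" for x
  proof -
    obtain a where a: "a \<in> carrier_vec n"
      "\<And>\<epsilon>. \<epsilon> > 0 \<Longrightarrow> \<exists>\<delta>>0. \<forall>h\<in>carrier_vec n. euclid_norm h < \<delta> \<longrightarrow>
       cmod (f (line n u b x + h) - f (line n u b x) - (\<Sum>i<n. a !\<^sub>v i * h !\<^sub>v i)) \<le> \<epsilon> * euclid_norm h"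
      using f line_carrier[of n u b x] unfolding entire_def by blast
    have "((\<lambda>x. f (line n u b x)) has_derivative (\<lambda>y::complex. y * (\<Sum>i<n. a !\<^sub>v i * b !\<^sub>v i))) (at x)"
      unfolding has_derivative_at_alt
    proof (intro conjI allI impI)
      show "bounded_linear (\<lambda>y::complex. y * (\<Sum>i<n. a !\<^sub>v i * b !\<^sub>v i))" by (rule bounded_linear_mult_left)
      fix e :: real assume e: "e > 0"
      \<comment> \<open>Adding 1 keeps the denominator positive when \<open>b\<close> is
        zero.\<close>
      define N where "N = euclid_norm b + 1"
      have N: "N > 0" by (simp add: N_def add_nonneg_pos)
      obtain \<delta> where d: "\<delta> > 0" "\<And>h. h \<in> carrier_vec n \<Longrightarrow> euclid_norm h < \<delta> \<Longrightarrow>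
          cmod (f (line n u b x + h) - f (line n u b x) - (\<Sum>i<n. a !\<^sub>v i * h !\<^sub>v i)) \<le> e / N * euclid_norm h"
        using a(2)[of "e / N"] e N by auto
      show "\<exists>d>0. \<forall>y. norm (y - x) < d \<longrightarrow>
          norm (f (line n u b y) - f (line n u b x) - (y - x) * (\<Sum>i<n. a !\<^sub>v i * b !\<^sub>v i)) \<le> e * norm (y - x)"
      proof (intro exI conjI allI impI)
        show "0 < \<delta> / N" using d N by simp
        fix y assume y: "norm (y - x) < \<delta> / N"
        define h where "h = line n (0\<^sub>v n) b (y - x)"
        have nh: "euclid_norm h \<le> cmod (y - x) * N"
          unfolding h_def euclid_norm_line_origin[OF b] N_def by (intro mult_left_mono) auto
        have "euclid_norm h < \<delta>" using nh y N by (simp add: field_simps)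
        then have "cmod (f (line n u b x + h) - f (line n u b x) - (\<Sum>i<n. a !\<^sub>v i * h !\<^sub>v i)) \<le> e / N * euclid_norm h"
          using d(2)[of h] by (simp add: h_def)
        also have "\<dots> \<le> e / N * (cmod (y - x) * N)" using nh e N by (intro mult_left_mono) auto
        also have "\<dots> = e * norm (y - x)" using N by simp
        also have "line n u b x + h = line n u b y"
          by (rule carrier_vec_eqI[of _ n]) (auto simp: h_def algebra_simps)
        also have "(\<Sum>i<n. a !\<^sub>v i * h !\<^sub>v i) = (y - x) * (\<Sum>i<n. a !\<^sub>v i * b !\<^sub>v i)"
          unfolding sum_distrib_left by (rule sum.cong) (auto simp: h_def)
        finally show "norm (f (line n u b y) - f (line n u b x) - (y - x) * (\<Sum>i<n. a !\<^sub>v i * b !\<^sub>v i))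
            \<le> e * norm (y - x)" .
      qed
    qed
    then show ?thesis
      unfolding field_differentiable_def has_field_derivative_def
      by (metis (no_types, lifting) ext mult.commute)
  qed
  then show "(\<lambda>x. f (line n u b x)) holomorphic_on UNIV"
    by (simp add: holomorphic_on_def field_differentiable_at_within)
next
  fix r
  show "\<exists>B. \<forall>z\<in>carrier_vec n. euclid_norm z \<le> r \<longrightarrow> cmod (f z) \<le> B"
  proof (rule locally_bounded_imp_bounded)
    fix z :: cvec assume z: "z \<in> carrier_vec n"
    obtain a where a: "a \<in> carrier_vec n"
      "\<And>\<epsilon>. \<epsilon> > 0 \<Longrightarrow> \<exists>\<delta>>0. \<forall>h\<in>carrier_vec n. euclid_norm h < \<delta> \<longrightarrow>
       cmod (f (z + h) - f z - (\<Sum>i<n. a !\<^sub>v i * h !\<^sub>v i)) \<le> \<epsilon> * euclid_norm h"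
      using f z unfolding entire_def by blast
    from a(2)[of 1] obtain \<delta> where d: "\<delta> > 0" "\<And>h. h \<in> carrier_vec n \<Longrightarrow> euclid_norm h < \<delta> \<Longrightarrow>
       cmod (f (z + h) - f z - (\<Sum>i<n. a !\<^sub>v i * h !\<^sub>v i)) \<le> 1 * euclid_norm h"
      by auto
    define S where "S = (\<Sum>i<n. cmod (a !\<^sub>v i))"
    have S: "0 \<le> S" unfolding S_def by (intro sum_nonneg) auto
    show "\<exists>\<delta>>0. \<exists>B. \<forall>w\<in>carrier_vec n. (\<forall>i<n. cmod (w !\<^sub>v i - z !\<^sub>v i) < \<delta>) \<longrightarrow> cmod (f w) \<le> B"
    proof (intro exI conjI ballI impI)
      \<comment> \<open>The norm is at most the sum over \<open>n\<close> coordinates, and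
        \<open>n + 1\<close> also covers \<open>n = 0\<close> and makes the inequality
        strict.\<close>
      show "0 < \<delta> / (n + 1)" using d by simp
      fix w assume w: "w \<in> carrier_vec n" "\<forall>i<n. cmod (w !\<^sub>v i - z !\<^sub>v i) < \<delta> / (n + 1)"
      define h where "h = line n w z (- 1)"
      have hi: "cmod (h !\<^sub>v i) < \<delta> / (n + 1)" if "i < n" for i using w that by (simp add: h_def)
      have "euclid_norm h \<le> (\<Sum>i<n. cmod (h !\<^sub>v i))" by (rule euclid_norm_le_sum) (simp add: h_def)
      also have "\<dots> \<le> n * (\<delta> / (n + 1))"
        using sum_bounded_above[of "{..<n}" "\<lambda>i. cmod (h !\<^sub>v i)" "\<delta> / (n + 1)"] hi by force
      also have "\<dots> < \<delta>" using d by (simp add: field_simps)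
      finally have hd: "euclid_norm h < \<delta>" .
      have hc: "h \<in> carrier_vec n" by (simp add: h_def)
      have "cmod (\<Sum>i<n. a !\<^sub>v i * h !\<^sub>v i) \<le> (\<Sum>i<n. cmod (a !\<^sub>v i) * \<delta>)"
      proof (rule order_trans[OF norm_sum], rule sum_mono)
        fix i assume "i \<in> {..<n}"
        then show "norm (a !\<^sub>v i * h !\<^sub>v i) \<le> cmod (a !\<^sub>v i) * \<delta>"
          using order_trans[OF cmod_index_le[OF hc, of i] less_imp_le[OF hd]]
          by (auto simp: norm_mult intro!: mult_left_mono)
      qed
      also have "\<dots> = S * \<delta>" by (simp add: S_def sum_distrib_right)
      finally have 1: "cmod (\<Sum>i<n. a !\<^sub>v i * h !\<^sub>v i) \<le> S * \<delta>" .
      have wz: "z + h = w" by (rule carrier_vec_eqI[of _ n]) (use w z in \<open>auto simp: h_def\<close>)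
      have 2: "cmod (f w - f z - (\<Sum>i<n. a !\<^sub>v i * h !\<^sub>v i)) \<le> \<delta>" using d(2)[OF hc hd] hd wz by simp
      have "f w = (f w - f z - (\<Sum>i<n. a !\<^sub>v i * h !\<^sub>v i)) + (f z + (\<Sum>i<n. a !\<^sub>v i * h !\<^sub>v i))" by simp
      also have "cmod \<dots> \<le> \<delta> + (cmod (f z) + S * \<delta>)"
        by (intro order_trans[OF norm_triangle_ineq] add_mono 1 2 order_refl)
      finally show "cmod (f w) \<le> \<delta> + (cmod (f z) + S * \<delta>)" .
    qed
  qed
qed

section \<open>Maximum modulus and its logarithmic convexity\<close>

context
  fixes n G assumes G: "slice_entire n G"
begin

lemma bdd_above_ball: "bdd_above ((\<lambda>z. cmod (G z)) ` {z \<in> carrier_vec n. euclid_norm z < r})"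
proof -
  obtain B where "\<forall>z\<in>carrier_vec n. euclid_norm z \<le> r \<longrightarrow> cmod (G z) \<le> B"
    using G unfolding slice_entire_def by blast
  then show ?thesis by (intro bdd_aboveI[of _ B]) auto
qed

lemma le_max_modulus:
  assumes "z \<in> carrier_vec n" "euclid_norm z < r"
  shows "cmod (G z) \<le> max_modulus n G r"
  unfolding max_modulus_def using assms by (intro cSUP_upper bdd_above_ball) auto

lemma max_modulus_le:
  assumes "0 < r" "\<And>z. z \<in> carrier_vec n \<Longrightarrow> euclid_norm z < r \<Longrightarrow> cmod (G z) \<le> B"
  shows "max_modulus n G r \<le> B"
  unfolding max_modulus_def
proof (rule cSUP_least)
  have "0\<^sub>v n \<in> {z \<in> carrier_vec n. euclid_norm z < r}" using assms by simp
  then show "{z \<in> carrier_vec n. euclid_norm z < r} \<noteq> {}" by blast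
qed (use assms in auto)

lemma max_modulus_mono: "0 < r \<Longrightarrow> r \<le> r' \<Longrightarrow> max_modulus n G r \<le> max_modulus n G r'"
  by (rule max_modulus_le) (auto intro: le_max_modulus)

text \<open>\<open>max_modulus\<close> is a supremum over the open ball. A boundary point is
  approached along its radius, where continuity in one variable suffices.\<close>

lemma closed_ball_bound:
  assumes B: "\<And>z. z \<in> carrier_vec n \<Longrightarrow> euclid_norm z < r \<Longrightarrow> cmod (G z) \<le> B"
    and z: "z \<in> carrier_vec n" "euclid_norm z \<le> r" and r: "0 < r"
  shows "cmod (G z) \<le> B"
proof -
  let ?g = "\<lambda>x::real. cmod (G (line n (0\<^sub>v n) z (of_real x)))"
  have "continuous_on UNIV (\<lambda>x. G (line n (0\<^sub>v n) z x))"
    using slice_entireD[OF G _ z(1), of "0\<^sub>v n"] by (intro holomorphic_on_imp_continuous_on) auto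
  then have "isCont (\<lambda>x. G (line n (0\<^sub>v n) z x)) (of_real 1)"
    by (simp add: continuous_on_eq_continuous_at)
  moreover have "((\<lambda>x. of_real x) \<longlongrightarrow> (of_real 1 :: complex)) (at_left 1)" by (intro tendsto_intros)
  ultimately have "((\<lambda>x::real. G (line n (0\<^sub>v n) z (of_real x))) \<longlongrightarrow> G (line n (0\<^sub>v n) z (of_real 1))) (at_left 1)"
    by (rule isCont_tendsto_compose)
  then have "(?g \<longlongrightarrow> ?g 1) (at_left 1)" by (rule tendsto_norm)
  moreover have "\<forall>\<^sub>F x in at_left 1. ?g x \<le> B"
    using eventually_at_left_real[of "0 :: real" 1, simplified]
  proof eventually_elim
    case (elim x)
    have "euclid_norm (line n (0\<^sub>v n) z (of_real x)) < r"
    proof (cases "euclid_norm z = 0")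
      case False
      then have "x * euclid_norm z < 1 * euclid_norm z"
        using elim by (intro mult_strict_right_mono) (auto simp: less_le)
      then show ?thesis using euclid_norm_line_origin[OF z(1), of "of_real x"] elim z(2) by simp
    qed (use euclid_norm_line_origin[OF z(1), of "of_real x"] r in simp)
    then show ?case by (intro B) auto
  qed
  ultimately have "?g 1 \<le> B" by (rule tendsto_upperbound) simp
  then show ?thesis using z by simp
qed

lemma le_max_modulus_closed:
  assumes "z \<in> carrier_vec n" "euclid_norm z \<le> r" "0 < r"
  shows "cmod (G z) \<le> max_modulus n G r"
  by (rule closed_ball_bound[OF le_max_modulus]) (use assms in auto)

text \<open>The identity theorem on the line through the origin and \<open>z\<close>; parameters in
  a disc of radius \<open>d\<close> give points of the ball.\<close>

lemma zero_on_ball_imp_zero: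
  assumes "0 < r" "\<And>z. z \<in> carrier_vec n \<Longrightarrow> euclid_norm z < r \<Longrightarrow> G z = 0" and z: "z \<in> carrier_vec n"
  shows "G z = 0"
proof -
  define d where "d = r / (euclid_norm z + 1)"
  have N: "0 < euclid_norm z + 1" using euclid_norm_nonneg[of z] by linarith
  then have d: "d > 0" using assms by (simp add: d_def)
  have "G (line n (0\<^sub>v n) z 1) = 0"
  proof (rule analytic_continuation[where f = "\<lambda>x. G (line n (0\<^sub>v n) z x)" and S = UNIV and U = "ball 0 d" and \<xi> = 0])
    show "(\<lambda>x. G (line n (0\<^sub>v n) z x)) holomorphic_on UNIV" using slice_entireD[OF G _ z] by auto
    show "0 islimpt ball (0::complex) d" using d by (intro interior_limit_point) simp
    fix x :: complex assume x: "x \<in> ball 0 d"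
    have "euclid_norm (line n (0\<^sub>v n) z x) \<le> cmod x * (euclid_norm z + 1)"
      unfolding euclid_norm_line_origin[OF z] by (intro mult_left_mono) auto
    also have "\<dots> < r" using x N by (simp add: d_def pos_less_divide_eq)
    finally show "G (line n (0\<^sub>v n) z x) = 0" by (intro assms) auto
  qed auto
  then show ?thesis using z by simp
qed

lemma max_modulus_pos:
  assumes "z0 \<in> carrier_vec n" "G z0 \<noteq> 0" "0 < r"
  shows "0 < max_modulus n G r"
proof -
  obtain z where z: "z \<in> carrier_vec n" "euclid_norm z < r" "G z \<noteq> 0"
    using zero_on_ball_imp_zero assms by blast
  then have "0 < cmod (G z)" by simp
  also have "\<dots> \<le> max_modulus n G r" using z by (intro le_max_modulus)
  finally show ?thesis .
qed

text \<open>On the line through the origin and \<open>z\<close>, parametrised so that the modulus of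
  the parameter is the norm of the point, the three circles theorem compares with the maxima over
  whole balls. Points of smaller norm carry a weight \<open>w \<le> u\<close>, and monotonicity of
  the maximum modulus handles these.\<close>

lemma convex_ln_max_modulus:
  assumes nz: "z0 \<in> carrier_vec n" "G z0 \<noteq> 0"
  shows "convex_on UNIV (\<lambda>t. ln (max_modulus n G (exp t)))"
proof (rule convex_on_linorderI)
  fix u t1 t2 :: real
  assume u: "0 < u" "u < 1" and t: "t1 < t2"
  let ?m = "\<lambda>t. max_modulus n G (exp t)" and ?t = "(1 - u) * t1 + u * t2"
  have pos: "0 < ?m t" for t using max_modulus_pos[OF nz] by simp
  let ?B = "exp ((1 - u) * ln (?m t1) + u * ln (?m t2))"
  have "?m ?t \<le> ?B"
  proof (rule max_modulus_le)
    fix z assume z: "z \<in> carrier_vec n" "euclid_norm z < exp ?t"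
    show "cmod (G z) \<le> ?B"
    proof (cases "euclid_norm z \<le> exp t1")
      case True
      then have "cmod (G z) \<le> exp (ln (?m t1))" using le_max_modulus_closed[OF z(1), of "exp t1"] pos by simp
      also have "ln (?m t1) \<le> ln (?m t2)" using max_modulus_mono[of "exp t1" "exp t2"] t pos by simp
      then have "u * ln (?m t1) \<le> u * ln (?m t2)" using u by (intro mult_left_mono) auto
      then have "exp (ln (?m t1)) \<le> ?B" by (simp add: algebra_simps)
      finally show ?thesis .
    next
      case False
      define N where "N = euclid_norm z"
      define w where "w = (ln N - t1) / (t2 - t1)"
      have N: "exp t1 < N" "N < exp ?t" using False z by (auto simp: N_def)
      then have N0: "N > 0" using exp_gt_zero[of t1] by linarith
      then have lN: "t1 < ln N" "ln N < ?t" using N by (metis exp_less_cancel_iff exp_ln)+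
      have "?t - t1 = u * (t2 - t1)" by (simp add: algebra_simps)
      then have w: "0 \<le> w" "w \<le> u" using lN t by (auto simp: w_def divide_le_eq)
      have wN: "(1 - w) * t1 + w * t2 = ln N"
      proof -
        have "w * (t2 - t1) = ln N - t1" using t by (simp add: w_def)
        then show ?thesis by (simp add: algebra_simps)
      qed
      let ?g = "\<lambda>x. G (line n (0\<^sub>v n) z (x / of_real N))"
      have nv: "euclid_norm (line n (0\<^sub>v n) z (x / of_real N)) = cmod x" for x
        unfolding euclid_norm_line_origin[OF z(1)] using N0 by (simp add: norm_divide flip: N_def)
      have "cmod (?g (of_real N)) \<le> exp ((1 - w) * ln (?m t1) + w * ln (?m t2))"
      proof (rule three_circles[where g = ?g and x = "of_real N" and u = w and ?t1.0 = t1 and ?t2.0 = t2])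
        have "(\<lambda>x. G (line n (0\<^sub>v n) z x)) \<circ> (\<lambda>x. x / of_real N) holomorphic_on UNIV"
          by (rule holomorphic_on_compose_gen[of _ _ _ UNIV])
            (use slice_entireD[OF G _ z(1)] N0 in \<open>auto intro!: holomorphic_intros\<close>)
        then show "?g holomorphic_on UNIV" by (simp add: o_def)
        show "cmod (?g x) \<le> ?m t1" if "norm x = exp t1" for x
          using le_max_modulus_closed[OF line_carrier, of "0\<^sub>v n" z "x / of_real N" "exp t1"] nv[of x] that by simp
        show "cmod (?g x) \<le> ?m t2" if "norm x = exp t2" for x
          using le_max_modulus_closed[OF line_carrier, of "0\<^sub>v n" z "x / of_real N" "exp t2"] nv[of x] that by simp
        show "norm (complex_of_real N) = exp ((1 - w) * t1 + w * t2)" using N0 by (simp add: wN)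
      qed (use u w t pos in auto)
      also have "\<dots> \<le> ?B"
      proof -
        have "ln (?m t1) \<le> ln (?m t2)" using max_modulus_mono[of "exp t1" "exp t2"] t pos by simp
        then have "w * (ln (?m t2) - ln (?m t1)) \<le> u * (ln (?m t2) - ln (?m t1))"
          using w by (intro mult_right_mono) auto
        then show ?thesis by (simp add: algebra_simps)
      qed
      finally show ?thesis using z N0 by simp
    qed
  qed simp
  then have "ln (?m ?t) \<le> ln ?B" using pos by (subst ln_le_cancel_iff) auto
  then show "ln (?m ((1 - u) *\<^sub>R t1 + u *\<^sub>R t2)) \<le> (1 - u) * ln (?m t1) + u * ln (?m t2)" by simp
qed simp

end

section \<open>Growth of polynomials on the graph of one function\<close>

text \<open>Polynomial of degree at most \<open>k\<close> in \<open>v\<close> and along every line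
  in \<open>w\<close>. The second clause makes \<open>q w (f w)\<close> bounded on balls, hence
  again \<open>slice_entire\<close>.\<close>

definition slice_poly :: "nat \<Rightarrow> nat \<Rightarrow> (cvec \<Rightarrow> complex \<Rightarrow> complex) \<Rightarrow> bool" where
  "slice_poly n k q \<longleftrightarrow>
    (\<forall>a\<in>carrier_vec n. \<forall>b\<in>carrier_vec n. bideg k (\<lambda>x v. q (line n a b x) v)) \<and>
    (\<forall>r. \<exists>B. \<forall>w\<in>carrier_vec n. \<forall>v. euclid_norm w \<le> r \<longrightarrow> cmod v \<le> r \<longrightarrow> cmod (q w v) \<le> B)"

lemma slice_entire_poly_graph:
  assumes f: "slice_entire n f" and q: "slice_poly n k q"
  shows "slice_entire n (\<lambda>w. q w (f w))"
  unfolding slice_entire_def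
proof (intro conjI ballI allI)
  fix a b :: cvec assume ab: "a \<in> carrier_vec n" "b \<in> carrier_vec n"
  show "(\<lambda>x. q (line n a b x) (f (line n a b x))) holomorphic_on UNIV"
    by (rule bideg_holomorphic[where Q = "\<lambda>x v. q (line n a b x) v"])
      (use q ab slice_entireD[OF f ab] in \<open>auto simp: slice_poly_def\<close>)
next
  fix r
  obtain B where B: "\<And>z. z \<in> carrier_vec n \<Longrightarrow> euclid_norm z \<le> r \<Longrightarrow> cmod (f z) \<le> B"
    using f unfolding slice_entire_def by blast
  obtain D where "\<And>w v. w \<in> carrier_vec n \<Longrightarrow> euclid_norm w \<le> max r B \<Longrightarrow> cmod v \<le> max r B \<Longrightarrow> cmod (q w v) \<le> D"
    using q unfolding slice_poly_def by blast
  then show "\<exists>B. \<forall>z\<in>carrier_vec n. euclid_norm z \<le> r \<longrightarrow> cmod (q z (f z)) \<le> B"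
    using B by (intro exI[of _ D]) (auto simp: le_max_iff_disj)
qed

lemma exp_phi:
  assumes "slice_entire n f" "z0 \<in> carrier_vec n" "f z0 \<noteq> 0"
  shows "exp (phi n f t) = max_modulus n f (exp t)"
  using max_modulus_pos[OF assms, of "exp t"] by (simp add: phi_def log_max_modulus_def)

lemma phi_mono:
  assumes "slice_entire n f" "z0 \<in> carrier_vec n" "f z0 \<noteq> 0" "t \<le> t'"
  shows "phi n f t \<le> phi n f t'"
proof -
  have "exp (phi n f t) \<le> exp (phi n f t')"
    unfolding exp_phi[OF assms(1-3)] using assms by (intro max_modulus_mono) auto
  then show ?thesis by simp
qed

lemma phi_convex:
  assumes "slice_entire n f" "z0 \<in> carrier_vec n" "f z0 \<noteq> 0"
  shows "convex_on UNIV (phi n f)"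
  using convex_ln_max_modulus[OF assms] by (simp add: phi_def[abs_def] log_max_modulus_def)

lemma cmod_le_exp_phi:
  assumes "slice_entire n f" "z0 \<in> carrier_vec n" "f z0 \<noteq> 0" "z \<in> carrier_vec n" "euclid_norm z \<le> exp t"
  shows "cmod (f z) \<le> exp (phi n f t)"
  unfolding exp_phi[OF assms(1-3)] using assms by (intro le_max_modulus_closed) auto

text \<open>Join a point \<open>b\<close> near the origin to a point \<open>a\<close> where \<open>f\<close> almost attains
  its maximum; on the complex line through both, near \<open>b\<close> \<open>f\<close> is small, at \<open>a\<close> it is large.\<close>

lemma poly_graph_core_bound:
  fixes k M :: nat
  assumes f: "slice_entire n f" "z0 \<in> carrier_vec n" "f z0 \<noteq> 0"
    and s: "0 < s" "s \<le> 1/10" and k: "1 \<le> k" and q: "slice_poly n k q"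
    and M: "3 / s * (phi n f (T + 20 * s) - phi n f (T - 1) + 3 + 2 / s) \<le> M"
    and growth: "40 / s * (k + ln (M + k)) < phi n f T - phi n f (T - 1) - ln 2"
    and b: "b \<in> carrier_vec n" "euclid_norm b \<le> s * exp T"
    and y: "cmod y \<le> exp (phi n f (T - 1))"
  shows "cmod (q b y) \<le> (1 + 12 * (M + k)) ^ (k + 1) * ((1 + 8 * (1 + 3 * s) / s) ^ (k + 1) *
    max_modulus n (\<lambda>w. q w (f w)) (exp (T + 8 * s)))"
proof -
  let ?\<phi> = "phi n f"
  let ?\<rho> = "exp (?\<phi> (T - 1))"
  have g: "slice_entire n (\<lambda>w. q w (f w))" by (rule slice_entire_poly_graph[OF f(1) q])
  \<comment> \<open>The supremum over the open ball may not be attained, but half of it is exceeded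
    somewhere; hence the \<open>ln 2\<close> in the hypothesis \<open>growth\<close>.\<close>
  obtain a where a: "a \<in> carrier_vec n" "euclid_norm a < exp T" "exp (?\<phi> T) / 2 < cmod (f a)"
  proof (rule ccontr)
    assume "\<not> thesis"
    then have "\<And>z. z \<in> carrier_vec n \<Longrightarrow> euclid_norm z < exp T \<Longrightarrow> cmod (f z) \<le> exp (?\<phi> T) / 2"
      using that by (meson not_le)
    then have "max_modulus n f (exp T) \<le> exp (?\<phi> T) / 2" by (intro max_modulus_le[OF f(1)]) auto
    then show False by (simp flip: exp_phi[OF f])
  qed
  define d where "d = line n a b (- 1)"
  have d: "d \<in> carrier_vec n" by (simp add: d_def)
  have nd: "euclid_norm d \<le> (1 + s) * exp T"
    using euclid_norm_line_le[OF a(1) b(1), of "- 1"] a(2) b(2) by (simp add: d_def distrib_right)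
  define L where "L = line n b d"
  have L: "L x \<in> carrier_vec n" for x by (simp add: L_def)
  have nL: "euclid_norm (L x) \<le> (s + c * (1 + s)) * exp T" if "cmod x \<le> c" for x c
  proof -
    have "euclid_norm (L x) \<le> euclid_norm b + cmod x * euclid_norm d"
      unfolding L_def by (rule euclid_norm_line_le[OF b(1) d])
    also have "\<dots> \<le> s * exp T + c * ((1 + s) * exp T)"
      using b(2) nd that by (intro add_mono mult_mono) (auto intro: order_trans[OF norm_ge_zero])
    finally show ?thesis by (simp add: algebra_simps)
  qed
  have e1: "exp (-1) \<ge> (1/3::real)" using exp_le by (simp add: exp_minus field_simps)
  \<comment> \<open>For such parameters the norm is at most
    \<open>(s + (1 + s) / 10) * exp T\<close>, and with \<open>s \<le> 1/10\<close> the factor is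
    below 1/3, hence below \<open>exp (- 1)\<close>.\<close>
  have small: "cmod (f (L x)) \<le> ?\<rho>" if "cmod x \<le> 1/10" for x
  proof (rule cmod_le_exp_phi[OF f L])
    have 1: "euclid_norm (L x) \<le> (s + 1/10 * (1 + s)) * exp T" by (rule nL[OF that])
    have "s + 1/10 * (1 + s) = s + 1/10 + s / 10" by (simp add: field_simps)
    then have "s + 1/10 * (1 + s) \<le> 1/3" using s by linarith
    then have "(s + 1/10 * (1 + s)) * exp T \<le> exp (- 1) * exp T"
      using e1 by (intro mult_right_mono order_trans[OF _ e1]) auto
    with 1 show "euclid_norm (L x) \<le> exp (T - 1)" by (simp add: exp_add[symmetric])
  qed
  \<comment> \<open>The factor is \<open>1 + 5 * s + 3 * s\<^sup>2\<close>, hence below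
    \<open>1 + 8 * s\<close>, which fixes the radius \<open>exp (T + 8 * s)\<close>.\<close>
  have inside: "euclid_norm (L x) < exp (T + 8 * s)" if "cmod x < 1 + 3 * s" for x
  proof -
    have "euclid_norm (L x) \<le> (s + (1 + 3 * s) * (1 + s)) * exp T" using that by (intro nL) auto
    also have "s + (1 + 3 * s) * (1 + s) < 1 + 8 * s"
      using s mult_strict_left_mono[of s 1 s] by (simp add: algebra_simps)
    also have "\<dots> \<le> exp (8 * s)" by (rule exp_ge_add_one_self)
    finally show ?thesis by (simp add: exp_add mult.commute)
  qed
  have Q0: "(\<lambda>x v. q (L x) v) 0 y = q b y" using b by (simp add: L_def)
  show ?thesis
    unfolding Q0[symmetric]
  proof (rule slice_polynomial_bound[where h = "\<lambda>x. f (L x)" and Q = "\<lambda>x v. q (L x) v"])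
    show "0 \<le> ?\<phi> (T + 20 * s) - ?\<phi> (T - 1)" using phi_mono[OF f, of "T - 1" "T + 20 * s"] s by simp
    show "(\<lambda>x. f (L x)) holomorphic_on ball 0 (1 + 3 * s)" unfolding L_def by (rule slice_entireD[OF f(1) b(1) d])
    show "bideg k (\<lambda>x v. q (L x) v)" using q b(1) d unfolding slice_poly_def L_def by blast
    show "cmod (f (L x)) \<le> ?\<rho> * exp (?\<phi> (T + 20 * s) - ?\<phi> (T - 1))" if "x \<in> ball 0 (1 + 3 * s)" for x
    proof -
      have "cmod (f (L x)) \<le> exp (?\<phi> (T + 8 * s))"
        using inside[of x] that by (intro cmod_le_exp_phi[OF f L]) auto
      also have "\<dots> \<le> exp (?\<phi> (T + 20 * s))" using phi_mono[OF f, of "T + 8 * s" "T + 20 * s"] s by simp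
      finally show ?thesis by (simp add: exp_diff)
    qed
    have L1: "L 1 = a" by (rule carrier_vec_eqI[OF L a(1)]) (simp add: L_def d_def)
    show "?\<rho> * exp (?\<phi> T - ?\<phi> (T - 1) - ln 2) \<le> cmod (f (L 1))"
      unfolding L1 using a(3) by (simp add: exp_diff)
    show "cmod (q (L x) (f (L x))) \<le> max_modulus n (\<lambda>w. q w (f w)) (exp (T + 8 * s))"
      if "x \<in> ball 0 (1 + 3 * s)" for x
      using le_max_modulus[OF g L inside, of x] that by simp
  qed (use s k M growth y small in auto)
qed

text \<open>Bernstein--Walsh in \<open>w\<close> along lines through the origin and then in \<open>v\<close>.\<close>

lemma slice_poly_extend_bound:
  assumes q: "slice_poly n k q" and r: "0 < r" "r \<le> R" and \<rho>: "0 < \<rho>" "\<rho> \<le> \<rho>'"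
    and K: "\<And>b y. b \<in> carrier_vec n \<Longrightarrow> euclid_norm b \<le> r \<Longrightarrow> cmod y \<le> \<rho> \<Longrightarrow> cmod (q b y) \<le> K"
    and w: "w \<in> carrier_vec n" "euclid_norm w \<le> R" and v: "cmod v \<le> \<rho>'"
  shows "cmod (q w v) \<le> (real k + 1) * (\<rho>' / \<rho>) ^ k * ((real k + 1) * (R / r) ^ k * K)"
proof -
  have 1: "cmod (q w y) \<le> (real k + 1) * (R / r) ^ k * K" if y: "cmod y \<le> \<rho>" for y
  proof -
    have "bideg k (\<lambda>x v. q (line n (0\<^sub>v n) w x) v)" using q w unfolding slice_poly_def by auto
    from bideg_fst[OF this, of y] obtain p where p: "degree p \<le> k"
      "\<And>x. q (line n (0\<^sub>v n) w x) y = poly p x" by auto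
    have "cmod (poly p x) \<le> K" if x: "cmod x \<le> r / R" for x
    proof -
      have "cmod x * euclid_norm w \<le> r / R * R" using x w r by (intro mult_mono) auto
      then show ?thesis
        unfolding p(2)[symmetric] using y w r by (intro K) (auto simp: euclid_norm_line_origin)
    qed
    then have "cmod (poly p 1) \<le> (real k + 1) * (1 / (r / R)) ^ k * K"
      using poly_growth_bound[OF p(1), of "r / R" K 1 1] r by simp
    then show ?thesis using p(2)[of 1] w by simp
  qed
  have "bideg k (\<lambda>x v. q (line n (0\<^sub>v n) w x) v)" using q w unfolding slice_poly_def by auto
  from bideg_snd[OF this, of 1] obtain p where p: "degree p \<le> k" "\<And>y. q w y = poly p y"
    using w by auto
  have "cmod (poly p x) \<le> (real k + 1) * (R / r) ^ k * K" if "cmod x \<le> \<rho>" for x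
    using 1[OF that] p(2) by simp
  then show ?thesis unfolding p(2)
    using poly_growth_bound[OF p(1) \<rho>(1), of "(real k + 1) * (R / r) ^ k * K" v \<rho>'] v \<rho> by simp
qed

text \<open>\<open>T\<close> is good for degree \<open>k\<close> if the increment over
  \<open>[T - 1, T]\<close> beats \<open>k\<close> and the logarithm of the increment up to
  \<open>T + 20 * s\<close>, both divided by \<open>s\<close>. In
  \<open>poly_graph_core_bound\<close> the constant is 40 and the logarithm is that of
  \<open>M + k\<close>, at most \<open>8 * A / s\<close>; 300 leaves room for both changes.\<close>

definition growth_at :: "nat \<Rightarrow> (cvec \<Rightarrow> complex) \<Rightarrow> nat \<Rightarrow> real \<Rightarrow> real \<Rightarrow> bool" where
  "growth_at n f k T s \<longleftrightarrow> 0 < s \<and> s \<le> 1/10 \<and> 1 \<le> phi n f T - phi n f (T - 1) \<and>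
     300 / s * (k + ln ((phi n f (T + 20 * s) - phi n f (T - 1)) / s)) \<le> phi n f T - phi n f (T - 1)"

lemma power_le_exp:
  fixes x c :: real
  assumes "0 \<le> x" "x \<le> exp c"
  shows "x ^ m \<le> exp (m * c)"
  using power_mono[OF assms(2,1), of m] by (simp add: exp_of_nat_mult)

text \<open>All factors are absorbed into powers of \<open>exp (k * A)\<close>, because
  \<open>growth_at\<close> forces \<open>A\<close> above \<open>300 / s\<close> and makes it large
  against \<open>k\<close> and \<open>ln (A / s)\<close>. The radii \<open>exp (T + 8 * s)\<close>
  and \<open>exp (T + 20 * s)\<close> leave a logarithmic gap of \<open>12 * s\<close> for the
  convexity argument.\<close>

lemma poly_graph_bound:
  fixes k :: nat and A :: real
  assumes f: "slice_entire n f" "z0 \<in> carrier_vec n" "f z0 \<noteq> 0"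
    and k: "1 \<le> k" and gr: "growth_at n f k T s" and q: "slice_poly n k q"
  defines "A \<equiv> phi n f (T + 20 * s) - phi n f (T - 1)"
    and "g \<equiv> (\<lambda>w. q w (f w))"
  shows "b \<in> carrier_vec n \<Longrightarrow> euclid_norm b \<le> s * exp T \<Longrightarrow> cmod y \<le> exp (phi n f (T - 1)) \<Longrightarrow>
      cmod (q b y) \<le> exp (4 * k * A) * max_modulus n g (exp (T + 8 * s))" (is "PROP ?P")
    and "max_modulus n g (exp (T + 20 * s)) \<le> exp (10 * k * A) * max_modulus n g (exp (T + 8 * s))" (is ?Q)
proof -
  define B where "B = phi n f T - phi n f (T - 1)"
  define l where "l = ln (A / s)"
  \<comment> \<open>The least number of values that \<open>poly_graph_core_bound\<close>
    admits.\<close>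
  define M where "M = nat \<lceil>3 / s * (A + 3 + 2 / s)\<rceil>"
  define G where "G = max_modulus n g (exp (T + 8 * s))"
  have s: "0 < s" "s \<le> 1/10" and B1: "1 \<le> B" and gB: "300 / s * (k + l) \<le> B"
    using gr by (auto simp: growth_at_def B_def A_def l_def)
  have AB: "B \<le> A" using phi_mono[OF f, of T "T + 20 * s"] s by (simp add: A_def B_def)
  have A1: "1 \<le> A" using AB B1 by simp
  have "1 \<le> A / s" using A1 s by (simp add: field_simps)
  then have l0: "0 \<le> l" by (simp add: l_def)
  have k1: "1 \<le> real k" using k by simp
  define i where "i = 1 / s"
  define X where "X = i * (k + l)"
  have sk: "300 * X \<le> B" using gB by (simp add: X_def i_def)
  have is10: "10 \<le> i" using s by (simp add: i_def field_simps)
  have "1 \<le> k + l" using k1 l0 by linarith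
  then have prod: "i \<le> X" "10 * (k + l) \<le> X"
    using mult_left_mono[of 1 "k + l" i] mult_right_mono[of 10 i "k + l"] is10 by (auto simp: X_def)
  have sA: "300 * i \<le> A" using sk prod(1) AB by linarith
  then have A3: "3000 \<le> A" using is10 by linarith
  have kA: "3000 * k \<le> A" "3000 * l \<le> A" using sk prod(2) AB k1 l0 by auto
  have M_le: "real M \<le> 6 * (A / s) + 1"
  proof -
    have pos: "0 \<le> 3 / s * (A + 3 + 2 / s)" using s A1 by simp
    have "A + 3 + 2 / s \<le> 2 * A" using sA A3 by (simp add: i_def)
    then have "3 / s * (A + 3 + 2 / s) \<le> 3 / s * (2 * A)" using s by (intro mult_left_mono) auto
    then show ?thesis unfolding M_def using pos by simp linarith
  qed
  have As: "A \<le> A / s" using s A1 by (simp add: field_simps)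
  have Mk: "M + k \<le> 8 * (A / s)" using M_le kA As A3 k1 by simp
  have Mk0: "0 < real (M + k)" using k by simp
  have lnMk: "ln (M + k) \<le> 3 + l"
  proof -
    have "ln (M + k) \<le> ln (8 * (A / s))" using Mk Mk0 by (subst ln_le_cancel_iff) auto
    also have "\<dots> = ln 8 + l" using s A1 ln_mult_pos[of 8 "A / s"] by (simp add: l_def)
    also have "ln 8 \<le> (3::real)"
    proof -
      have "ln (8::real) = 3 * ln 2" using ln_realpow[of 2 3] by simp
      then show ?thesis using ln_le_minus_one[of "2::real"] by simp
    qed
    finally show ?thesis by simp
  qed
  have th: "40 / s * (k + ln (M + k)) < B - ln 2"
  proof -
    have "40 / s * (k + ln (M + k)) \<le> 40 / s * (4 * (k + l))"
      using lnMk k1 l0 s by (intro mult_left_mono) auto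
    also have "\<dots> = 160 * X" by (simp add: X_def i_def)
    also have "\<dots> < B - ln 2" using sk prod is10 ln_le_minus_one[of "2::real"] by linarith
    finally show ?thesis .
  qed
  have M: "3 / s * (A + 3 + 2 / s) \<le> M" unfolding M_def by linarith
  have G0: "0 \<le> G"
    unfolding G_def g_def
    by (rule order_trans[OF norm_ge_zero le_max_modulus[OF slice_entire_poly_graph[OF f(1) q], of "0\<^sub>v n"]]) auto
  have X1: "(1 + 12 * (M + k)) ^ (k + 1) \<le> exp (2 * k * A)"
  proof -
    have "1 + 12 * (M + k) \<le> 128 * (A / s)" using Mk Mk0 k1 by simp
    also have "\<dots> = exp (ln 128 + l)" using s A1 by (simp add: exp_add l_def)
    also have "\<dots> \<le> exp A"
    proof -
      have "ln (128::real) = 7 * ln 2" using ln_realpow[of 2 7] by simp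
      then have "ln (128::real) \<le> 7" using ln_le_minus_one[of "2::real"] by simp
      then show ?thesis using kA A3 by simp
    qed
    finally have "real (1 + 12 * (M + k)) ^ (k + 1) \<le> exp (real (k + 1) * A)"
      using power_le_exp[of "real (1 + 12 * (M + k))" A "k + 1"] by simp
    also have "\<dots> \<le> exp (2 * k * A)" using k1 A1 by (simp add: mult_right_mono)
    finally show ?thesis by (simp only: of_nat_power)
  qed
  have X2: "(1 + 8 * (1 + 3 * s) / s) ^ (k + 1) \<le> exp (2 * k * A)"
  proof -
    have "8 * (1 + 3 * s) / s = 8 * i + 24" using s by (simp add: i_def field_simps)
    then have "1 + 8 * (1 + 3 * s) / s \<le> 1 + A" using sA is10 by simp
    also have "\<dots> \<le> exp A" by (rule exp_ge_add_one_self)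
    finally have "(1 + 8 * (1 + 3 * s) / s) ^ (k + 1) \<le> exp (real (k + 1) * A)"
      using s by (intro power_le_exp) auto
    also have "\<dots> \<le> exp (2 * k * A)" using k1 A1 by (simp add: mult_right_mono)
    finally show ?thesis .
  qed
  have core: "cmod (q b y) \<le> exp (4 * k * A) * G"
    if "b \<in> carrier_vec n" "euclid_norm b \<le> s * exp T" "cmod y \<le> exp (phi n f (T - 1))" for b y
  proof -
    have "cmod (q b y) \<le> (1 + 12 * (M + k)) ^ (k + 1) * ((1 + 8 * (1 + 3 * s) / s) ^ (k + 1) * G)"
      unfolding G_def g_def
      by (rule poly_graph_core_bound[OF f s k q _ _ that]) (use M th in \<open>auto simp: A_def B_def\<close>)
    also have "\<dots> \<le> exp (2 * k * A) * (exp (2 * k * A) * G)"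
      using X1 X2 G0 s by (intro mult_mono mult_right_mono) auto
    also have "\<dots> = exp (4 * k * A) * G" by (simp flip: exp_add mult.assoc)
    finally show ?thesis .
  qed
  then show "PROP ?P" by (simp add: G_def)
  show ?Q
    unfolding g_def
  proof (rule max_modulus_le[OF slice_entire_poly_graph[OF f(1) q]])
    fix w assume w: "w \<in> carrier_vec n" "euclid_norm w < exp (T + 20 * s)"
    have "cmod (q w (f w)) \<le> (real k + 1) * (exp (phi n f (T + 20 * s)) / exp (phi n f (T - 1))) ^ k *
        ((real k + 1) * (exp (T + 20 * s) / (s * exp T)) ^ k * (exp (4 * k * A) * G))"
    proof (rule slice_poly_extend_bound[OF q])
      have "s * exp T \<le> 1 * exp (T + 20 * s)" using s by (intro mult_mono) auto
      then show "s * exp T \<le> exp (T + 20 * s)" by simp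
      show "exp (phi n f (T - 1)) \<le> exp (phi n f (T + 20 * s))" using A1 by (simp add: A_def)
      show "cmod (f w) \<le> exp (phi n f (T + 20 * s))" using w by (intro cmod_le_exp_phi[OF f]) auto
    qed (use core w s in auto)
    \<comment> \<open>The extension contributes \<open>exp (k * A)\<close> twice: in
      \<open>v\<close>, where \<open>A\<close> is the logarithm of the ratio of the radii, and in
      \<open>w\<close>, where that ratio is about \<open>1 / s\<close> and hence below
      \<open>exp A\<close>.\<close>
    also have "\<dots> \<le> exp (k * 1) * exp (k * A) * (exp (k * 1) * exp (k * A) * (exp (4 * k * A) * G))"
    proof (intro mult_mono)
      show "real k + 1 \<le> exp (k * 1)" "real k + 1 \<le> exp (k * 1)"
        using exp_ge_add_one_self[of "real k"] by (auto simp: add.commute)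
      show "(exp (phi n f (T + 20 * s)) / exp (phi n f (T - 1))) ^ k \<le> exp (k * A)"
        by (intro power_le_exp) (auto simp: A_def exp_diff)
      show "(exp (T + 20 * s) / (s * exp T)) ^ k \<le> exp (k * A)"
      proof (intro power_le_exp)
        have "exp (T + 20 * s) / (s * exp T) = exp (20 * s) * (1 / s)" by (simp add: exp_add)
        also have "\<dots> \<le> exp 2 * exp (1 / s)"
        proof (intro mult_mono)
          show "1 / s \<le> exp (1 / s)" using exp_ge_add_one_self[of "1 / s"] by linarith
        qed (use s in auto)
        also have "\<dots> \<le> exp A" unfolding exp_add[symmetric] using sA is10 by (simp add: i_def)
        finally show "exp (T + 20 * s) / (s * exp T) \<le> exp A" .
      qed (use s in simp)
    qed (use G0 s in auto)
    also have "\<dots> = exp (2 * k + 6 * k * A) * G" by (simp flip: exp_add mult.assoc)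
    also have "\<dots> \<le> exp (10 * k * A) * G"
    proof (intro mult_right_mono G0)
      have "2 * x + 6 * y \<le> 10 * y" if "x \<le> y" "0 \<le> y" for x y :: real
        using that by simp
      from this[of "real k" "k * A"] have "2 * real k + 6 * (k * A) \<le> 10 * (k * A)"
        using A1 by (auto simp: mult_le_cancel_left1)
      then show "exp (2 * k + 6 * k * A) \<le> exp (10 * k * A)" by (simp add: mult.assoc)
    qed
    finally show "cmod (q w (f w)) \<le> exp (10 * k * A) * max_modulus n (\<lambda>w. q w (f w)) (exp (T + 8 * s))"
      by (simp add: G_def g_def)
  qed simp
qed

text \<open>Transcendence of \<open>f\<close>: if the maximum on the graph is 0, the bound makes
  \<open>q\<close> vanish on a product of balls, and polynomial extension does the rest. This later
  shows that the test polynomials for optimality do not vanish on the graph.\<close>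

lemma slice_poly_zero:
  assumes f: "slice_entire n f" "z0 \<in> carrier_vec n" "f z0 \<noteq> 0"
    and k: "1 \<le> k" and gr: "growth_at n f k T s" and q: "slice_poly n k q"
    and zero: "\<And>w. w \<in> carrier_vec n \<Longrightarrow> q w (f w) = 0"
    and w: "w \<in> carrier_vec n"
  shows "q w v = 0"
proof -
  have s: "0 < s" using gr by (simp add: growth_at_def)
  have mm: "max_modulus n (\<lambda>w. q w (f w)) (exp (T + 8 * s)) \<le> 0"
    by (rule max_modulus_le[OF slice_entire_poly_graph[OF f(1) q]]) (use zero in auto)
  define r where "r = s * exp T"
  define \<rho> where "\<rho> = exp (phi n f (T - 1))"
  have K: "cmod (q b y) \<le> 0"
    if "b \<in> carrier_vec n" "euclid_norm b \<le> r" "cmod y \<le> \<rho>" for b y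
  proof -
    have "cmod (q b y) \<le> exp (4 * k * (phi n f (T + 20 * s) - phi n f (T - 1))) *
        max_modulus n (\<lambda>w. q w (f w)) (exp (T + 8 * s))"
      by (rule poly_graph_bound(1)[OF f k gr q]) (use that in \<open>auto simp: r_def \<rho>_def\<close>)
    also have "\<dots> \<le> 0" using mm by (simp add: mult_nonneg_nonpos)
    finally show ?thesis .
  qed
  have "cmod (q w v) \<le> (real k + 1) * (max \<rho> (cmod v) / \<rho>) ^ k * ((real k + 1) * (max r (euclid_norm w) / r) ^ k * 0)"
    by (rule slice_poly_extend_bound[OF q]) (use K w s in \<open>auto simp: r_def \<rho>_def\<close>)
  then show ?thesis by simp
qed

text \<open>\<open>k * A / s\<close> is the logarithmic growth rate obtained from one good
  \<open>T\<close>. Good points must exist beyond every \<open>t0\<close>, since convexity bounds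
  slopes only by those further out; \<open>C\<close> may depend on \<open>t0\<close> but not on
  \<open>k\<close>.\<close>

definition growth_cond :: "nat \<Rightarrow> (cvec \<Rightarrow> complex) \<Rightarrow> (nat \<Rightarrow> real) \<Rightarrow> bool" where
  "growth_cond n f \<mu> \<longleftrightarrow> (\<forall>t0. \<exists>C\<ge>0. \<forall>k\<ge>1. \<exists>T\<ge>t0. \<exists>s. growth_at n f k T s \<and>
     k * (phi n f (T + 20 * s) - phi n f (T - 1)) / s \<le> C * \<mu> k)"

lemma convex_slope_le:
  fixes h :: "real \<Rightarrow> real"
  assumes h: "convex_on UNIV h" and "a < b" "a \<le> c" "b \<le> d" "c < d"
  shows "(h b - h a) / (b - a) \<le> (h d - h c) / (d - c)"
proof -
  define D where "D = (\<lambda>x y. (h y - h x) / (y - x))"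
  have flip: "(h x - h y) / (x - y) = D x y" for x y
    unfolding D_def by (metis minus_diff_eq minus_divide_divide)
  have D: "D x y \<le> D x z" "D x z \<le> D y z" if "x < y" "y < z" for x y z
    using convex_on_slope_le[OF h UNIV_I UNIV_I that] unfolding flip by auto
  have "D a b \<le> D a d" using D(1)[of a b d] assms by (cases "b = d") auto
  also have "\<dots> \<le> D c d" using D(2)[of a c d] assms by (cases "a = c") auto
  finally show ?thesis by (simp add: D_def)
qed

lemma graph_growth_bound:
  assumes f: "slice_entire n f" "z0 \<in> carrier_vec n" "f z0 \<noteq> 0"
    and gc: "growth_cond n f \<mu>" and r: "0 < r" "r < R"
  shows "\<exists>C\<ge>0. \<forall>k\<ge>1. \<forall>q. slice_poly n k q \<longrightarrow>
    max_modulus n (\<lambda>w. q w (f w)) R \<le> exp (C * \<mu> k) * max_modulus n (\<lambda>w. q w (f w)) r"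
proof -
  obtain C where C: "C \<ge> 0" "\<And>k. k \<ge> 1 \<Longrightarrow> \<exists>T\<ge>ln R. \<exists>s. growth_at n f k T s \<and>
     k * (phi n f (T + 20 * s) - phi n f (T - 1)) / s \<le> C * \<mu> k"
    using gc unfolding growth_cond_def by blast
  have lnr: "ln r < ln R" using r by simp
  have main: "max_modulus n (\<lambda>w. q w (f w)) R \<le> exp ((ln R - ln r) * C * \<mu> k) * max_modulus n (\<lambda>w. q w (f w)) r"
    if k: "k \<ge> 1" and q: "slice_poly n k q" for k q
  proof -
    let ?g = "\<lambda>w. q w (f w)"
    have g: "slice_entire n ?g" by (rule slice_entire_poly_graph[OF f(1) q])
    from C(2)[OF k] obtain T s where T: "T \<ge> ln R" "growth_at n f k T s"
      "k * (phi n f (T + 20 * s) - phi n f (T - 1)) / s \<le> C * \<mu> k" by blast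
    define A where "A = phi n f (T + 20 * s) - phi n f (T - 1)"
    have s: "0 < s" using T by (simp add: growth_at_def)
    show ?thesis
    proof (cases "\<exists>w\<in>carrier_vec n. ?g w \<noteq> 0")
      case False
      then have "max_modulus n ?g R \<le> 0" using r by (intro max_modulus_le[OF g]) auto
      moreover have "0 \<le> max_modulus n ?g r"
        using le_max_modulus[OF g, of "0\<^sub>v n" r] r by (auto intro: order_trans[OF norm_ge_zero])
      ultimately show ?thesis by (auto intro: order_trans)
    next
      case True
      then obtain w where w: "w \<in> carrier_vec n" "?g w \<noteq> 0" by blast
      let ?h = "\<lambda>t. ln (max_modulus n ?g (exp t))"
      have pos: "0 < max_modulus n ?g t" if "t > 0" for t using max_modulus_pos[where G = ?g, OF g w that] .
      have "(?h (ln R) - ?h (ln r)) / (ln R - ln r) \<le>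
          (?h (T + 20 * s) - ?h (T + 8 * s)) / (T + 20 * s - (T + 8 * s))"
        by (rule convex_slope_le[OF convex_ln_max_modulus[where G = ?g, OF g w]]) (use lnr T s in auto)
      \<comment> \<open>The slope is taken over an interval of length \<open>12 * s\<close>, which
        absorbs the factor 10 from \<open>poly_graph_bound\<close>.\<close>
      also have "\<dots> \<le> 10 * k * A / (T + 20 * s - (T + 8 * s))"
      proof (rule divide_right_mono)
        have "?h (T + 20 * s) \<le> ln (exp (10 * k * A) * max_modulus n ?g (exp (T + 8 * s)))"
          using poly_graph_bound(2)[OF f k T(2) q] pos by (subst ln_le_cancel_iff) (auto simp: A_def)
        then show "?h (T + 20 * s) - ?h (T + 8 * s) \<le> 10 * k * A"
          using pos[of "exp (T + 8 * s)"] ln_mult_pos[of "exp (10 * k * A)" "max_modulus n ?g (exp (T + 8 * s))"]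
          by simp
      qed (use s in simp)
      also have "\<dots> \<le> k * A / s"
      proof -
        have "0 \<le> A" using phi_mono[OF f, of "T - 1" "T + 20 * s"] s by (simp add: A_def)
        then show ?thesis using s by (simp add: field_simps)
      qed
      also have "\<dots> \<le> C * \<mu> k" using T(3) by (simp add: A_def)
      finally have "?h (ln R) - ?h (ln r) \<le> (ln R - ln r) * C * \<mu> k"
        using lnr by (simp add: divide_le_eq mult_ac)
      then have "ln (max_modulus n ?g R) \<le> ln (exp ((ln R - ln r) * C * \<mu> k) * max_modulus n ?g r)"
        using r pos[of r] ln_mult_pos[of "exp ((ln R - ln r) * C * \<mu> k)" "max_modulus n ?g r"] by simp
      then show ?thesis using r pos by (subst (asm) ln_le_cancel_iff) auto
    qed
  qed
  then show ?thesis using C(1) lnr by (intro exI[of _ "(ln R - ln r) * C"]) auto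
qed

section \<open>Polynomial functions\<close>

abbreviation (input) keysum :: "(nat \<Rightarrow>\<^sub>0 nat) \<Rightarrow> nat" where
  "keysum \<alpha> \<equiv> (\<Sum>i\<in>Poly_Mapping.keys \<alpha>. Poly_Mapping.lookup \<alpha> i)"

definition monomial_value :: "(nat \<Rightarrow>\<^sub>0 nat) \<Rightarrow> cvec \<Rightarrow> complex" where
  "monomial_value \<alpha> z = (\<Prod>i\<in>Poly_Mapping.keys \<alpha>. (z !\<^sub>v i) ^ Poly_Mapping.lookup \<alpha> i)"

lemma keysum_superset:
  "finite S \<Longrightarrow> Poly_Mapping.keys \<alpha> \<subseteq> S \<Longrightarrow> keysum \<alpha> = (\<Sum>i\<in>S. Poly_Mapping.lookup \<alpha> i)"
  by (rule sum.mono_neutral_left) (auto simp: in_keys_iff)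

lemma monomial_value_superset:
  "finite S \<Longrightarrow> Poly_Mapping.keys \<alpha> \<subseteq> S \<Longrightarrow> monomial_value \<alpha> z = (\<Prod>i\<in>S. (z !\<^sub>v i) ^ Poly_Mapping.lookup \<alpha> i)"
  unfolding monomial_value_def by (rule prod.mono_neutral_left) (auto simp: in_keys_iff)

lemma keysum_add: "keysum (\<alpha> + \<beta>) = keysum \<alpha> + keysum \<beta>"
proof -
  let ?S = "Poly_Mapping.keys \<alpha> \<union> Poly_Mapping.keys \<beta>"
  have "keysum (\<alpha> + \<beta>) = (\<Sum>i\<in>?S. Poly_Mapping.lookup (\<alpha> + \<beta>) i)"
    using keys_add[of \<alpha> \<beta>] by (intro keysum_superset) auto
  also have "\<dots> = (\<Sum>i\<in>?S. Poly_Mapping.lookup \<alpha> i) + (\<Sum>i\<in>?S. Poly_Mapping.lookup \<beta> i)"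
    by (simp add: lookup_add sum.distrib)
  also have "\<dots> = keysum \<alpha> + keysum \<beta>"
    by (simp add: keysum_superset[of ?S])
  finally show ?thesis .
qed

lemma monomial_value_add: "monomial_value (\<alpha> + \<beta>) z = monomial_value \<alpha> z * monomial_value \<beta> z"
proof -
  let ?S = "Poly_Mapping.keys \<alpha> \<union> Poly_Mapping.keys \<beta>"
  have "monomial_value (\<alpha> + \<beta>) z = (\<Prod>i\<in>?S. (z !\<^sub>v i) ^ Poly_Mapping.lookup (\<alpha> + \<beta>) i)"
    using keys_add[of \<alpha> \<beta>] by (intro monomial_value_superset) auto
  also have "\<dots> = (\<Prod>i\<in>?S. (z !\<^sub>v i) ^ Poly_Mapping.lookup \<alpha> i) * (\<Prod>i\<in>?S. (z !\<^sub>v i) ^ Poly_Mapping.lookup \<beta> i)"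
    by (simp add: lookup_add power_add prod.distrib)
  also have "\<dots> = monomial_value \<alpha> z * monomial_value \<beta> z"
    by (simp add: monomial_value_superset[of ?S])
  finally show ?thesis .
qed

lemma poly_value_superset:
  "finite S \<Longrightarrow> Poly_Mapping.keys p \<subseteq> S \<Longrightarrow>
    poly_value p z = (\<Sum>\<alpha>\<in>S. Poly_Mapping.lookup p \<alpha> * monomial_value \<alpha> z)"
  unfolding poly_value_def monomial_value_def
  by (rule sum.mono_neutral_left) (auto simp: in_keys_iff)

lemma poly_value_add: "poly_value (p + q) z = poly_value p z + poly_value q z"
proof -
  let ?S = "Poly_Mapping.keys p \<union> Poly_Mapping.keys q"
  have "poly_value (p + q) z = (\<Sum>\<alpha>\<in>?S. Poly_Mapping.lookup (p + q) \<alpha> * monomial_value \<alpha> z)"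
    using keys_add[of p q] by (intro poly_value_superset) auto
  also have "\<dots> = poly_value p z + poly_value q z"
    by (simp add: poly_value_superset[of ?S] lookup_add distrib_right sum.distrib)
  finally show ?thesis .
qed

lemma poly_value_single: "poly_value (Poly_Mapping.single \<alpha> c) z = c * monomial_value \<alpha> z"
  by (subst poly_value_superset[of "{\<alpha>}"]) auto

lemma poly_value_zero [simp]: "poly_value 0 z = 0"
  by (simp add: poly_value_def)

lemma poly_value_sum: "poly_value (\<Sum>a\<in>A. p a) z = (\<Sum>a\<in>A. poly_value (p a) z)"
  by (induction A rule: infinite_finite_induct) (auto simp: poly_value_add)

lemma sum_single_keys:
  fixes p :: cpoly
  shows "(\<Sum>\<alpha>\<in>Poly_Mapping.keys p. Poly_Mapping.single \<alpha> (Poly_Mapping.lookup p \<alpha>)) = p"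
proof (rule poly_mapping_eqI)
  fix \<beta>
  have "Poly_Mapping.lookup (\<Sum>\<alpha>\<in>Poly_Mapping.keys p. Poly_Mapping.single \<alpha> (Poly_Mapping.lookup p \<alpha>)) \<beta>
      = (\<Sum>\<alpha>\<in>Poly_Mapping.keys p. if \<alpha> = \<beta> then Poly_Mapping.lookup p \<alpha> else 0)"
    unfolding lookup_sum by (rule sum.cong) (auto simp: lookup_single when_def)
  also have "\<dots> = Poly_Mapping.lookup p \<beta>" by (auto simp: in_keys_iff)
  finally show "Poly_Mapping.lookup (\<Sum>\<alpha>\<in>Poly_Mapping.keys p. Poly_Mapping.single \<alpha> (Poly_Mapping.lookup p \<alpha>)) \<beta>
      = Poly_Mapping.lookup p \<beta>" .
qed

lemma poly_value_mult: "poly_value (p * q) z = poly_value p z * poly_value q z"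
proof -
  let ?s = "\<lambda>p :: cpoly. \<Sum>\<alpha>\<in>Poly_Mapping.keys p. Poly_Mapping.single \<alpha> (Poly_Mapping.lookup p \<alpha>)"
  have val: "poly_value r z = (\<Sum>\<alpha>\<in>Poly_Mapping.keys r. Poly_Mapping.lookup r \<alpha> * monomial_value \<alpha> z)" for r
    by (rule poly_value_superset) auto
  have "poly_value (p * q) z = poly_value (?s p * ?s q) z" by (simp only: sum_single_keys)
  also have "\<dots> = (\<Sum>\<alpha>\<in>Poly_Mapping.keys p. \<Sum>\<beta>\<in>Poly_Mapping.keys q.
      Poly_Mapping.lookup p \<alpha> * Poly_Mapping.lookup q \<beta> * (monomial_value \<alpha> z * monomial_value \<beta> z))"
    by (simp add: sum_product poly_value_sum mult_single poly_value_single monomial_value_add)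
  also have "\<dots> = poly_value p z * poly_value q z"
    unfolding val sum_product by (intro sum.cong) (auto simp: mult_ac)
  finally show ?thesis .
qed

lemma total_degree_le_iff: "total_degree p \<le> d \<longleftrightarrow> (\<forall>\<alpha>\<in>Poly_Mapping.keys p. keysum \<alpha> \<le> d)"
  unfolding total_degree_def by (subst Max_le_iff) auto

text \<open>Unlike \<open>polynomial_function\<close> this carries a degree bound, which the test
  polynomials for optimality need.\<close>

definition polyfun :: "nat \<Rightarrow> nat \<Rightarrow> (cvec \<Rightarrow> complex) \<Rightarrow> bool" where
  "polyfun n d g \<longleftrightarrow> (\<exists>p\<in>polys n. total_degree p \<le> d \<and> (\<forall>z\<in>carrier_vec n. g z = poly_value p z))"

lemma polynomial_function_iff: "polynomial_function n g \<longleftrightarrow> (\<exists>d. polyfun n d g)"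
  unfolding polynomial_function_def polyfun_def by blast

lemma polyfun_cong:
  "polyfun n d g \<Longrightarrow> (\<And>z. z \<in> carrier_vec n \<Longrightarrow> g z = h z) \<Longrightarrow> polyfun n d h"
  unfolding polyfun_def by auto

lemma polyfun_mono: "polyfun n d g \<Longrightarrow> d \<le> d' \<Longrightarrow> polyfun n d' g"
  unfolding polyfun_def using order_trans by blast

lemma polyfun_const: "polyfun n d (\<lambda>z. c)"
proof -
  have "Poly_Mapping.single 0 c \<in> polys n" by (auto simp: polys_def split: if_splits)
  moreover have "total_degree (Poly_Mapping.single 0 c) \<le> d"
    unfolding total_degree_le_iff by (auto split: if_splits)
  ultimately show ?thesis unfolding polyfun_def
    by (intro bexI[of _ "Poly_Mapping.single 0 c"]) (auto simp: poly_value_single monomial_value_def)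
qed

lemma polyfun_coord:
  assumes "i < n"
  shows "polyfun n 1 (\<lambda>z. z !\<^sub>v i)"
proof -
  let ?p = "Poly_Mapping.single (Poly_Mapping.single i 1) 1 :: cpoly"
  have "?p \<in> polys n" "total_degree ?p \<le> 1" "poly_value ?p z = z !\<^sub>v i" for z
    unfolding total_degree_le_iff using assms
    by (auto simp: polys_def poly_value_single monomial_value_def)
  then show ?thesis unfolding polyfun_def by auto
qed

lemma polyfun_add:
  assumes "polyfun n d g" "polyfun n d h"
  shows "polyfun n d (\<lambda>z. g z + h z)"
proof -
  from assms obtain p q where p: "p \<in> polys n" "total_degree p \<le> d" "\<forall>z\<in>carrier_vec n. g z = poly_value p z"
    and q: "q \<in> polys n" "total_degree q \<le> d" "\<forall>z\<in>carrier_vec n. h z = poly_value q z"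
    unfolding polyfun_def by blast
  have "p + q \<in> polys n" "total_degree (p + q) \<le> d"
    using p q keys_add[of p q] unfolding polys_def total_degree_le_iff by blast+
  then show ?thesis using p q unfolding polyfun_def
    by (intro bexI[of _ "p + q"]) (auto simp: poly_value_add)
qed

lemma polyfun_mult:
  assumes "polyfun n d g" "polyfun n e h"
  shows "polyfun n (d + e) (\<lambda>z. g z * h z)"
proof -
  from assms obtain p q where p: "p \<in> polys n" "total_degree p \<le> d" "\<forall>z\<in>carrier_vec n. g z = poly_value p z"
    and q: "q \<in> polys n" "total_degree q \<le> e" "\<forall>z\<in>carrier_vec n. h z = poly_value q z"
    unfolding polyfun_def by blast
  have key: "\<exists>\<beta>\<in>Poly_Mapping.keys p. \<exists>\<gamma>\<in>Poly_Mapping.keys q. \<alpha> = \<beta> + \<gamma>"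
    if "\<alpha> \<in> Poly_Mapping.keys (p * q)" for \<alpha>
    using subsetD[OF keys_mult that] by blast
  have "p * q \<in> polys n"
    unfolding polys_def
  proof (intro CollectI ballI)
    fix \<alpha> assume "\<alpha> \<in> Poly_Mapping.keys (p * q)"
    from key[OF this] obtain \<beta> \<gamma> where \<beta>: "\<beta> \<in> Poly_Mapping.keys p" "\<gamma> \<in> Poly_Mapping.keys q" "\<alpha> = \<beta> + \<gamma>"
      by blast
    then have "Poly_Mapping.keys \<beta> \<subseteq> {..<n}" "Poly_Mapping.keys \<gamma> \<subseteq> {..<n}"
      using p(1) q(1) unfolding polys_def by auto
    then show "Poly_Mapping.keys \<alpha> \<subseteq> {..<n}"
      unfolding \<beta>(3) using keys_add[of \<beta> \<gamma>] by (meson Un_least order_trans)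
  qed
  moreover have "total_degree (p * q) \<le> d + e"
    unfolding total_degree_le_iff
  proof
    fix \<alpha> assume "\<alpha> \<in> Poly_Mapping.keys (p * q)"
    from key[OF this] obtain \<beta> \<gamma> where "\<beta> \<in> Poly_Mapping.keys p" "\<gamma> \<in> Poly_Mapping.keys q" "\<alpha> = \<beta> + \<gamma>"
      by blast
    then show "keysum \<alpha> \<le> d + e"
      using p(2) q(2) unfolding total_degree_le_iff by (metis keysum_add add_mono)
  qed
  ultimately show ?thesis using p q unfolding polyfun_def
    by (intro bexI[of _ "p * q"]) (auto simp: poly_value_mult)
qed

lemma polyfun_sum:
  assumes "\<And>a. a \<in> A \<Longrightarrow> polyfun n d (g a)"
  shows "polyfun n d (\<lambda>z. \<Sum>a\<in>A. g a z)"
  using assms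
proof (induction A rule: infinite_finite_induct)
  case (insert x F)
  then show ?case using polyfun_add[of n d "g x" "\<lambda>z. \<Sum>a\<in>F. g a z"] by simp
qed (auto intro: polyfun_const)

lemma polyfun_power:
  assumes "polyfun n d g"
  shows "polyfun n (m * d) (\<lambda>z. g z ^ m)"
proof (induction m)
  case (Suc m)
  then show ?case using polyfun_mult[OF assms Suc] by simp
qed (auto intro: polyfun_const)

lemma polyfun_prod:
  assumes "\<And>a. a \<in> A \<Longrightarrow> polyfun n (d a) (g a)"
  shows "polyfun n (\<Sum>a\<in>A. d a) (\<lambda>z. \<Prod>a\<in>A. g a z)"
  using assms
proof (induction A rule: infinite_finite_induct)
  case (insert x F)
  then show ?case using polyfun_mult[of n "d x" "g x" "\<Sum>a\<in>F. d a" "\<lambda>z. \<Prod>a\<in>F. g a z"] by simp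
qed (auto intro: polyfun_const)

lemma poly_value_alt:
  "poly_value p z = (\<Sum>\<alpha>\<in>Poly_Mapping.keys p. Poly_Mapping.lookup p \<alpha> * monomial_value \<alpha> z)"
  by (rule poly_value_superset) auto

lemma polyfun_compose:
  assumes p: "p \<in> polys m" and g: "\<And>i. i < m \<Longrightarrow> polyfun n D (\<lambda>z. \<zeta> z !\<^sub>v i)"
  shows "polyfun n (total_degree p * D) (\<lambda>z. poly_value p (\<zeta> z))"
  unfolding poly_value_alt
proof (rule polyfun_sum)
  fix \<alpha> assume \<alpha>: "\<alpha> \<in> Poly_Mapping.keys p"
  then have sub: "Poly_Mapping.keys \<alpha> \<subseteq> {..<m}" using p by (auto simp: polys_def)
  have "polyfun n (\<Sum>i\<in>Poly_Mapping.keys \<alpha>. Poly_Mapping.lookup \<alpha> i * D) (\<lambda>z. monomial_value \<alpha> (\<zeta> z))"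
    unfolding monomial_value_def by (intro polyfun_prod polyfun_power g) (use sub in auto)
  moreover have "(\<Sum>i\<in>Poly_Mapping.keys \<alpha>. Poly_Mapping.lookup \<alpha> i * D) \<le> total_degree p * D"
    unfolding sum_distrib_right[symmetric] using total_degree_le_iff[of p "total_degree p"] \<alpha>
    by (intro mult_right_mono) auto
  ultimately have "polyfun n (total_degree p * D) (\<lambda>z. monomial_value \<alpha> (\<zeta> z))" by (rule polyfun_mono)
  from polyfun_mult[OF polyfun_const[of n 0 "Poly_Mapping.lookup p \<alpha>"] this]
  show "polyfun n (total_degree p * D) (\<lambda>z. Poly_Mapping.lookup p \<alpha> * monomial_value \<alpha> (\<zeta> z))" by simp
qed

section \<open>Bidegrees of polynomial expressions\<close>

lemma bideg_const: "bideg d (\<lambda>x v. c)"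
  unfolding bideg_def by (intro exI[of _ "[:[:c:]:]"]) (auto simp: coeff_pCons split: nat.splits)

lemma bideg_mono: "bideg d Q \<Longrightarrow> d \<le> e \<Longrightarrow> bideg e Q"
  unfolding bideg_def using order_trans by blast

lemma bideg_add:
  assumes "bideg d Q" "bideg d R"
  shows "bideg d (\<lambda>x v. Q x v + R x v)"
proof -
  from assms obtain P P' :: "complex poly poly" where
    P: "degree P \<le> d" "\<forall>j. degree (coeff P j) \<le> d" "\<forall>x v. Q x v = poly (poly P [:v:]) x" and
    P': "degree P' \<le> d" "\<forall>j. degree (coeff P' j) \<le> d" "\<forall>x v. R x v = poly (poly P' [:v:]) x"
    unfolding bideg_def by blast
  show ?thesis unfolding bideg_def
    by (intro exI[of _ "P + P'"]) (use P P' in \<open>auto intro!: degree_add_le\<close>)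
qed

lemma bideg_mult:
  assumes "bideg d Q" "bideg e R"
  shows "bideg (d + e) (\<lambda>x v. Q x v * R x v)"
proof -
  from assms obtain P P' :: "complex poly poly" where
    P: "degree P \<le> d" "\<forall>j. degree (coeff P j) \<le> d" "\<forall>x v. Q x v = poly (poly P [:v:]) x" and
    P': "degree P' \<le> e" "\<forall>j. degree (coeff P' j) \<le> e" "\<forall>x v. R x v = poly (poly P' [:v:]) x"
    unfolding bideg_def by blast
  have "degree (coeff (P * P') j) \<le> d + e" for j
    unfolding coeff_mult
    by (rule degree_sum_le) (use P P' in \<open>auto intro!: order_trans[OF degree_mult_le] add_mono\<close>)
  moreover have "degree (P * P') \<le> d + e"
    using order_trans[OF degree_mult_le add_mono[OF P(1) P'(1)]] .
  ultimately show ?thesis unfolding bideg_def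
    by (intro exI[of _ "P * P'"]) (use P P' in auto)
qed

lemma bideg_sum:
  assumes "\<And>a. a \<in> A \<Longrightarrow> bideg d (Q a)"
  shows "bideg d (\<lambda>x v. \<Sum>a\<in>A. Q a x v)"
  using assms
proof (induction A rule: infinite_finite_induct)
  case (insert x F)
  then show ?case using bideg_add[of d "Q x" "\<lambda>y v. \<Sum>a\<in>F. Q a y v"] by simp
qed (auto intro: bideg_const)

lemma bideg_power: "bideg d Q \<Longrightarrow> bideg (m * d) (\<lambda>x v. Q x v ^ m)"
proof (induction m)
  case (Suc m)
  then show ?case using bideg_mult[of d Q "m * d" "\<lambda>x v. Q x v ^ m"] by simp
qed (auto intro: bideg_const)

lemma bideg_prod:
  assumes "\<And>a. a \<in> A \<Longrightarrow> bideg (d a) (Q a)"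
  shows "bideg (\<Sum>a\<in>A. d a) (\<lambda>x v. \<Prod>a\<in>A. Q a x v)"
  using assms
proof (induction A rule: infinite_finite_induct)
  case (insert y F)
  then show ?case using bideg_mult[of "d y" "Q y" "\<Sum>a\<in>F. d a" "\<lambda>x v. \<Prod>a\<in>F. Q a x v"] by simp
qed (auto intro: bideg_const)

lemma bideg_fst_var: "bideg 1 (\<lambda>x v. a + x * b)"
  unfolding bideg_def by (intro exI[of _ "[:[:a, b:]:]"]) (auto simp: coeff_pCons split: nat.splits)

lemma bideg_snd_var: "bideg 1 (\<lambda>x v. v)"
  unfolding bideg_def by (intro exI[of _ "[:0, 1:]"]) (auto simp: coeff_pCons split: nat.splits)

lemma bideg_poly_value:
  assumes p: "p \<in> polys m" "total_degree p \<le> k" and g: "\<And>i. i < m \<Longrightarrow> bideg D (\<lambda>x v. \<zeta> x v !\<^sub>v i)"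
  shows "bideg (k * D) (\<lambda>x v. poly_value p (\<zeta> x v))"
  unfolding poly_value_alt
proof (rule bideg_sum)
  fix \<alpha> assume \<alpha>: "\<alpha> \<in> Poly_Mapping.keys p"
  then have sub: "Poly_Mapping.keys \<alpha> \<subseteq> {..<m}" using p by (auto simp: polys_def)
  have "bideg (\<Sum>i\<in>Poly_Mapping.keys \<alpha>. Poly_Mapping.lookup \<alpha> i * D) (\<lambda>x v. monomial_value \<alpha> (\<zeta> x v))"
    unfolding monomial_value_def by (intro bideg_prod bideg_power g) (use sub in auto)
  moreover have "(\<Sum>i\<in>Poly_Mapping.keys \<alpha>. Poly_Mapping.lookup \<alpha> i * D) \<le> k * D"
    unfolding sum_distrib_right[symmetric] using total_degree_le_iff[of p k] p(2) \<alpha>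
    by (intro mult_right_mono) auto
  ultimately have "bideg (k * D) (\<lambda>x v. monomial_value \<alpha> (\<zeta> x v))" by (rule bideg_mono)
  from bideg_mult[OF bideg_const[of 0 "Poly_Mapping.lookup p \<alpha>"] this]
  show "bideg (k * D) (\<lambda>x v. Poly_Mapping.lookup p \<alpha> * monomial_value \<alpha> (\<zeta> x v))" by simp
qed

lemma poly_value_bounded:
  assumes p: "p \<in> polys m"
  shows "\<exists>B. \<forall>z. (\<forall>i<m. cmod (z !\<^sub>v i) \<le> r) \<longrightarrow> cmod (poly_value p z) \<le> B"
proof (intro exI allI impI)
  fix z :: cvec assume z: "\<forall>i<m. cmod (z !\<^sub>v i) \<le> r"
  show "cmod (poly_value p z) \<le>
      (\<Sum>\<alpha>\<in>Poly_Mapping.keys p. cmod (Poly_Mapping.lookup p \<alpha>) * (\<Prod>i\<in>Poly_Mapping.keys \<alpha>. r ^ Poly_Mapping.lookup \<alpha> i))"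
    unfolding poly_value_alt
  proof (rule order_trans[OF norm_sum], rule sum_mono)
    fix \<alpha> assume "\<alpha> \<in> Poly_Mapping.keys p"
    then have sub: "Poly_Mapping.keys \<alpha> \<subseteq> {..<m}" using p by (auto simp: polys_def)
    have "cmod (monomial_value \<alpha> z) \<le> (\<Prod>i\<in>Poly_Mapping.keys \<alpha>. r ^ Poly_Mapping.lookup \<alpha> i)"
      unfolding monomial_value_def prod_norm[symmetric]
      by (rule prod_mono) (use sub z in \<open>auto simp: norm_power intro!: power_mono\<close>)
    then show "cmod (Poly_Mapping.lookup p \<alpha> * monomial_value \<alpha> z) \<le>
       cmod (Poly_Mapping.lookup p \<alpha>) * (\<Prod>i\<in>Poly_Mapping.keys \<alpha>. r ^ Poly_Mapping.lookup \<alpha> i)"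
      by (simp add: norm_mult mult_left_mono)
  qed
qed

section \<open>Growth of nonpolynomial entire functions\<close>

definition lagrange_basis :: "nat \<Rightarrow> nat \<Rightarrow> complex \<Rightarrow> complex" where
  "lagrange_basis d i x = (\<Prod>j\<in>{..d} - {i}. (x - of_nat j) * (1 / (of_nat i - of_nat j)))"

lemma lagrange_interpolation:
  assumes "degree p \<le> d"
  shows "poly p x = (\<Sum>i\<le>d. poly p (of_nat i) * lagrange_basis d i x)"
proof -
  define L where "L = (\<lambda>i. \<Prod>j\<in>{..d} - {i}. Polynomial.smult (1 / (of_nat i - of_nat j :: complex)) [:- of_nat j, 1:])"
  define r where "r = (\<Sum>i\<le>d. Polynomial.smult (poly p (of_nat i)) (L i))"
  have L: "poly (L i) x = lagrange_basis d i x" for i x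
    unfolding L_def poly_prod lagrange_basis_def by (rule prod.cong) (auto simp: diff_divide_distrib)
  have dL: "degree (L i) \<le> d" if "i \<le> d" for i
  proof -
    have "degree (L i) \<le> (\<Sum>j\<in>{..d} - {i}. degree (Polynomial.smult (1 / (of_nat i - of_nat j :: complex)) [:- of_nat j, 1:]))"
      unfolding L_def by (rule order_trans[OF degree_prod_sum_le]) (auto simp: o_def)
    also have "\<dots> \<le> (\<Sum>j\<in>{..d} - {i}. 1)" by (rule sum_mono) simp
    also have "\<dots> = d" using that by simp
    finally show ?thesis .
  qed
  have node: "lagrange_basis d i (of_nat l) = (if i = l then 1 else 0)" if "i \<le> d" "l \<le> d" for i l
  proof (cases "i = l")
    case True
    then show ?thesis unfolding lagrange_basis_def by (auto intro!: prod.neutral)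
  next
    case False
    then have "l \<in> {..d} - {i}" using that by auto
    then show ?thesis using False unfolding lagrange_basis_def by (auto intro!: prod_zero)
  qed
  have "p = r"
  proof (rule poly_eqI_degree[where A = "of_nat ` {..d}"])
    fix x :: complex assume "x \<in> of_nat ` {..d}"
    then obtain l where l: "l \<le> d" "x = of_nat l" by auto
    have "poly r x = (\<Sum>i\<le>d. if i = l then poly p (of_nat i) else 0)"
      unfolding r_def poly_sum l(2) by (rule sum.cong) (use l node in \<open>auto simp: L\<close>)
    then show "poly p x = poly r x" using l by simp
  next
    have c: "card (of_nat ` {..d} :: complex set) = d + 1"
      by (subst card_image) (auto simp: inj_on_def)
    then show "degree p < card (of_nat ` {..d} :: complex set)" using assms by simp
    have "degree r \<le> d" unfolding r_def
      by (rule degree_sum_le) (use dL in \<open>auto intro: order_trans[OF degree_smult_le]\<close>)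
    then show "degree r < card (of_nat ` {..d} :: complex set)" using c by simp
  qed
  then have "poly p x = poly r x" by simp
  also have "\<dots> = (\<Sum>i\<le>d. poly p (of_nat i) * lagrange_basis d i x)"
    by (simp add: r_def poly_sum L)
  finally show ?thesis .
qed

lemma polyfun_lagrange_basis:
  assumes "l < n" "i \<le> d"
  shows "polyfun n d (\<lambda>z. lagrange_basis d i (z !\<^sub>v l))"
proof -
  have "polyfun n (\<Sum>j\<in>{..d} - {i}. 1) (\<lambda>z. lagrange_basis d i (z !\<^sub>v l))"
    unfolding lagrange_basis_def
  proof (rule polyfun_prod)
    fix j
    have "polyfun n (1 + 0) (\<lambda>z. (z !\<^sub>v l + - of_nat j) * (1 / (of_nat i - of_nat j)))"
      by (intro polyfun_mult polyfun_add polyfun_coord polyfun_const assms)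
    then show "polyfun n 1 (\<lambda>z. (z !\<^sub>v l - of_nat j) * (1 / (of_nat i - of_nat j)))" by simp
  qed
  then show ?thesis using assms by simp
qed

lemma slice_entire_shift:
  assumes f: "slice_entire n f" and e: "e \<in> carrier_vec n"
  shows "slice_entire n (\<lambda>z. f (line n z e c))"
  unfolding slice_entire_def
proof (intro conjI ballI allI)
  fix a b :: cvec assume ab: "a \<in> carrier_vec n" "b \<in> carrier_vec n"
  have "line n (line n a b x) e c = line n (line n a e c) b x" for x
    by (rule carrier_vec_eqI[of _ n]) auto
  then show "(\<lambda>x. f (line n (line n a b x) e c)) holomorphic_on UNIV"
    using slice_entireD[OF f line_carrier[of n a e c] ab(2)] by simp
next
  fix r
  obtain B where B: "\<And>z. z \<in> carrier_vec n \<Longrightarrow> euclid_norm z \<le> r + cmod c * euclid_norm e \<Longrightarrow> cmod (f z) \<le> B"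
    using f unfolding slice_entire_def by blast
  show "\<exists>B. \<forall>z\<in>carrier_vec n. euclid_norm z \<le> r \<longrightarrow> cmod (f (line n z e c)) \<le> B"
  proof (intro exI ballI impI)
    fix z :: cvec assume z: "z \<in> carrier_vec n" "euclid_norm z \<le> r"
    show "cmod (f (line n z e c)) \<le> B"
      using order_trans[OF euclid_norm_line_le[OF z(1) e, of c]] z(2) by (intro B) auto
  qed
qed

definition trunc :: "nat \<Rightarrow> nat \<Rightarrow> cvec \<Rightarrow> cvec" where
  "trunc n j z = Matrix.vec n (\<lambda>i. if i < j then z !\<^sub>v i else 0)"

lemma trunc_carrier [simp]: "trunc n j z \<in> carrier_vec n"
  by (simp add: trunc_def)

text \<open>Liouville in one variable at a time: along the new coordinate \<open>f\<close> is a polynomial of degree at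
  most \<open>d\<close>, hence determined by its values at \<open>0, \<dots>, d\<close>.\<close>

lemma polyfun_trunc_of_growth:
  assumes "j \<le> n" "slice_entire n f"
    and "\<And>z. z \<in> carrier_vec n \<Longrightarrow> cmod (f z) \<le> C * (1 + euclid_norm z) ^ d"
  shows "polyfun n (j * d) (\<lambda>z. f (trunc n j z))"
  using assms
proof (induction j arbitrary: f C)
  case 0
  have "trunc n 0 z = 0\<^sub>v n" for z by (rule carrier_vec_eqI[of _ n]) (auto simp: trunc_def)
  then show ?case by (simp add: polyfun_const)
next
  case (Suc j)
  define e :: cvec where "e = Matrix.vec n (\<lambda>i. if i = j then 1 else 0)"
  have e: "e \<in> carrier_vec n" by (simp add: e_def)
  have C0: "0 \<le> C" using order_trans[OF norm_ge_zero Suc.prems(3)[of "0\<^sub>v n"]] by simp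
  have each: "polyfun n (j * d) (\<lambda>z. f (line n (trunc n j z) e (of_nat i)))" for i
  proof (rule Suc.IH)
    show "slice_entire n (\<lambda>z. f (line n z e (of_nat i)))" by (rule slice_entire_shift[OF Suc.prems(2) e])
    fix z :: cvec assume z: "z \<in> carrier_vec n"
    let ?K = "real i * euclid_norm e"
    have "cmod (f (line n z e (of_nat i))) \<le> C * (1 + euclid_norm (line n z e (of_nat i))) ^ d"
      by (rule Suc.prems(3)) simp
    also have "\<dots> \<le> C * ((1 + ?K) * (1 + euclid_norm z)) ^ d"
    proof (intro mult_left_mono power_mono C0)
      have "1 + euclid_norm (line n z e (of_nat i)) \<le> 1 + (euclid_norm z + ?K)"
        using euclid_norm_line_le[OF z e, of "of_nat i"] by simp
      also have "\<dots> \<le> (1 + ?K) * (1 + euclid_norm z)" by (simp add: algebra_simps)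
      finally show "1 + euclid_norm (line n z e (of_nat i)) \<le> (1 + ?K) * (1 + euclid_norm z)" .
    qed (simp add: add_nonneg_nonneg)
    finally show "cmod (f (line n z e (of_nat i))) \<le> (C * (1 + ?K) ^ d) * (1 + euclid_norm z) ^ d"
      by (simp add: power_mult_distrib mult.assoc)
  qed (use Suc.prems in simp)
  have eq: "f (trunc n (Suc j) z) = (\<Sum>i\<le>d. f (line n (trunc n j z) e (of_nat i)) * lagrange_basis d i (z !\<^sub>v j))"
    for z
  proof -
    let ?a = "trunc n j z" and ?K = "2 + euclid_norm (trunc n j z) + euclid_norm e"
    let ?g = "\<lambda>x. f (line n ?a e x)"
    have hol: "?g holomorphic_on UNIV" by (rule slice_entireD[OF Suc.prems(2) trunc_carrier e])
    have gr: "cmod (?g x) \<le> (C * ?K ^ d) * norm x ^ d" if x: "1 \<le> norm x" for x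
    proof -
      have "cmod (?g x) \<le> C * (1 + euclid_norm (line n ?a e x)) ^ d" by (rule Suc.prems(3)) simp
      also have "\<dots> \<le> C * (?K * norm x) ^ d"
      proof (intro mult_left_mono power_mono C0)
        have "1 + euclid_norm (line n ?a e x) \<le> 1 * 1 + euclid_norm ?a * 1 + norm x * euclid_norm e"
          using euclid_norm_line_le[OF trunc_carrier e, where x = x] by simp
        also have "\<dots> \<le> 2 * norm x + euclid_norm ?a * norm x + norm x * euclid_norm e"
          using x by (intro add_mono mult_mono) auto
        finally show "1 + euclid_norm (line n ?a e x) \<le> ?K * norm x" by (simp add: algebra_simps)
      qed (simp add: add_nonneg_nonneg)
      finally show ?thesis by (simp add: power_mult_distrib mult.assoc)
    qed
    define p where "p = (\<Sum>k\<le>d. monom ((deriv ^^ k) ?g 0 / fact k) k)"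
    have p: "?g x = poly p x" for x
      using Liouville_polynomial[OF hol gr, where \<xi> = x] by (simp add: p_def poly_sum poly_monom)
    have "degree p \<le> d" unfolding p_def
      by (rule degree_sum_le) (auto intro: order_trans[OF degree_monom_le])
    then have "?g (z !\<^sub>v j) = (\<Sum>i\<le>d. ?g (of_nat i) * lagrange_basis d i (z !\<^sub>v j))"
      unfolding p by (rule lagrange_interpolation)
    moreover have "line n ?a e (z !\<^sub>v j) = trunc n (Suc j) z"
      by (rule carrier_vec_eqI[of _ n]) (auto simp: trunc_def e_def less_Suc_eq)
    ultimately show ?thesis by simp
  qed
  have "polyfun n (j * d + d) (\<lambda>z. \<Sum>i\<le>d. f (line n (trunc n j z) e (of_nat i)) * lagrange_basis d i (z !\<^sub>v j))"
    by (intro polyfun_sum polyfun_mult each polyfun_lagrange_basis) (use Suc.prems in auto)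
  then show ?case unfolding eq by (simp add: add.commute)
qed

lemma polynomial_function_of_growth:
  assumes f: "slice_entire n f" and gr: "\<And>z. z \<in> carrier_vec n \<Longrightarrow> cmod (f z) \<le> C * (1 + euclid_norm z) ^ d"
  shows "polynomial_function n f"
proof -
  have "polyfun n (n * d) (\<lambda>z. f (trunc n n z))"
    by (rule polyfun_trunc_of_growth[OF _ f gr]) auto
  moreover have "trunc n n z = z" if "z \<in> carrier_vec n" for z
    by (rule carrier_vec_eqI[of _ n]) (use that in \<open>auto simp: trunc_def\<close>)
  ultimately have "polyfun n (n * d) f" by (auto intro: polyfun_cong)
  then show ?thesis unfolding polynomial_function_iff by blast
qed

lemma not_polynomial_nonzero:
  assumes "\<not> polynomial_function n f"
  obtains z0 where "z0 \<in> carrier_vec n" "f z0 \<noteq> 0"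
proof -
  have "\<exists>z0\<in>carrier_vec n. f z0 \<noteq> 0"
  proof (rule ccontr)
    assume "\<not> ?thesis"
    then have "polyfun n 0 f" using polyfun_cong[OF polyfun_const[of n 0 0], of f] by auto
    then show False using assms unfolding polynomial_function_iff by blast
  qed
  then show ?thesis using that by blast
qed

lemma phi_diff_mono:
  assumes "slice_entire n f" "z0 \<in> carrier_vec n" "f z0 \<noteq> 0" "t \<le> t'"
  shows "phi n f t - phi n f (t - 1) \<le> phi n f t' - phi n f (t' - 1)"
  using convex_slope_le[OF phi_convex[OF assms(1-3)], of "t - 1" t "t' - 1" t'] assms(4) by simp

text \<open>Liouville's theorem: the increments of a convex function increase, so if they did not
  eventually exceed \<open>K\<close>, none would, \<open>phi\<close> would grow at most linearly and
  \<open>f\<close> would be a polynomial.\<close>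

lemma phi_diff_unbounded:
  assumes f: "slice_entire n f" and np: "\<not> polynomial_function n f"
  shows "\<exists>t0. \<forall>t\<ge>t0. K \<le> phi n f t - phi n f (t - 1)"
proof (rule ccontr)
  assume neg: "\<not> ?thesis"
  obtain z0 where z0: "z0 \<in> carrier_vec n" "f z0 \<noteq> 0" using not_polynomial_nonzero[OF np] .
  let ?\<phi> = "phi n f"
  have less: "?\<phi> t - ?\<phi> (t - 1) \<le> K" for t
  proof (rule ccontr)
    assume "\<not> ?thesis"
    then have "\<forall>t'\<ge>t. K \<le> ?\<phi> t' - ?\<phi> (t' - 1)"
      using phi_diff_mono[OF f z0] by (meson le_cases order_trans not_le)
    then show False using neg by blast
  qed
  have lin: "?\<phi> t \<le> ?\<phi> 0 + K * t" if t: "1 \<le> t" for t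
  proof -
    have "(?\<phi> t - ?\<phi> 0) / (t - 0) \<le> (?\<phi> t - ?\<phi> (t - 1)) / (t - (t - 1))"
      by (rule convex_slope_le[OF phi_convex[OF f z0]]) (use t in auto)
    also have "\<dots> \<le> K" using less[of t] by simp
    finally show ?thesis using t by (simp add: divide_le_eq)
  qed
  define d where "d = nat \<lceil>\<bar>K\<bar>\<rceil>"
  have K: "K \<le> d" unfolding d_def by linarith
  have "polynomial_function n f"
  proof (rule polynomial_function_of_growth[OF f])
    fix z :: cvec assume z: "z \<in> carrier_vec n"
    \<comment> \<open>Since \<open>exp 1 \<le> 3\<close>, the 3 ensures \<open>t \<ge> 1\<close>,
      where \<open>lin\<close> applies.\<close>
    define t where "t = ln (3 + euclid_norm z)"
    have N: "0 < 3 + euclid_norm z" using euclid_norm_nonneg[of z] by linarith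
    have "exp 1 \<le> 3 + euclid_norm z" using exp_le euclid_norm_nonneg[of z] by linarith
    then have t: "1 \<le> t" "exp t = 3 + euclid_norm z" using N by (auto simp: t_def ln_ge_iff)
    have "cmod (f z) \<le> exp (?\<phi> t)" using t by (intro cmod_le_exp_phi[OF f z0 z]) simp
    also have "\<dots> \<le> exp (?\<phi> 0 + d * t)"
    proof -
      have "K * t \<le> d * t" using K t by (intro mult_right_mono) auto
      then show ?thesis using lin[OF t(1)] by simp
    qed
    also have "\<dots> = exp (?\<phi> 0) * (3 + euclid_norm z) ^ d" by (simp add: exp_add exp_of_nat_mult t)
    also have "\<dots> \<le> exp (?\<phi> 0) * (3 * (1 + euclid_norm z)) ^ d"
      by (intro mult_left_mono power_mono) (auto intro: add_nonneg_nonneg)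
    finally show "cmod (f z) \<le> (exp (?\<phi> 0) * 3 ^ d) * (1 + euclid_norm z) ^ d"
      by (simp only: power_mult_distrib mult.assoc)
  qed
  then show False using np by contradiction
qed

section \<open>The growth condition for class C\<close>

text \<open>Used with a large \<open>c\<close>, to replace a logarithm by a small multiple of its
  argument and a constant.\<close>

lemma ln_le_linear:
  fixes x c :: real
  assumes "0 < x" "0 < c"
  shows "ln x \<le> x / c + ln c"
proof -
  have "ln (x / c) \<le> x / c - 1" using assms by (intro ln_le_minus_one) simp
  then show ?thesis using assms by (simp add: ln_div)
qed

text \<open>\<open>T\<close> is the first point, in unit steps, at which the increment \<Delta>
  reaches \<open>K * k\<close>. The bounded ratio of consecutive increments prevents an overshoot by
  more than a constant factor and keeps the increments up to \<open>T + 2\<close> comparable to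
  \<open>k\<close>. So the fixed step \<open>s = 1/10\<close> gives a cost of order
  \<open>k\<^sup>2\<close>.\<close>

lemma class_C_I_growth_cond:
  assumes f: "slice_entire n f" and np: "\<not> polynomial_function n f" and I: "class_C_I n f"
  shows "growth_cond n f (\<lambda>k. real k ^ 2)"
  unfolding growth_cond_def
proof
  fix t0 :: real
  obtain z0 where z0: "z0 \<in> carrier_vec n" "f z0 \<noteq> 0" using not_polynomial_nonzero[OF np] .
  define \<Delta> where "\<Delta> = (\<lambda>t. phi n f t - phi n f (t - 1))"
  obtain H where H: "1 \<le> H" "\<forall>\<^sub>F t in at_top. (phi n f (t + 1) - phi n f t) / (phi n f t - phi n f (t - 1)) < H"
  proof -
    let ?L = "Limsup at_top (\<lambda>t::real. ereal ((phi n f (t + 1) - phi n f t) / (phi n f t - phi n f (t - 1))))"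
    have "?L < \<infinity>" using I by (simp add: class_C_I_def)
    then obtain c where c: "?L < ereal c" by (metis ereal_dense2 less_PInf_Ex_of_nat)
    then have "\<forall>\<^sub>F t in at_top. ereal ((phi n f (t + 1) - phi n f t) / (phi n f t - phi n f (t - 1))) < ereal c"
      by (rule Limsup_lessD)
    then have "\<forall>\<^sub>F t in at_top. (phi n f (t + 1) - phi n f t) / (phi n f t - phi n f (t - 1)) < max 1 c"
      by eventually_elim auto
    then show ?thesis by (intro that[of "max 1 c"]) auto
  qed
  obtain ta where ta: "\<And>t. t \<ge> ta \<Longrightarrow> 1 \<le> \<Delta> t" using phi_diff_unbounded[OF f np, of 1] by (auto simp: \<Delta>_def)
  obtain tb where tb: "\<And>t. t \<ge> tb \<Longrightarrow> (phi n f (t + 1) - phi n f t) / (phi n f t - phi n f (t - 1)) < H"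
    using H(2) unfolding eventually_at_top_linorder by auto
  define t2 where "t2 = max t0 (max ta tb)"
  have t2: "t0 \<le> t2" "ta \<le> t2" "tb \<le> t2" by (auto simp: t2_def)
  have ratio: "\<Delta> (t + 1) \<le> H * \<Delta> t" if "t \<ge> t2" for t
    using tb[of t] ta[of t] that t2 by (simp add: \<Delta>_def divide_less_eq split: if_splits)
  \<comment> \<open>For \<open>s = 1/10\<close> the point \<open>T + 20 * s\<close> is
    \<open>T + 2\<close>, so \<open>A\<close> consists of three unit increments, each of the later
    two at most \<open>H\<close> times its predecessor.\<close>
  define H' where "H' = 1 + H + H ^ 2"
  have H': "1 \<le> H'" using H(1) by (simp add: H'_def)
  \<comment> \<open>The number 12000 turns \<open>3000 * ln (\<Delta> T)\<close> into a quarter of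
    \<open>\<Delta> T\<close> and a constant; the other three quarters cover
    \<open>3000 * (k + c2)\<close>, because \<open>K * k \<ge> 4000 * (k + c2)\<close>.\<close>
  define c2 where "c2 = ln (10 * H') + ln 12000"
  have c2: "0 \<le> c2" unfolding c2_def using H' by (intro add_nonneg_nonneg) auto
  define K where "K = 4000 * (1 + c2)"
  have K: "0 < K" using c2 by (simp add: K_def)
  define C where "C = 10 * (H' * (\<Delta> t2 + H * K))"
  have D2: "1 \<le> \<Delta> t2" using ta t2 by simp
  have C0: "0 \<le> C" unfolding C_def using H' D2 H K by simp
  have main: "\<exists>T\<ge>t0. \<exists>s. growth_at n f k T s \<and>
      k * (phi n f (T + 20 * s) - phi n f (T - 1)) / s \<le> C * real k ^ 2" if k: "k \<ge> 1" for k
  proof -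
    obtain tc where tc: "\<And>t. t \<ge> tc \<Longrightarrow> K * k \<le> \<Delta> t"
      using phi_diff_unbounded[OF f np, of "K * k"] by (auto simp: \<Delta>_def)
    obtain N :: nat where N: "tc - t2 \<le> N" using real_arch_simple by blast
    define P where "P = (\<lambda>i::nat. K * k \<le> \<Delta> (t2 + i))"
    have "P N" unfolding P_def using N by (intro tc) simp
    define i where "i = (LEAST i. P i)"
    have Pi: "P i" unfolding i_def using \<open>P N\<close> by (rule LeastI)
    define T where "T = t2 + real i"
    have T: "t2 \<le> T" by (simp add: T_def)
    have low: "K * k \<le> \<Delta> T" using Pi by (simp add: P_def T_def)
    have up: "\<Delta> T \<le> (\<Delta> t2 + H * K) * k"
    proof (cases i)
      case 0
      have "\<Delta> t2 * 1 \<le> \<Delta> t2 * k" using k D2 by (intro mult_left_mono) auto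
      also have "\<dots> \<le> (\<Delta> t2 + H * K) * k" using H K by (intro mult_right_mono) auto
      finally show ?thesis using 0 by (simp add: T_def)
    next
      case (Suc j)
      then have "\<not> P j" unfolding i_def by (intro not_less_Least) simp
      then have "\<Delta> (t2 + j) \<le> K * k" by (simp add: P_def)
      then have "H * \<Delta> (t2 + j) \<le> H * (K * k)" using H by (intro mult_left_mono) auto
      moreover have "\<Delta> T \<le> H * \<Delta> (t2 + j)" using ratio[of "t2 + j"] Suc by (simp add: T_def add.commute add.left_commute)
      moreover have "H * (K * k) \<le> (\<Delta> t2 + H * K) * k" using D2 by (simp add: algebra_simps)
      ultimately show ?thesis by linarith
    qed
    have D1: "1 \<le> \<Delta> T" using ta T t2 by simp
    define A where "A = phi n f (T + 2) - phi n f (T - 1)"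
    have A_eq: "A = \<Delta> (T + 2) + \<Delta> (T + 1) + \<Delta> T" by (simp add: A_def \<Delta>_def add.commute)
    have "\<Delta> (T + 1) \<le> H * \<Delta> T" by (rule ratio[OF T])
    moreover have "\<Delta> (T + 2) \<le> H * \<Delta> (T + 1)" using ratio[of "T + 1"] T by (simp add: add.assoc)
    moreover have "H * \<Delta> (T + 1) \<le> H * (H * \<Delta> T)" using ratio[OF T] H by (intro mult_left_mono) auto
    ultimately have A_le: "A \<le> H' * \<Delta> T" by (simp add: A_eq H'_def algebra_simps power2_eq_square)
    have "\<Delta> T \<le> A" unfolding A_eq using ta[of "T + 2"] ta[of "T + 1"] T t2 by simp
    then have A1: "1 \<le> A" using D1 by simp
    have lnA: "ln (A / (1/10)) \<le> \<Delta> T / 12000 + c2"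
    proof -
      have "ln (A / (1/10)) \<le> ln (10 * H' * \<Delta> T)" using A_le A1 H' D1 by (subst ln_le_cancel_iff) auto
      also have "\<dots> = ln (10 * H') + ln (\<Delta> T)" using H' D1 by (intro ln_mult_pos) auto
      also have "ln (\<Delta> T) \<le> \<Delta> T / 12000 + ln 12000" using D1 by (intro ln_le_linear) auto
      finally show ?thesis by (simp add: c2_def)
    qed
    have "growth_at n f k T (1/10)"
      unfolding growth_at_def
    proof (intro conjI)
      show "1 \<le> phi n f T - phi n f (T - 1)" using D1 by (simp add: \<Delta>_def)
      have Kk: "4000 * k + 4000 * c2 \<le> \<Delta> T"
      proof -
        have "c2 * 1 \<le> c2 * k" using c2 k by (intro mult_left_mono) auto
        then show ?thesis using low by (simp add: K_def algebra_simps)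
      qed
      have "300 / (1/10) * (k + ln (A / (1/10))) \<le> 3000 * (k + (\<Delta> T / 12000 + c2))" using lnA by simp
      also have "\<dots> \<le> \<Delta> T" using Kk c2 by simp
      finally show "300 / (1/10) * (k + ln ((phi n f (T + 20 * (1/10)) - phi n f (T - 1)) / (1/10)))
          \<le> phi n f T - phi n f (T - 1)" by (simp add: A_def \<Delta>_def)
    qed auto
    moreover have "k * (phi n f (T + 20 * (1/10)) - phi n f (T - 1)) / (1/10) \<le> C * real k ^ 2"
    proof -
      have "A \<le> H' * ((\<Delta> t2 + H * K) * k)"
        using A_le up mult_left_mono[OF up, of H'] H' by linarith
      then have "10 * k * A \<le> 10 * k * (H' * ((\<Delta> t2 + H * K) * k))" by (intro mult_left_mono) auto
      also have "\<dots> = C * real k ^ 2" by (simp add: C_def power2_eq_square)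
      finally show ?thesis by (simp add: A_def mult_ac)
    qed
    ultimately show ?thesis using T t2 by (intro exI[of _ T] conjI exI[of _ "1/10"]) auto
  qed
  then show "\<exists>C\<ge>0. \<forall>k\<ge>1. \<exists>T\<ge>t0. \<exists>s. growth_at n f k T s \<and>
      k * (phi n f (T + 20 * s) - phi n f (T - 1)) / s \<le> C * real k ^ 2"
    using C0 by blast
qed

section \<open>Convex functions and derivatives off a countable set\<close>

lemma convex_countable_nondifferentiable:
  fixes \<psi> :: "real \<Rightarrow> real"
  assumes "convex_on UNIV \<psi>"
  shows "countable {t. \<not> \<psi> differentiable (at t)}"
proof -
  define D where "D = (\<lambda>x y. (\<psi> y - \<psi> x) / (y - x))"
  have Dsym: "D x y = D y x" for x y unfolding D_def by (metis minus_diff_eq minus_divide_divide)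
  have D: "D a b \<le> D c d" if "a < b" "a \<le> c" "b \<le> d" "c < d" for a b c d
    unfolding D_def by (rule convex_slope_le[OF assms that])
  \<comment> \<open>The right derivative of \<psi>. It is monotone, hence continuous off a countable
    set, and \<psi> is differentiable wherever it is continuous.\<close>
  define r where "r = (\<lambda>x. INF y\<in>{x<..}. D x y)"
  have bdd: "bdd_below (D x ` {x<..})" for x
    by (intro bdd_belowI[of _ "D (x - 1) x"]) (auto intro: D)
  have r_le: "r x \<le> D x y" if "x < y" for x y
    unfolding r_def by (rule cINF_lower[OF bdd]) (use that in auto)
  have le_r: "D x y \<le> r y" if "x < y" for x y
    unfolding r_def by (rule cINF_greatest) (use that in \<open>auto intro: D\<close>)
  have "mono r"
  proof (rule monoI)
    fix x y :: real assume "x \<le> y"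
    then show "r x \<le> r y" using r_le[of x y] le_r[of x y] by (cases "x = y") auto
  qed
  then have "countable {t. \<not> isCont r t}" by (rule mono_ctble_discont)
  moreover have "\<psi> differentiable (at t)" if "isCont r t" for t
  proof -
    have "((\<lambda>y. (\<psi> y - \<psi> t) / (y - t)) \<longlongrightarrow> r t) (at t)"
    proof (rule LIM_zero_cancel, rule Lim_null_comparison)
      show "((\<lambda>y. \<bar>r y - r t\<bar>) \<longlongrightarrow> 0) (at t)"
        using that unfolding isCont_def by (intro tendsto_rabs_zero LIM_zero)
      \<comment> \<open>On either side of \<open>t\<close>, the difference quotient between
        \<open>t\<close> and \<open>y\<close> lies between \<open>r t\<close> and
        \<open>r y\<close>.\<close>
      show "\<forall>\<^sub>F y in at t. norm ((\<psi> y - \<psi> t) / (y - t) - r t) \<le> \<bar>r y - r t\<bar>"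
        unfolding eventually_at_filter
      proof (intro always_eventually allI impI)
        fix y assume "y \<noteq> t"
        have "(\<psi> y - \<psi> t) / (y - t) = D t y" by (simp add: D_def)
        then show "norm ((\<psi> y - \<psi> t) / (y - t) - r t) \<le> \<bar>r y - r t\<bar>"
          using r_le[of t y] le_r[of t y] r_le[of y t] le_r[of y t] Dsym[of t y] \<open>y \<noteq> t\<close>
          by (cases "t < y") auto
      qed
    qed
    then have "(\<psi> has_field_derivative r t) (at t)" by (simp add: has_field_derivative_iff)
    then show ?thesis using field_differentiable_def real_differentiable_def by blast
  qed
  then have "{t. \<not> \<psi> differentiable (at t)} \<subseteq> {t. \<not> isCont r t}" by blast
  ultimately show ?thesis by (rule countable_subset[rotated])
qed

text \<open>A level that \<open>u\<close> crosses downwards and that avoids the countable set \<open>u ` S\<close> would be crossed at a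
  point of positive derivative.\<close>

lemma increasing_of_pos_derivative_off_countable:
  fixes u :: "real \<Rightarrow> real"
  assumes "a \<le> b" and u: "continuous_on {a..b} u" and S: "countable S"
    and D: "\<And>x. x \<in> {a..b} - S \<Longrightarrow> \<exists>d>0. (u has_real_derivative d) (at x)"
  shows "u a \<le> u b"
proof (rule ccontr)
  assume "\<not> u a \<le> u b"
  then have "uncountable ({u b<..<u a} - u ` S)"
    using S by (intro uncountable_minus_countable) (auto simp: uncountable_open_interval)
  then obtain c where c: "u b < c" "c < u a" "c \<notin> u ` S"
    by (metis Diff_iff countable_empty ex_in_conv greaterThanLessThan_iff)
  define E where "E = {a..b} \<inter> u -` {c..}"
  have cl: "closed E" unfolding E_def using u by (intro continuous_closed_preimage) auto
  have ne: "a \<in> E" using \<open>a \<le> b\<close> c by (auto simp: E_def)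
  have bdd: "bdd_above E" by (intro bdd_aboveI[of _ b]) (auto simp: E_def)
  \<comment> \<open>The last point at which \<open>u\<close> is at least \<open>c\<close>. There
    \<open>u x = c\<close>, and a positive derivative would lift \<open>u\<close> above
    \<open>c\<close> further to the right.\<close>
  define x where "x = Sup E"
  have xE: "x \<in> E" unfolding x_def using cl ne bdd by (intro closed_contains_Sup) auto
  then have x: "a \<le> x" "x \<le> b" "c \<le> u x" by (auto simp: E_def)
  have le: "z \<le> x" if "z \<in> E" for z unfolding x_def using that bdd by (rule cSup_upper)
  have "\<exists>z\<ge>x. z \<le> b \<and> u z = c"
    by (rule IVT2') (use x c u in \<open>auto intro: continuous_on_subset\<close>)
  then obtain z where z: "x \<le> z" "z \<le> b" "u z = c" by blast
  then have "z \<in> E" using x by (auto simp: E_def)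
  then have ux: "u x = c" using le[of z] z by simp
  then have "x \<notin> S" using c by auto
  then obtain d where "d > 0" "(u has_real_derivative d) (at x)" using D[of x] x by auto
  then obtain e where e: "e > 0" "\<And>h. 0 < h \<Longrightarrow> h < e \<Longrightarrow> u x < u (x + h)"
    using DERIV_pos_inc_right by blast
  have xb: "x < b" using ux c x by (cases "x = b") auto
  define h where "h = min (e / 2) (b - x)"
  have h: "0 < h" "h < e" "x + h \<le> b" using e xb by (auto simp: h_def)
  then have "x + h \<in> E" using e(2)[of h] ux x by (auto simp: E_def)
  then show False using le[of "x + h"] h by simp
qed

text \<open>The exponents found for infinite order tend to 0 but need not decrease. The supremum
  over the tail is their least decreasing majorant, and \<open>max 0\<close> makes it
  nonnegative.\<close>

lemma decreasing_envelope:
  fixes \<delta> :: "nat \<Rightarrow> real"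
  assumes "\<delta> \<longlonglongrightarrow> 0"
  shows "\<exists>\<epsilon>. (\<forall>k. 0 \<le> \<epsilon> k) \<and> (\<forall>k. \<delta> k \<le> \<epsilon> k) \<and> decseq \<epsilon> \<and> \<epsilon> \<longlonglongrightarrow> 0"
proof -
  define \<epsilon> where "\<epsilon> = (\<lambda>k. SUP j\<in>{k..}. max 0 (\<delta> j))"
  have "Bseq \<delta>" using assms by (intro convergent_imp_Bseq) (auto simp: convergent_def)
  then obtain B where B: "\<And>j. norm (\<delta> j) \<le> B" unfolding Bseq_def by blast
  have bdd: "bdd_above ((\<lambda>j. max 0 (\<delta> j)) ` {k..})" for k
  proof (intro bdd_aboveI[of _ "max 0 B"])
    fix x assume "x \<in> (\<lambda>j. max 0 (\<delta> j)) ` {k..}"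
    then obtain j where "x = max 0 (\<delta> j)" by auto
    then show "x \<le> max 0 B" using B[of j] by auto
  qed
  have up: "max 0 (\<delta> j) \<le> \<epsilon> k" if "k \<le> j" for j k
    unfolding \<epsilon>_def by (rule cSUP_upper[OF _ bdd]) (use that in auto)
  have pos: "0 \<le> \<epsilon> k" and dom: "\<delta> k \<le> \<epsilon> k" for k using up[of k k] by auto
  have dec: "decseq \<epsilon>"
    unfolding decseq_def \<epsilon>_def by (intro allI impI cSUP_subset_mono bdd) auto
  have "\<epsilon> \<longlonglongrightarrow> 0"
  proof (rule LIMSEQ_I)
    fix e :: real assume e: "0 < e"
    then obtain N where N: "\<And>j. j \<ge> N \<Longrightarrow> norm (\<delta> j) < e / 2" using LIMSEQ_D[OF assms, of "e / 2"] by auto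
    have "\<epsilon> k \<le> e / 2" if "k \<ge> N" for k
      unfolding \<epsilon>_def
    proof (rule cSUP_least)
      fix j assume "j \<in> {k..}"
      then show "max 0 (\<delta> j) \<le> e / 2" using N[of j] that e by (auto simp: abs_less_iff)
    qed auto
    then have "norm (\<epsilon> k - 0) < e" if "k \<ge> N" for k using that pos[of k] e by force
    then show "\<exists>no. \<forall>k\<ge>no. norm (\<epsilon> k - 0) < e" by blast
  qed
  then show ?thesis using pos dom dec by blast
qed

text \<open>The finitely many \<open>k\<close> below \<open>N\<close> borrow the point
  \<open>T N\<close>: \<open>growth_at\<close> for \<open>N\<close> implies it for smaller degrees,
  and the constant covers their cost because \<open>\<mu> k \<ge> 1\<close>.\<close>

lemma growth_cond_of_sequence:
  assumes f: "slice_entire n f" "z0 \<in> carrier_vec n" "f z0 \<noteq> 0"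
    and T: "filterlim T at_top sequentially"
    and gr: "\<forall>\<^sub>F k in sequentially. growth_at n f k (T k) (s k)"
    and cost: "\<forall>\<^sub>F k in sequentially. k * (phi n f (T k + 20 * s k) - phi n f (T k - 1)) / s k \<le> \<mu> k"
    and \<mu>: "\<And>k. 1 \<le> k \<Longrightarrow> 1 \<le> \<mu> k"
  shows "growth_cond n f \<mu>"
  unfolding growth_cond_def
proof
  fix t0
  have "\<forall>\<^sub>F k in sequentially. t0 \<le> T k" using T by (simp add: filterlim_at_top)
  with gr cost have "\<forall>\<^sub>F k in sequentially. t0 \<le> T k \<and> growth_at n f k (T k) (s k) \<and>
      k * (phi n f (T k + 20 * s k) - phi n f (T k - 1)) / s k \<le> \<mu> k"
    by eventually_elim auto
  then obtain N where N: "\<And>k. k \<ge> N \<Longrightarrow> t0 \<le> T k" "\<And>k. k \<ge> N \<Longrightarrow> growth_at n f k (T k) (s k)"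
    "\<And>k. k \<ge> N \<Longrightarrow> k * (phi n f (T k + 20 * s k) - phi n f (T k - 1)) / s k \<le> \<mu> k"
    unfolding eventually_sequentially by blast
  define A where "A = phi n f (T N + 20 * s N) - phi n f (T N - 1)"
  have sN: "0 < s N" using N(2)[of N] by (simp add: growth_at_def)
  have A0: "0 \<le> A" using phi_mono[OF f, of "T N - 1" "T N + 20 * s N"] sN by (simp add: A_def)
  define C where "C = max 1 (N * A / s N)"
  have "\<exists>Ta\<ge>t0. \<exists>sa. growth_at n f k Ta sa \<and>
      k * (phi n f (Ta + 20 * sa) - phi n f (Ta - 1)) / sa \<le> C * \<mu> k" if k: "k \<ge> 1" for k
  proof (cases "k \<ge> N")
    case True
    have "1 * \<mu> k \<le> C * \<mu> k" using \<mu>[OF k] by (intro mult_right_mono) (auto simp: C_def)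
    then show ?thesis using N[OF True] by (intro exI[of _ "T k"] conjI exI[of _ "s k"]) auto
  next
    case False
    have "growth_at n f k (T N) (s N)"
    proof -
      have "300 / s N * (k + l) \<le> 300 / s N * (N + l)" for l :: real
        using False sN by (intro mult_left_mono) auto
      then show ?thesis using N(2)[of N] unfolding growth_at_def by (meson order_refl order_trans)
    qed
    moreover have "k * A / s N \<le> C * \<mu> k"
    proof -
      have "k * A / s N \<le> N * A / s N" using False A0 sN by (intro divide_right_mono mult_right_mono) auto
      also have "\<dots> \<le> C * 1" by (simp add: C_def)
      also have "\<dots> \<le> C * \<mu> k" using \<mu>[OF k] by (intro mult_left_mono) (auto simp: C_def)
      finally show ?thesis .
    qed
    ultimately show ?thesis using N(1)[of N] by (intro exI[of _ "T N"] conjI exI[of _ "s N"]) (auto simp: A_def)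
  qed
  moreover have "0 \<le> C" by (simp add: C_def)
  ultimately show "\<exists>C\<ge>0. \<forall>k\<ge>1. \<exists>T\<ge>t0. \<exists>s. growth_at n f k T s \<and>
      k * (phi n f (T + 20 * s) - phi n f (T - 1)) / s \<le> C * \<mu> k" by blast
qed

lemma phi_at_top:
  assumes f: "slice_entire n f" and np: "\<not> polynomial_function n f"
  shows "filterlim (phi n f) at_top at_top"
proof -
  obtain z0 where z0: "z0 \<in> carrier_vec n" "f z0 \<noteq> 0" using not_polynomial_nonzero[OF np] .
  obtain ta where ta: "1 \<le> phi n f ta - phi n f (ta - 1)" using phi_diff_unbounded[OF f np, of 1] by blast
  have grow: "phi n f ta + (t - ta) \<le> phi n f t" if "t > ta" for t
  proof -
    have "(phi n f ta - phi n f (ta - 1)) / (ta - (ta - 1)) \<le> (phi n f t - phi n f ta) / (t - ta)"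
      by (rule convex_slope_le[OF phi_convex[OF f z0]]) (use that in auto)
    then have "1 \<le> (phi n f t - phi n f ta) / (t - ta)" using ta by simp
    then show ?thesis using that by (simp add: le_divide_eq)
  qed
  show ?thesis
    unfolding filterlim_at_top
  proof
    fix Z
    show "\<forall>\<^sub>F t in at_top. Z \<le> phi n f t"
      using eventually_gt_at_top[of "max ta (Z - phi n f ta + ta)"]
    proof eventually_elim
      case (elim t)
      then show ?case using grow[of t] by simp
    qed
  qed
qed

text \<open>Integrating the bound on the derivative of \<open>1 / ln \<psi>\<close> shows that \<open>ln \<psi>\<close> grows superlinearly and
  varies little over steps of length comparable to \<open>1 / ln \<psi>\<close>.\<close>

lemma slowly_varying_ln:
  fixes \<psi> :: "real \<Rightarrow> real"
  assumes cont: "continuous_on UNIV \<psi>" and conv: "convex_on UNIV \<psi>"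
    and top: "filterlim (\<lambda>t. ln (\<psi> t)) at_top at_top" and pos: "\<And>t. t \<ge> t1 \<Longrightarrow> 0 < \<psi> t"
    and lim: "((\<lambda>t. t\<^sup>2 * deriv (\<lambda>s. 1 / ln (\<psi> s)) t) \<longlongrightarrow> 0)
        (inf at_top (principal {t. \<psi> differentiable (at t)}))"
    and \<eta>: "0 < \<eta>"
  shows "\<forall>\<^sub>F t in at_top. 1 / ln (\<psi> t) \<le> \<eta> / t \<and>
    (\<forall>h\<ge>0. 1 / ln (\<psi> t) - 1 / ln (\<psi> (t + h)) \<le> \<eta> * h / t\<^sup>2)"
proof -
  define y where "y = (\<lambda>t. 1 / ln (\<psi> t))"
  have "\<forall>\<^sub>F t in inf at_top (principal {t. \<psi> differentiable (at t)}). - \<eta> < t\<^sup>2 * deriv y t"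
    unfolding y_def using order_tendstoD(1)[OF lim, of "- \<eta>"] \<eta> by simp
  then have "\<forall>\<^sub>F t in at_top. \<psi> differentiable (at t) \<longrightarrow> - \<eta> < t\<^sup>2 * deriv y t"
    unfolding eventually_inf_principal by simp
  moreover have "\<forall>\<^sub>F t in at_top. 1 \<le> ln (\<psi> t)" using top by (simp add: filterlim_at_top)
  ultimately have "\<forall>\<^sub>F t in at_top. (\<psi> differentiable (at t) \<longrightarrow> - \<eta> < t\<^sup>2 * deriv y t) \<and> 1 \<le> ln (\<psi> t)"
    by (rule eventually_conj)
  then obtain t2 where t2: "\<And>t. t \<ge> t2 \<Longrightarrow> \<psi> differentiable (at t) \<Longrightarrow> - \<eta> < t\<^sup>2 * deriv y t"
    "\<And>t. t \<ge> t2 \<Longrightarrow> 1 \<le> ln (\<psi> t)"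
    unfolding eventually_at_top_linorder by blast
  define t3 where "t3 = max 1 (max t1 t2)"
  have t3: "1 \<le> t" "t1 \<le> t" "t2 \<le> t" if "t3 \<le> t" for t using that by (auto simp: t3_def)
  \<comment> \<open>The derivative of \<open>y t - \<eta> / t\<close> is
    \<open>deriv y t + \<eta> / t\<^sup>2\<close>, which the limit hypothesis makes positive
    wherever \<psi> is differentiable.\<close>
  have mono: "y a - \<eta> / a \<le> y b - \<eta> / b" if ab: "t3 \<le> a" "a \<le> b" for a b
  proof (rule increasing_of_pos_derivative_off_countable[OF ab(2) _ convex_countable_nondifferentiable[OF conv]])
    have ln_nz: "ln (\<psi> x) \<noteq> 0" "\<psi> x \<noteq> 0" "x \<noteq> 0" if "x \<in> {a..b}" for x
      using t2(2)[of x] pos[of x] t3[of x] that ab by auto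
    have "continuous_on {a..b} \<psi>" using cont continuous_on_subset by blast
    then show "continuous_on {a..b} (\<lambda>t. y t - \<eta> / t)"
      unfolding y_def using ln_nz by (intro continuous_intros) auto
    fix x assume x: "x \<in> {a..b} - {t. \<not> \<psi> differentiable (at t)}"
    then have xx: "x \<in> {a..b}" "\<psi> differentiable (at x)" by auto
    have xa: "t3 \<le> x" using xx ab by auto
    obtain d where d: "(\<psi> has_real_derivative d) (at x)"
      using xx(2) real_differentiable_def by blast
    have "(y has_real_derivative - (d / \<psi> x) / (ln (\<psi> x))\<^sup>2) (at x)"
      unfolding y_def using pos[of x] t3[OF xa] ln_nz[OF xx(1)]
      by (auto intro!: derivative_eq_intros d simp: power2_eq_square)
    then have "(y has_real_derivative deriv y x) (at x)" using DERIV_imp_deriv by metis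
    moreover have "((\<lambda>t. \<eta> / t) has_real_derivative - \<eta> / x\<^sup>2) (at x)"
      using ln_nz[OF xx(1)] by (auto intro!: derivative_eq_intros simp: power2_eq_square)
    ultimately have "((\<lambda>t. y t - \<eta> / t) has_real_derivative deriv y x - (- \<eta> / x\<^sup>2)) (at x)"
      by (rule DERIV_diff)
    moreover have "0 < deriv y x - (- \<eta> / x\<^sup>2)"
    proof -
      have "0 < x\<^sup>2" using ln_nz[OF xx(1)] by simp
      moreover have "- \<eta> < x\<^sup>2 * deriv y x" using t2(1)[of x] t3[OF xa] xx by auto
      ultimately have "- \<eta> / x\<^sup>2 < deriv y x" by (subst pos_divide_less_eq) (auto simp: mult.commute)
      then show ?thesis by simp
    qed
    ultimately show "\<exists>d>0. ((\<lambda>t. y t - \<eta> / t) has_real_derivative d) (at x)" by blast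
  qed
  have y0: "((\<lambda>t. y t - \<eta> / t) \<longlongrightarrow> 0 - 0) at_top"
  proof (intro tendsto_diff)
    show "(y \<longlongrightarrow> 0) at_top" unfolding y_def
      by (rule tendsto_divide_0[OF tendsto_const]) (rule filterlim_at_top_imp_at_infinity[OF top])
    show "((\<lambda>t. \<eta> / t) \<longlongrightarrow> 0) at_top" by real_asymp
  qed
  \<comment> \<open>Both claims follow from \<open>mono\<close>: the first by sending the right end
    to infinity, where \<open>y t - \<eta> / t\<close> tends to 0, the second with the right end
    \<open>t + h\<close>.\<close>
  have "y t \<le> \<eta> / t \<and> (\<forall>h\<ge>0. y t - y (t + h) \<le> \<eta> * h / t\<^sup>2)" if t: "t3 \<le> t" for t
  proof (intro conjI allI impI)
    have "\<forall>\<^sub>F b in at_top. y t - \<eta> / t \<le> y b - \<eta> / b"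
      using eventually_ge_at_top[of t] by eventually_elim (use mono t in auto)
    then have "y t - \<eta> / t \<le> 0 - 0" by (intro tendsto_lowerbound[OF y0]) auto
    then show "y t \<le> \<eta> / t" by simp
    fix h :: real assume h: "0 \<le> h"
    have tp: "0 < t" using t3[OF t] by simp
    have "y t - y (t + h) \<le> \<eta> / t - \<eta> / (t + h)" using mono[OF t, of "t + h"] h by simp
    also have "\<dots> = \<eta> * h / (t * (t + h))" using tp h by (simp add: field_simps)
    also have "\<dots> \<le> \<eta> * h / t\<^sup>2"
      unfolding power2_eq_square using tp h \<eta> by (intro divide_left_mono mult_left_mono) auto
    finally show "y t - y (t + h) \<le> \<eta> * h / t\<^sup>2" .
  qed
  then show ?thesis
    unfolding y_def by (rule eventually_mono[OF eventually_ge_at_top[of t3]])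
qed

text \<open>\<open>T k\<close> solves \<open>\<phi> (T k) = k * ln k ^ 4\<close>, and
  \<open>s k\<close> is \<open>1 / ln (\<psi> (T k))\<close>. As
  \<open>t \<le> ln (\<psi> t)\<close> for large \<open>t\<close>, the point \<open>T k\<close> is
  at most of order \<open>ln k\<close>, so by convexity the increment there is at least of order
  \<open>k * ln k ^ 3\<close>, more than \<open>growth_at\<close> demands. The hypothesis does not
  control \<phi> over a step of fixed length, but over one comparable to
  \<open>1 / ln \<psi>\<close> the logarithm of \<phi> changes by a factor tending to 1; hence the
  cost is \<open>k\<close> to a power tending to 2.\<close>

lemma class_C_II_growth_cond:
  assumes f: "slice_entire n f" and np: "\<not> polynomial_function n f" and II: "class_C_II n f"
  obtains \<epsilon> where "\<And>k. 0 \<le> \<epsilon> k" "decseq \<epsilon>" "\<epsilon> \<longlonglongrightarrow> 0" "growth_cond n f (\<lambda>k. real k powr (2 + \<epsilon> k))"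
proof -
  obtain z0 where z0: "z0 \<in> carrier_vec n" "f z0 \<noteq> 0" using not_polynomial_nonzero[OF np] .
  obtain \<psi> :: "real \<Rightarrow> real" where cont: "continuous_on UNIV \<psi>" and conv: "convex_on UNIV \<psi>" and mono: "mono \<psi>"
    and quot: "((\<lambda>t. ln (\<psi> t) / ln (phi n f t)) \<longlongrightarrow> 1) at_top"
    and lim: "((\<lambda>t. t\<^sup>2 * deriv (\<lambda>s. 1 / ln (\<psi> s)) t) \<longlongrightarrow> 0)
        (inf at_top (principal {t. \<psi> differentiable (at t)}))"
    using II unfolding class_C_II_def by blast
  define \<phi> where "\<phi> = phi n f"
  define L where "L = (\<lambda>t. ln (\<psi> t))"
  define l where "l = (\<lambda>t. ln (\<phi> t))"
  have \<phi>_mono: "\<phi> a \<le> \<phi> b" if "a \<le> b" for a b unfolding \<phi>_def by (rule phi_mono[OF f z0 that])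
  have \<phi>_top: "filterlim \<phi> at_top at_top" unfolding \<phi>_def by (rule phi_at_top[OF f np])
  have l_top: "filterlim l at_top at_top" unfolding l_def by (rule filterlim_compose[OF ln_at_top \<phi>_top])
  have Ll: "((\<lambda>t. L t / l t) \<longlongrightarrow> 1) at_top" using quot by (simp add: L_def l_def \<phi>_def)
  have l_pos: "\<forall>\<^sub>F t in at_top. 1 \<le> l t" using l_top by (simp add: filterlim_at_top)
  have L_top: "filterlim L at_top at_top"
  proof -
    have "filterlim (\<lambda>t. L t / l t * l t) at_top at_top"
      by (rule filterlim_tendsto_pos_mult_at_top[OF Ll _ l_top]) simp
    moreover have "\<forall>\<^sub>F t in at_top. L t / l t * l t = L t"
      using l_pos by eventually_elim auto
    ultimately show ?thesis using filterlim_cong[OF refl refl, of "\<lambda>t. L t / l t * l t" L at_top] by blast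
  qed
  have "\<exists>t1. \<forall>t\<ge>t1. 0 < \<psi> t"
  proof -
    \<comment> \<open>The real \<open>ln\<close> satisfies \<open>ln (- x) = ln x\<close> and
      \<open>ln 0 = 0\<close>, so \<open>ln \<psi>\<close> tending to infinity does not by itself
      make \<psi> positive. A nonpositive increasing \<psi>, however, has decreasing modulus and
      hence a logarithm bounded above on the half line.\<close>
    have "\<exists>t1. 0 < \<psi> t1"
    proof (rule ccontr)
      assume "\<not> ?thesis"
      then have neg: "\<psi> t \<le> 0" for t by (meson not_le)
      have "\<forall>\<^sub>F t in at_top. max 0 \<bar>ln (- \<psi> 0)\<bar> + 1 \<le> L t" using L_top by (simp add: filterlim_at_top)
      then obtain t where t: "max 0 \<bar>ln (- \<psi> 0)\<bar> + 1 \<le> L t" "0 \<le> t"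
        unfolding eventually_at_top_linorder by (metis linear max.cobounded2 order_refl)
      have "\<psi> 0 \<le> \<psi> t" using mono t(2) by (rule monoD)
      have "L t \<le> \<bar>ln (- \<psi> 0)\<bar>"
      proof (cases "\<psi> t = 0")
        case False
        then have "ln (- \<psi> t) \<le> ln (- \<psi> 0)" using neg[of t] \<open>\<psi> 0 \<le> \<psi> t\<close> by (subst ln_le_cancel_iff) auto
        then show ?thesis by (simp add: L_def ln_minus)
      qed (simp add: L_def)
      then show False using t by simp
    qed
    then show ?thesis using monoD[OF mono] by (meson less_le_trans)
  qed
  then obtain t1 where \<psi>_pos: "\<And>t. t \<ge> t1 \<Longrightarrow> 0 < \<psi> t" by blast
  have slow: "\<forall>\<^sub>F t in at_top. 1 / L t \<le> \<eta> / t \<and> (\<forall>h\<ge>0. 1 / L t - 1 / L (t + h) \<le> \<eta> * h / t\<^sup>2)"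
    if "0 < \<eta>" for \<eta>
    using slowly_varying_ln[OF cont conv L_top[unfolded L_def] \<psi>_pos lim that] by (simp add: L_def)
  \<comment> \<open>This is \<open>T + 20 * s\<close> for the step \<open>s = 1 / L T\<close> chosen
    below.\<close>
  define T' where "T' = (\<lambda>t. t + 20 * (1 / L t))"
  have L1: "\<forall>\<^sub>F t in at_top. 10 \<le> L t" using L_top by (simp add: filterlim_at_top)
  have T'_top: "filterlim T' at_top at_top"
  proof (rule filterlim_at_top_mono[OF filterlim_ident])
    show "\<forall>\<^sub>F t in at_top. t \<le> T' t" using L1 by eventually_elim (simp add: T'_def)
  qed
  have ratio: "((\<lambda>t. L t / L (T' t)) \<longlongrightarrow> 1) at_top"
  proof (rule tendstoI)
    fix e :: real assume e: "0 < e"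
    \<comment> \<open>The slow variation estimate with \<open>h = 20 / L t\<close>, multiplied by
      \<open>L t\<close>, leaves \<open>20 * \<eta>\<close>, which must be below
      \<open>e\<close>.\<close>
    define \<eta> where "\<eta> = e / 40"
    have \<eta>: "0 < \<eta>" using e by (simp add: \<eta>_def)
    show "\<forall>\<^sub>F t in at_top. dist (L t / L (T' t)) 1 < e"
      using slow[OF \<eta>] L1 eventually_ge_at_top[of "max 1 t1"]
    proof eventually_elim
      case (elim t)
      have t: "1 \<le> t" "t1 \<le> t" and Lt: "10 \<le> L t" using elim by auto
      have tT: "t \<le> T' t" using Lt by (simp add: T'_def)
      have "\<psi> t \<le> \<psi> (T' t)" using mono tT by (rule monoD)
      then have LL: "L t \<le> L (T' t)" unfolding L_def using \<psi>_pos[OF t(2)] by (subst ln_le_cancel_iff) auto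
      have "1 / L t - 1 / L (T' t) \<le> \<eta> * (20 * (1 / L t)) / t\<^sup>2"
        unfolding T'_def by (rule elim(1)[THEN conjunct2, rule_format]) (use Lt in simp)
      also have "\<dots> \<le> \<eta> * (20 * (1 / L t)) / 1"
        using t Lt \<eta> by (intro divide_left_mono) (auto simp: one_le_power)
      finally have "L t * (1 / L t - 1 / L (T' t)) \<le> L t * (\<eta> * (20 * (1 / L t)) / 1)"
        using Lt by (intro mult_left_mono) auto
      then have "1 - L t / L (T' t) \<le> 20 * \<eta>" using Lt by (simp add: right_diff_distrib)
      moreover have "20 * \<eta> < e" using e by (simp add: \<eta>_def)
      moreover have "L t / L (T' t) \<le> 1" using LL Lt by simp
      ultimately show ?case unfolding dist_real_def by linarith
    qed
  qed
  \<comment> \<open>Transfers slow variation from \<open>ln \<psi>\<close> to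
    \<open>ln \<phi>\<close>: for large \<open>t\<close>, \<open>\<phi> (T' t)\<close> is the power
    of \<open>\<phi> t\<close> with exponent \<open>\<gamma> t\<close>.\<close>
  define \<gamma> where "\<gamma> = (\<lambda>t. l (T' t) / l t)"
  have \<gamma>: "(\<gamma> \<longlongrightarrow> 1) at_top"
  proof -
    have "((\<lambda>t. (L t / l t) / (L t / L (T' t)) / (L (T' t) / l (T' t))) \<longlongrightarrow> 1 / 1 / 1) at_top"
      by (intro tendsto_divide ratio Ll filterlim_compose[OF Ll T'_top]) auto
    moreover have "\<forall>\<^sub>F t in at_top. (L t / l t) / (L t / L (T' t)) / (L (T' t) / l (T' t)) = \<gamma> t"
      using L1 eventually_compose_filterlim[OF L1 T'_top]
      by eventually_elim (auto simp: \<gamma>_def field_simps)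
    ultimately show ?thesis by (simp add: tendsto_cong)
  qed
  have late: "\<forall>\<^sub>F t in at_top. 10 \<le> L t \<and> L t \<le> 2 * l t \<and> t \<le> L t \<and> 1 \<le> t \<and> 1 \<le> \<phi> t \<and> 0 \<le> \<phi> (t - 1) \<and>
      \<phi> t / (2 * L t) \<le> \<phi> t - \<phi> (t - 1) \<and> \<gamma> t \<le> 2"
  proof -
    have "\<forall>\<^sub>F t in at_top. L t / l t < 2" using order_tendstoD(2)[OF Ll, of 2] by simp
    moreover have "\<forall>\<^sub>F t in at_top. \<gamma> t < 2" using order_tendstoD(2)[OF \<gamma>, of 2] by simp
    moreover have "\<forall>\<^sub>F t in at_top. max 1 (2 * \<phi> 0) \<le> \<phi> t" using \<phi>_top unfolding filterlim_at_top by blast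
    moreover have "\<forall>\<^sub>F t in at_top. 0 \<le> \<phi> (t - 1)"
    proof -
      have "\<forall>\<^sub>F t in at_top. 0 \<le> \<phi> t" using \<phi>_top by (simp add: filterlim_at_top)
      then obtain a where "\<And>t. t \<ge> a \<Longrightarrow> 0 \<le> \<phi> t" unfolding eventually_at_top_linorder by blast
      then show ?thesis by (intro eventually_mono[OF eventually_ge_at_top[of "a + 1"]]) simp
    qed
    moreover have "\<forall>\<^sub>F t in at_top. 1 / L t \<le> 1 / t"
      using slow[of 1] by (auto elim: eventually_mono)
    ultimately show ?thesis
      using L1 l_pos eventually_ge_at_top[of 1]
    proof eventually_elim
      case (elim t)
      have Lt: "10 \<le> L t" and t: "1 \<le> t" and lt: "1 \<le> l t" using elim by auto
      have "1 / L t \<le> 1 / t" using elim by simp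
      then have tL: "t \<le> L t" using Lt t by (simp add: field_simps)
      \<comment> \<open>By convexity the last unit increment is at least the mean slope from 0 to
        \<open>t\<close>, and \<open>t \<le> L t\<close> turns this into a bound by
        \<open>\<phi> t / (2 * L t)\<close>.\<close>
      have "(\<phi> t - \<phi> 0) / (t - 0) \<le> (\<phi> t - \<phi> (t - 1)) / (t - (t - 1))"
        unfolding \<phi>_def by (rule convex_slope_le[OF phi_convex[OF f z0]]) (use t in auto)
      then have slope: "(\<phi> t - \<phi> 0) / t \<le> \<phi> t - \<phi> (t - 1)" by simp
      have "\<phi> t / (2 * L t) \<le> \<phi> t / (2 * t)" using tL t elim by (intro divide_left_mono) auto
      also have "\<dots> = (\<phi> t / 2) / t" by simp
      also have "\<dots> \<le> (\<phi> t - \<phi> 0) / t" using elim t by (intro divide_right_mono) auto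
      finally have "\<phi> t / (2 * L t) \<le> \<phi> t - \<phi> (t - 1)" using slope by simp
      moreover have "L t \<le> 2 * l t" using elim lt by (simp add: divide_less_eq)
      ultimately show ?case using elim tL Lt t by auto
    qed
  qed
  \<comment> \<open>Two of the four logarithms are spent: one because the increment may be smaller
    than \<phi> by a factor of order \<open>L\<close>, one on the factor \<open>1 / s = L\<close> in
    \<open>growth_at\<close>. The others beat the constants.\<close>
  define X where "X = (\<lambda>k::nat. real k * ln (real k) ^ 4)"
  have X_top: "filterlim X at_top sequentially" unfolding X_def by real_asymp
  have "\<exists>t\<ge>0. \<phi> t = x" if "\<phi> 0 \<le> x" for x
  proof -
    have "\<forall>\<^sub>F t in at_top. x \<le> \<phi> t" using \<phi>_top by (simp add: filterlim_at_top)
    then obtain b where b: "x \<le> \<phi> b" "0 \<le> b"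
      unfolding eventually_at_top_linorder by (metis linear max.cobounded2 order_refl)
    have "continuous_on UNIV \<phi>" unfolding \<phi>_def
      by (rule convex_on_continuous[OF open_UNIV phi_convex[OF f z0]])
    then show ?thesis using IVT'[of \<phi> 0 x b] that b continuous_on_subset by blast
  qed
  then obtain S where S: "\<And>x. \<phi> 0 \<le> x \<Longrightarrow> 0 \<le> S x \<and> \<phi> (S x) = x" by metis
  define T where "T = (\<lambda>k. S (X k))"
  have T: "\<forall>\<^sub>F k in sequentially. \<phi> (T k) = X k"
  proof -
    have "\<forall>\<^sub>F k in sequentially. \<phi> 0 \<le> X k" using X_top by (simp add: filterlim_at_top)
    then show ?thesis by eventually_elim (simp add: T_def S)
  qed
  have T_top: "filterlim T at_top sequentially"
    unfolding filterlim_at_top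
  proof
    fix Z
    have "\<forall>\<^sub>F k in sequentially. \<phi> Z + 1 \<le> X k" using X_top by (simp add: filterlim_at_top)
    with T show "\<forall>\<^sub>F k in sequentially. Z \<le> T k"
    proof eventually_elim
      case (elim k)
      then have "\<not> \<phi> (T k) \<le> \<phi> Z" by simp
      then show ?case using \<phi>_mono[of "T k" Z] by linarith
    qed
  qed
  define s where "s = (\<lambda>k. 1 / L (T k))"
  have T's: "T' (T k) = T k + 20 * s k" for k by (simp add: T'_def s_def)
  have lateT: "\<forall>\<^sub>F k in sequentially. 10 \<le> L (T k) \<and> L (T k) \<le> 2 * l (T k) \<and> T k \<le> L (T k) \<and> 1 \<le> T k \<and>
      1 \<le> \<phi> (T k) \<and> 0 \<le> \<phi> (T k - 1) \<and>
      \<phi> (T k) / (2 * L (T k)) \<le> \<phi> (T k) - \<phi> (T k - 1) \<and> \<gamma> (T k) \<le> 2"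
    by (rule eventually_compose_filterlim[OF late T_top])
  have numeric: "\<forall>\<^sub>F k::nat in sequentially. 1 \<le> ln k \<and> ln (X k) \<le> 5 * ln k \<and>
      3000 * ln k * (k + 40 * ln k) \<le> k * ln k ^ 3 / 20 \<and> 1 \<le> k * ln k ^ 3 / 20"
    unfolding X_def by (intro eventually_conj; real_asymp)
  \<comment> \<open>Makes \<open>k * (\<phi> (T' (T k)) * L (T k))\<close>, which bounds the cost
    \<open>k * A / s\<close>, equal to \<open>k powr (2 + \<delta> k)\<close> for large
    \<open>k\<close>.\<close>
  define \<delta> where "\<delta> = (\<lambda>k::nat. ln (\<phi> (T' (T k)) * L (T k)) / ln k - 1)"
  have good: "\<forall>\<^sub>F k in sequentially. growth_at n f k (T k) (s k) \<and>
      k * (phi n f (T k + 20 * s k) - phi n f (T k - 1)) / s k \<le> k powr (2 + \<delta> k)"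
    using T lateT numeric
  proof eventually_elim
    case (elim k)
    define x where "x = ln (real k)"
    have LT: "10 \<le> L (T k)" and lT: "l (T k) \<le> 5 * x" and LT2: "L (T k) \<le> 2 * l (T k)" and x1: "1 \<le> x"
      and XT: "\<phi> (T k) = X k" and g2: "\<gamma> (T k) \<le> 2"
      using elim by (auto simp: l_def x_def)
    have k0: "0 < real k" using x1 by (cases k) (auto simp: x_def)
    have LT10: "L (T k) \<le> 10 * x" using LT2 lT by simp
    have TT: "T k \<le> T' (T k)" using LT by (simp add: T'_def)
    define A where "A = \<phi> (T' (T k)) - \<phi> (T k - 1)"
    have \<phi>T': "1 \<le> \<phi> (T' (T k))" using \<phi>_mono[OF TT] elim by simp
    have A_le: "A \<le> \<phi> (T' (T k))" using elim by (simp add: A_def)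
    have \<Delta>_ge: "k * x ^ 3 / 20 \<le> \<phi> (T k) - \<phi> (T k - 1)"
    proof -
      have "k * x ^ 3 / 20 = X k / (2 * (10 * x))" using x1 by (simp add: X_def x_def power4_eq_xxxx power3_eq_cube)
      also have "\<dots> \<le> X k / (2 * L (T k))"
      proof (rule divide_left_mono)
        show "0 \<le> X k" by (simp add: X_def)
      qed (use LT10 LT x1 in auto)
      also have "\<dots> \<le> \<phi> (T k) - \<phi> (T k - 1)" using elim XT by simp
      finally show ?thesis .
    qed
    have \<Delta>1: "1 \<le> \<phi> (T k) - \<phi> (T k - 1)" using \<Delta>_ge elim by (simp add: x_def)
    have A1: "1 \<le> A" using \<Delta>1 \<phi>_mono[OF TT] by (simp add: A_def)
    have lnA: "ln (A / s k) \<le> 20 * x"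
    proof -
      have "ln (A / s k) = ln (A * L (T k))" by (simp add: s_def)
      also have "\<dots> = ln A + ln (L (T k))" using A1 LT by (intro ln_mult_pos) auto
      also have "ln A \<le> l (T' (T k))" unfolding l_def using A1 A_le by (subst ln_le_cancel_iff) auto
      also have "l (T' (T k)) = \<gamma> (T k) * l (T k)" using LT LT2 by (simp add: \<gamma>_def)
      also have "\<dots> \<le> 2 * (5 * x)" using g2 lT LT LT2 by (intro mult_mono) auto
      also have "ln (L (T k)) \<le> L (T k)" using LT by (intro ln_bound) auto
      finally show ?thesis using LT10 by simp
    qed
    have "growth_at n f k (T k) (s k)"
      unfolding growth_at_def \<phi>_def[symmetric] T's[symmetric] A_def[symmetric]
    proof (intro conjI)
      show "0 < s k" "s k \<le> 1 / 10" using LT by (auto simp: s_def field_simps)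
      show "1 \<le> \<phi> (T k) - \<phi> (T k - 1)" by (rule \<Delta>1)
      have "300 / s k * (k + ln (A / s k)) \<le> 300 / s k * (k + 40 * x)"
        using lnA x1 LT by (intro mult_left_mono) (auto simp: s_def)
      also have "\<dots> = 300 * L (T k) * (k + 40 * x)" by (simp add: s_def)
      also have "\<dots> \<le> 300 * (10 * x) * (k + 40 * x)" using LT10 x1 by (intro mult_right_mono mult_left_mono) auto
      also have "\<dots> \<le> k * x ^ 3 / 20" using elim by (simp add: x_def)
      also note \<Delta>_ge
      finally show "300 / s k * (k + ln (A / s k)) \<le> \<phi> (T k) - \<phi> (T k - 1)" .
    qed
    moreover have "k * A / s k \<le> k powr (2 + \<delta> k)"
    proof -
      have "k * A / s k \<le> k * (\<phi> (T' (T k)) * L (T k))"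
        using A_le LT by (simp add: s_def mult_left_mono mult_right_mono mult.assoc)
      also have "\<dots> = exp (x + ln (\<phi> (T' (T k)) * L (T k)))"
        using k0 \<phi>T' LT by (simp add: exp_add x_def)
      also have "x + ln (\<phi> (T' (T k)) * L (T k)) = (2 + \<delta> k) * x"
        using x1 by (simp add: \<delta>_def x_def field_simps)
      also have "exp ((2 + \<delta> k) * x) = k powr (2 + \<delta> k)" using k0 by (simp add: powr_def x_def)
      finally show ?thesis .
    qed
    ultimately show ?case by (simp add: A_def \<phi>_def T's)
  qed
  \<comment> \<open>\<open>ln (\<phi> (T' (T k)))\<close> is
    \<open>\<gamma> (T k) * ln (X k)\<close>, asymptotic to \<open>ln k\<close>, while
    \<open>ln (L (T k))\<close> is at most of order \<open>ln (ln k)\<close>.\<close>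
  have "\<delta> \<longlonglongrightarrow> 0"
  proof -
    have "(\<lambda>k. \<gamma> (T k)) \<longlonglongrightarrow> 1" by (rule filterlim_compose[OF \<gamma> T_top])
    moreover have "(\<lambda>k. ln (X k) / ln (real k)) \<longlonglongrightarrow> 1" unfolding X_def by real_asymp
    moreover have "(\<lambda>k. ln (L (T k)) / ln (real k)) \<longlonglongrightarrow> 0"
    proof (rule tendsto_sandwich)
      show "\<forall>\<^sub>F k in sequentially. 0 \<le> ln (L (T k)) / ln (real k)"
        using lateT numeric by eventually_elim auto
      show "\<forall>\<^sub>F k in sequentially. ln (L (T k)) / ln (real k) \<le> ln (10 * ln (real k)) / ln (real k)"
        using T lateT numeric
      proof eventually_elim
        case (elim k)
        then have "L (T k) \<le> 10 * ln (real k)" by (simp add: l_def)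
        then show ?case using elim by (intro divide_right_mono) auto
      qed
      show "(\<lambda>k. ln (10 * ln (real k)) / ln (real k)) \<longlonglongrightarrow> 0" by real_asymp
    qed simp
    ultimately have "(\<lambda>k. \<gamma> (T k) * (ln (X k) / ln (real k)) + ln (L (T k)) / ln (real k) - 1) \<longlonglongrightarrow> 1 * 1 + 0 - 1"
      by (intro tendsto_intros)
    moreover have "\<forall>\<^sub>F k in sequentially. \<gamma> (T k) * (ln (X k) / ln (real k)) + ln (L (T k)) / ln (real k) - 1 = \<delta> k"
      using T lateT numeric
    proof eventually_elim
      case (elim k)
      have lT: "l (T k) = ln (X k)" "5 \<le> l (T k)" using elim by (auto simp: l_def)
      have "1 \<le> \<phi> (T' (T k))" using \<phi>_mono[of "T k" "T' (T k)"] elim by (simp add: T'_def)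
      then have "ln (\<phi> (T' (T k)) * L (T k)) = l (T' (T k)) + ln (L (T k))"
        unfolding l_def using elim by (intro ln_mult_pos) auto
      also have "l (T' (T k)) = \<gamma> (T k) * ln (X k)" using lT by (simp add: \<gamma>_def)
      finally show ?case using elim by (simp add: \<delta>_def add_divide_distrib)
    qed
    ultimately show ?thesis by (simp add: tendsto_cong)
  qed
  from decreasing_envelope[OF this] obtain \<epsilon> where
    \<epsilon>: "\<And>k. 0 \<le> \<epsilon> k" "\<And>k. \<delta> k \<le> \<epsilon> k" "decseq \<epsilon>" "\<epsilon> \<longlonglongrightarrow> 0" by blast
  have "growth_cond n f (\<lambda>k. real k powr (2 + \<epsilon> k))"
  proof (rule growth_cond_of_sequence[OF f z0 T_top])
    show "\<forall>\<^sub>F k in sequentially. growth_at n f k (T k) (s k)" using good by eventually_elim auto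
    show "\<forall>\<^sub>F k in sequentially. k * (phi n f (T k + 20 * s k) - phi n f (T k - 1)) / s k \<le> real k powr (2 + \<epsilon> k)"
      using good eventually_ge_at_top[of 1]
    proof eventually_elim
      case (elim k)
      have "real k powr (2 + \<delta> k) \<le> real k powr (2 + \<epsilon> k)" using elim \<epsilon>(2)[of k] by (intro powr_mono) auto
      then show ?case using elim by simp
    qed
    show "1 \<le> real k powr (2 + \<epsilon> k)" if "1 \<le> k" for k
      using that \<epsilon>(1)[of k] by (intro ge_one_powr_ge_zero) auto
  qed
  then show thesis using that \<epsilon> by blast
qed

section \<open>Products of functions\<close>

lemma growth_cond_cong: "growth_cond n f \<mu> \<Longrightarrow> (\<And>k. \<mu> k = \<mu>' k) \<Longrightarrow> growth_cond n f \<mu>'"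
  by (simp add: growth_cond_def)

lemma class_C_growth_cond:
  assumes "class_C n f"
  shows "\<exists>\<epsilon>. (\<forall>k. 0 \<le> \<epsilon> k) \<and> decseq \<epsilon> \<and> \<epsilon> \<longlonglongrightarrow> 0 \<and>
    (growth_order n f < \<infinity> \<longrightarrow> (\<forall>k. \<epsilon> k = 0)) \<and> growth_cond n f (\<lambda>k. real k powr (2 + \<epsilon> k))"
proof -
  have f: "slice_entire n f" and np: "\<not> polynomial_function n f"
    using assms by (auto simp: class_C_def entire_imp_slice_entire)
  show ?thesis
  proof (cases "class_C_I n f")
    case True
    have "growth_cond n f (\<lambda>k. real k powr (2 + 0))"
      by (rule growth_cond_cong[OF class_C_I_growth_cond[OF f np True]]) simp
    then show ?thesis by (intro exI[of _ "\<lambda>k. 0"]) (auto simp: decseq_def)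
  next
    case False
    then have II: "class_C_II n f" using assms by (auto simp: class_C_def)
    obtain \<epsilon> where "\<And>k. 0 \<le> \<epsilon> k" "decseq \<epsilon>" "\<epsilon> \<longlonglongrightarrow> 0" "growth_cond n f (\<lambda>k. real k powr (2 + \<epsilon> k))"
      using class_C_II_growth_cond[OF f np II] by blast
    then show ?thesis using II by (intro exI[of _ \<epsilon>]) (auto simp: class_C_II_def)
  qed
qed

text \<open>The blocks will be centred at those of \<open>P 0\<close>, not at the origin. For large
  radii the centre hardly matters: the ball of radius \<open>a\<close> around \<open>w0\<close>
  contains the unit ball, and that of radius \<open>b\<close> lies in the ball of radius
  \<open>b + N\<close> around 0. This bounds one slope of the logarithm of the maximum around
  \<open>w0\<close>, and convexity brings it back to \<open>r\<close> and \<open>R\<close>. The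
  bound \<open>B\<close> is left free because the induction over blocks applies the lemma
  pointwise.\<close>

lemma graph_growth_bound_center:
  assumes f: "slice_entire n f" and np: "\<not> polynomial_function n f" and gc: "growth_cond n f \<mu>"
    and w0: "w0 \<in> carrier_vec n" and r: "0 < r" "r < R"
  shows "\<exists>C\<ge>0. \<forall>k\<ge>1. \<forall>q. slice_poly n k q \<longrightarrow> (\<forall>B.
    (\<forall>u\<in>carrier_vec n. euclid_norm u < r \<longrightarrow> cmod (q (line n w0 u 1) (f (line n w0 u 1))) \<le> B) \<longrightarrow>
    (\<forall>u\<in>carrier_vec n. euclid_norm u < R \<longrightarrow>
       cmod (q (line n w0 u 1) (f (line n w0 u 1))) \<le> exp (C * \<mu> k) * B))"
proof -
  obtain z0 where z0: "z0 \<in> carrier_vec n" "f z0 \<noteq> 0" using not_polynomial_nonzero[OF np] .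
  define N where "N = euclid_norm w0"
  have N: "0 \<le> N" by (simp add: N_def)
  \<comment> \<open>\<open>a\<close> is at least \<open>R\<close>, for convexity, and at least
    \<open>1 + N\<close>, for the inclusion of the unit ball; \<open>b\<close> makes the logarithmic
    length equal to 1.\<close>
  define a where "a = R + N + 1"
  define b where "b = exp 1 * a"
  have a: "R \<le> a" "1 + N \<le> a" "0 < a" using N r by (auto simp: a_def)
  have b: "a < b" using a by (simp add: b_def)
  have lnb: "ln b - ln a = 1" using a by (simp add: b_def ln_mult_pos)
  have "(0::real) < 1" "1 < b + N" using a b N by auto
  from graph_growth_bound[OF f z0 gc this] obtain C where C: "C \<ge> 0" "\<And>k q. k \<ge> 1 \<Longrightarrow> slice_poly n k q \<Longrightarrow>
    max_modulus n (\<lambda>w. q w (f w)) (b + N) \<le> exp (C * \<mu> k) * max_modulus n (\<lambda>w. q w (f w)) 1" by blast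
  define C' where "C' = (ln R - ln r) * C"
  have lnr: "ln r < ln R" using r by simp
  have main: "cmod (q (line n w0 u 1) (f (line n w0 u 1))) \<le> exp (C' * \<mu> k) * B"
    if k: "k \<ge> 1" and q: "slice_poly n k q"
      and B: "\<forall>u\<in>carrier_vec n. euclid_norm u < r \<longrightarrow> cmod (q (line n w0 u 1) (f (line n w0 u 1))) \<le> B"
      and u: "u \<in> carrier_vec n" "euclid_norm u < R" for k q B u
  proof -
    define g where "g = (\<lambda>w. q w (f w))"
    define h where "h = (\<lambda>u. g (line n u w0 1))"
    have swap: "line n u w0 1 = line n w0 u 1" for u by (rule carrier_vec_eqI[of _ n]) auto
    have g: "slice_entire n g" unfolding g_def by (rule slice_entire_poly_graph[OF f q])
    have h: "slice_entire n h" unfolding h_def by (rule slice_entire_shift[OF g w0])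
    have hB: "max_modulus n h r \<le> B"
      using B r by (intro max_modulus_le[OF h]) (auto simp: h_def g_def swap)
    have hu: "cmod (q (line n w0 u 1) (f (line n w0 u 1))) \<le> max_modulus n h R"
      using le_max_modulus[OF h u] by (simp add: h_def g_def swap)
    have "max_modulus n h R \<le> exp (C' * \<mu> k) * max_modulus n h r"
    proof (cases "\<exists>w\<in>carrier_vec n. h w \<noteq> 0")
      case False
      then have "max_modulus n h R \<le> 0" using r by (intro max_modulus_le[OF h]) auto
      moreover have "0 \<le> max_modulus n h r"
        using le_max_modulus[OF h, of "0\<^sub>v n" r] r by (auto intro: order_trans[OF norm_ge_zero])
      ultimately show ?thesis by (auto intro: order_trans)
    next
      case True
      then obtain w where w: "w \<in> carrier_vec n" "h w \<noteq> 0" by blast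
      let ?l = "\<lambda>t. ln (max_modulus n h (exp t))"
      have pos: "0 < max_modulus n h t" if "t > 0" for t using max_modulus_pos[OF h w that] .
      have "max_modulus n h b \<le> max_modulus n g (b + N)"
      proof (rule max_modulus_le[OF h])
        fix v :: cvec assume v: "v \<in> carrier_vec n" "euclid_norm v < b"
        show "cmod (h v) \<le> max_modulus n g (b + N)" unfolding h_def
          using euclid_norm_line_le[OF v(1) w0, of 1] v(2) by (intro le_max_modulus[OF g]) (auto simp: N_def)
      qed (use a b in simp)
      also have "\<dots> \<le> exp (C * \<mu> k) * max_modulus n g 1" using C(2)[OF k q] by (simp add: g_def)
      also have "max_modulus n g 1 \<le> max_modulus n h a"
      proof (rule max_modulus_le[OF g])
        fix v :: cvec assume v: "v \<in> carrier_vec n" "euclid_norm v < 1"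
        have "line n (line n v w0 (- 1)) w0 1 = v" by (rule carrier_vec_eqI[of _ n]) (use v in auto)
        then have "g v = h (line n v w0 (- 1))" by (simp add: h_def)
        also have "cmod \<dots> \<le> max_modulus n h a"
          using euclid_norm_line_le[OF v(1) w0, of "- 1"] v(2) a by (intro le_max_modulus[OF h]) (auto simp: N_def)
        finally show "cmod (g v) \<le> max_modulus n h a" .
      qed simp
      finally have hba: "max_modulus n h b \<le> exp (C * \<mu> k) * max_modulus n h a" by simp
      then have "ln (max_modulus n h b) \<le> ln (exp (C * \<mu> k) * max_modulus n h a)"
        using pos[of b] pos[of a] a b by (subst ln_le_cancel_iff) auto
      also have "\<dots> = C * \<mu> k + ln (max_modulus n h a)"
        using pos[of a] a ln_mult_pos[of "exp (C * \<mu> k)" "max_modulus n h a"] by simp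
      finally have lba: "ln (max_modulus n h b) - ln (max_modulus n h a) \<le> C * \<mu> k" by simp
      have "(?l (ln R) - ?l (ln r)) / (ln R - ln r) \<le> (?l (ln b) - ?l (ln a)) / (ln b - ln a)"
        by (rule convex_slope_le[OF convex_ln_max_modulus[OF h w]]) (use r a b in auto)
      also have "\<dots> \<le> C * \<mu> k" unfolding lnb using lba a b by simp
      finally have "?l (ln R) - ?l (ln r) \<le> C' * \<mu> k"
        using lnr by (simp add: C'_def divide_le_eq mult_ac)
      then have "ln (max_modulus n h R) \<le> C' * \<mu> k + ln (max_modulus n h r)" using r by simp
      also have "\<dots> = ln (exp (C' * \<mu> k) * max_modulus n h r)"
        using pos[of r] r ln_mult_pos[of "exp (C' * \<mu> k)" "max_modulus n h r"] by simp
      finally show ?thesis using r pos[of r] pos[of R] by (subst (asm) ln_le_cancel_iff) auto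
    qed
    also have "\<dots> \<le> exp (C' * \<mu> k) * B" using hB by simp
    finally show ?thesis using hu by simp
  qed
  moreover have "0 \<le> C'" using C(1) lnr by (simp add: C'_def)
  ultimately show ?thesis by blast
qed

section \<open>Vectors cut into blocks\<close>

definition set_block :: "(nat \<Rightarrow> nat) \<Rightarrow> nat \<Rightarrow> nat \<Rightarrow> cvec \<Rightarrow> cvec \<Rightarrow> cvec" where
  "set_block n N j u w = Matrix.vec N (\<lambda>i. if (\<Sum>l<j. n l) \<le> i \<and> i < (\<Sum>l<j. n l) + n j
     then u !\<^sub>v (i - (\<Sum>l<j. n l)) else w !\<^sub>v i)"

definition set_entry :: "nat \<Rightarrow> nat \<Rightarrow> complex \<Rightarrow> cvec \<Rightarrow> cvec" where
  "set_entry m j c v = Matrix.vec m (\<lambda>i. if i = j then c else v !\<^sub>v i)"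

lemma sum_lessThan_block_le:
  fixes n :: "nat \<Rightarrow> nat"
  assumes "i < j"
  shows "(\<Sum>l<i. n l) + n i \<le> (\<Sum>l<j. n l)"
proof -
  have "(\<Sum>l<i. n l) + n i = (\<Sum>l<Suc i. n l)" by simp
  also have "\<dots> \<le> (\<Sum>l<j. n l)" using assms by (intro sum_mono2) auto
  finally show ?thesis .
qed

lemma block_carrier [simp]: "block n j w \<in> carrier_vec (n j)"
  by (simp add: block_def)

lemma set_block_carrier [simp]: "set_block n N j u w \<in> carrier_vec N"
  by (simp add: set_block_def)

lemma set_entry_carrier [simp]: "set_entry m j c v \<in> carrier_vec m"
  by (simp add: set_entry_def)

context
  fixes n :: "nat \<Rightarrow> nat" and m N :: nat
  assumes N_def: "N = (\<Sum>l<m. n l)"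
begin

lemma block_set_block:
  assumes "j < m" "i < m" "u \<in> carrier_vec (n j)"
  shows "block n i (set_block n N j u w) = (if i = j then u else block n i w)"
proof -
  have iN: "(\<Sum>l<i. n l) + x < N" if "x < n i" for x
    using sum_lessThan_block_le[OF assms(2), of n] that unfolding N_def by linarith
  show ?thesis
  proof (cases "i = j")
    case True
    then show ?thesis using assms iN by (auto intro!: eq_vecI simp: block_def set_block_def)
  next
    case False
    have "\<not> ((\<Sum>l<j. n l) \<le> (\<Sum>l<i. n l) + x \<and> (\<Sum>l<i. n l) + x < (\<Sum>l<j. n l) + n j)" if "x < n i" for x
      using False sum_lessThan_block_le[of i j n] sum_lessThan_block_le[of j i n] that by (cases "i < j") auto
    then show ?thesis using False assms iN by (auto intro!: eq_vecI simp: block_def set_block_def)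
  qed
qed

lemma set_block_self:
  assumes "j < m" "w \<in> carrier_vec N"
  shows "set_block n N j (block n j w) w = w"
  by (rule carrier_vec_eqI[of _ N]) (use assms in \<open>auto simp: set_block_def block_def\<close>)

text \<open>The reason why one block can be treated at a time: with the other blocks frozen, the
  product map depends on \<open>u\<close> only through the number \<open>f j u\<close>.\<close>

lemma product_map_set_block:
  assumes "j < m" "u \<in> carrier_vec (n j)"
  shows "product_map m n f (set_block n N j u w) = set_entry m j (f j u) (product_map m n f w)"
  by (rule carrier_vec_eqI[of _ m])
    (use assms in \<open>auto simp: product_map_def set_entry_def block_set_block\<close>)

end

lemma product_map_carrier [simp]: "product_map m n f w \<in> carrier_vec m"
  by (simp add: product_map_def)

lemma polynomial_map_degree:
  assumes "polynomial_map n k G"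
  obtains D p where "1 \<le> D" "\<And>i. i < k \<Longrightarrow> p i \<in> polys n" "\<And>i. i < k \<Longrightarrow> total_degree (p i) \<le> D"
    "\<And>i z. i < k \<Longrightarrow> z \<in> carrier_vec n \<Longrightarrow> G z !\<^sub>v i = poly_value (p i) z"
proof -
  have "\<forall>i. i < k \<longrightarrow> (\<exists>p\<in>polys n. \<forall>z\<in>carrier_vec n. G z !\<^sub>v i = poly_value p z)"
    using assms unfolding polynomial_map_def polynomial_function_def by blast
  then obtain p where p: "\<And>i. i < k \<Longrightarrow> p i \<in> polys n"
    "\<And>i z. i < k \<Longrightarrow> z \<in> carrier_vec n \<Longrightarrow> G z !\<^sub>v i = poly_value (p i) z" by metis
  define D where "D = Suc (\<Sum>i<k. total_degree (p i))"
  have "total_degree (p i) \<le> D" if "i < k" for i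
    using member_le_sum[of i "{..<k}" "\<lambda>i. total_degree (p i)"] that by (simp add: D_def)
  then show thesis using that[of D p] p by (simp add: D_def)
qed

lemma polynomial_map_bounded:
  assumes "polynomial_map n k G"
  shows "\<exists>B. \<forall>z\<in>carrier_vec n. (\<forall>i<n. cmod (z !\<^sub>v i) \<le> r) \<longrightarrow> (\<forall>i<k. cmod (G z !\<^sub>v i) \<le> B)"
proof -
  obtain D p where p: "\<And>i. i < k \<Longrightarrow> p i \<in> polys n"
    "\<And>i z. i < k \<Longrightarrow> z \<in> carrier_vec n \<Longrightarrow> G z !\<^sub>v i = poly_value (p i) z"
    using polynomial_map_degree[OF assms] by metis
  have "\<forall>i. \<exists>B. i < k \<longrightarrow> (\<forall>z. (\<forall>i<n. cmod (z !\<^sub>v i) \<le> r) \<longrightarrow> cmod (poly_value (p i) z) \<le> B)"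
    using poly_value_bounded p(1) by blast
  then obtain B where B: "\<And>i z. i < k \<Longrightarrow> (\<forall>i<n. cmod (z !\<^sub>v i) \<le> r) \<Longrightarrow> cmod (poly_value (p i) z) \<le> B i" by metis
  have "cmod (G z !\<^sub>v i) \<le> (\<Sum>i<k. \<bar>B i\<bar>)" if "z \<in> carrier_vec n" "\<forall>i<n. cmod (z !\<^sub>v i) \<le> r" "i < k" for z i
  proof -
    have "cmod (G z !\<^sub>v i) \<le> \<bar>B i\<bar>" using B[OF that(3,2)] p(2)[OF that(3,1)] by simp
    also have "\<dots> \<le> (\<Sum>i<k. \<bar>B i\<bar>)" using that by (intro member_le_sum) auto
    finally show ?thesis .
  qed
  then show ?thesis by blast
qed

text \<open>By the Schwarz lemma on lines through \<open>w0\<close>, a polynomial map is Lipschitz at \<open>w0\<close>.\<close>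

lemma polynomial_map_lipschitz:
  assumes G: "polynomial_map n k G" and w0: "w0 \<in> carrier_vec n"
  obtains K where "0 \<le> K" "\<And>u x i. u \<in> carrier_vec n \<Longrightarrow> euclid_norm u \<le> 1 \<Longrightarrow> cmod x < 1 \<Longrightarrow> i < k \<Longrightarrow>
      cmod (G (line n w0 u x) !\<^sub>v i - G w0 !\<^sub>v i) \<le> K * cmod x"
proof -
  obtain D p where p: "\<And>i. i < k \<Longrightarrow> p i \<in> polys n" "\<And>i. i < k \<Longrightarrow> total_degree (p i) \<le> D"
    "\<And>i z. i < k \<Longrightarrow> z \<in> carrier_vec n \<Longrightarrow> G z !\<^sub>v i = poly_value (p i) z"
    using polynomial_map_degree[OF G] by metis
  obtain B where B: "\<And>z i. z \<in> carrier_vec n \<Longrightarrow> (\<forall>i<n. cmod (z !\<^sub>v i) \<le> euclid_norm w0 + 1) \<Longrightarrow> i < k \<Longrightarrow>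
     cmod (G z !\<^sub>v i) \<le> B" using polynomial_map_bounded[OF G, of "euclid_norm w0 + 1"] by blast
  have lip: "cmod (G (line n w0 u x) !\<^sub>v i - G w0 !\<^sub>v i) \<le> 4 * \<bar>B\<bar> * cmod x"
    if u: "u \<in> carrier_vec n" "euclid_norm u \<le> 1" and x: "cmod x < 1" and i: "i < k" for u x i
  proof -
    have "bideg (total_degree (p i) * 1) (\<lambda>x v. poly_value (p i) (line n w0 u x))"
      by (rule bideg_poly_value[OF p(1)[OF i] order_refl]) (use bideg_fst_var in auto)
    from bideg_fst[OF this] obtain a where a: "\<And>x. poly_value (p i) (line n w0 u x) = poly a x" by blast
    have Ga: "G (line n w0 u x) !\<^sub>v i = poly a x" for x using p(3)[OF i, of "line n w0 u x"] a by simp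
    have aB: "cmod (poly a x) \<le> B" if "cmod x < 1" for x
      unfolding Ga[symmetric]
    proof (rule B[OF line_carrier _ i], intro allI impI)
      fix l assume "l < n"
      have "cmod (line n w0 u x !\<^sub>v l) \<le> euclid_norm (line n w0 u x)" using \<open>l < n\<close> by (intro cmod_index_le) auto
      also have "\<dots> \<le> euclid_norm w0 + cmod x * euclid_norm u" by (rule euclid_norm_line_le[OF w0 u(1)])
      also have "\<dots> \<le> euclid_norm w0 + 1 * 1" using that u by (intro add_mono mult_mono) auto
      finally show "cmod (line n w0 u x !\<^sub>v l) \<le> euclid_norm w0 + 1" by simp
    qed
    define a' where "a' = synthetic_div a 0"
    have a': "poly a x = x * poly a' x + poly a 0" for x
    proof -
      have "poly a x = poly ([:-0, 1:] * synthetic_div a 0 + [:poly a 0:]) x"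
        using synthetic_div_correct'[of 0 a] by simp
      then show ?thesis by (simp add: a'_def)
    qed
    have "cmod (poly a' x) \<le> 2 * (2 * \<bar>B\<bar>) / (1 - 0)"
    proof (rule factor_bound[where g = "poly a'" and z = 0 and r = 0 and R = 1])
      show "poly a' holomorphic_on ball 0 1" by (intro holomorphic_intros)
      fix x :: complex assume "x \<in> ball 0 1"
      then have "cmod (poly a x) \<le> B" "cmod (poly a 0) \<le> B" using aB by auto
      then have "cmod (poly a x - poly a 0) \<le> 2 * \<bar>B\<bar>"
        using norm_triangle_ineq4[of "poly a x" "poly a 0"] by linarith
      then show "cmod ((x - 0) * poly a' x) \<le> 2 * \<bar>B\<bar>" using a'[of x] by simp
    qed (use x in auto)
    then have "cmod x * cmod (poly a' x) \<le> cmod x * (4 * \<bar>B\<bar>)" by (intro mult_left_mono) auto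
    moreover have "G (line n w0 u x) !\<^sub>v i - G w0 !\<^sub>v i = x * poly a' x"
      using Ga[of x] Ga[of 0] a'[of x] w0 by simp
    ultimately show ?thesis by (simp add: norm_mult mult_ac)
  qed
  show thesis by (rule that[of "4 * \<bar>B\<bar>"]) (use lip in auto)
qed

lemma slice_poly_block:
  fixes n :: "nat \<Rightarrow> nat"
  assumes p: "p \<in> polys (N + m)" "total_degree p \<le> k"
    and G: "polynomial_map N N G" and H: "polynomial_map m m H"
    and Gp: "\<And>i. i < N \<Longrightarrow> gp i \<in> polys N" "\<And>i. i < N \<Longrightarrow> total_degree (gp i) \<le> D"
      "\<And>i z. i < N \<Longrightarrow> z \<in> carrier_vec N \<Longrightarrow> G z !\<^sub>v i = poly_value (gp i) z"
    and Hp: "\<And>i. i < m \<Longrightarrow> hp i \<in> polys m" "\<And>i. i < m \<Longrightarrow> total_degree (hp i) \<le> D"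
      "\<And>i z. i < m \<Longrightarrow> z \<in> carrier_vec m \<Longrightarrow> H z !\<^sub>v i = poly_value (hp i) z"
  shows "slice_poly (n j) (k * D) (\<lambda>u v. poly_value p (G (set_block n N j u W) @\<^sub>v H (set_entry m j v V)))"
  unfolding slice_poly_def
proof (intro conjI ballI allI)
  have Gc: "G z \<in> carrier_vec N" if "z \<in> carrier_vec N" for z using G that by (simp add: polynomial_map_def)
  have Hc: "H z \<in> carrier_vec m" if "z \<in> carrier_vec m" for z using H that by (simp add: polynomial_map_def)
  fix a b :: cvec assume ab: "a \<in> carrier_vec (n j)" "b \<in> carrier_vec (n j)"
  show "bideg (k * D) (\<lambda>x v. poly_value p (G (set_block n N j (line (n j) a b x) W) @\<^sub>v H (set_entry m j v V)))"
  proof (rule bideg_poly_value[OF p])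
    fix i assume i: "i < N + m"
    show "bideg D (\<lambda>x v. (G (set_block n N j (line (n j) a b x) W) @\<^sub>v H (set_entry m j v V)) !\<^sub>v i)"
    proof (cases "i < N")
      case True
      have "bideg (D * 1) (\<lambda>x v. poly_value (gp i) (set_block n N j (line (n j) a b x) W))"
      proof (rule bideg_poly_value[OF Gp(1,2)[OF True]])
        fix l assume "l < N"
        let ?o = "\<Sum>l<j. n l"
        show "bideg 1 (\<lambda>x v. set_block n N j (line (n j) a b x) W !\<^sub>v l)"
        proof (cases "?o \<le> l \<and> l < ?o + n j")
          case True
          then have "l - ?o < n j" by auto
          then show ?thesis using True \<open>l < N\<close> bideg_fst_var by (simp add: set_block_def)
        next
          case False
          then have "set_block n N j (line (n j) a b x) W !\<^sub>v l = W !\<^sub>v l" for x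
            using \<open>l < N\<close> by (auto simp: set_block_def)
          then show ?thesis using bideg_const by simp
        qed
      qed
      moreover have "(G (set_block n N j u W) @\<^sub>v H (set_entry m j v V)) !\<^sub>v i = poly_value (gp i) (set_block n N j u W)" for u v
        using Gc[OF set_block_carrier, of n j u W] Hc[OF set_entry_carrier, of j v V] True i Gp(3)[OF True]
        by (subst index_append_vec(1)) auto
      ultimately show ?thesis by simp
    next
      case False
      then have im: "i - N < m" using i by simp
      have "bideg (D * 1) (\<lambda>x v. poly_value (hp (i - N)) (set_entry m j v V))"
      proof (rule bideg_poly_value[OF Hp(1,2)[OF im]])
        fix l assume "l < m"
        then show "bideg 1 (\<lambda>x v. set_entry m j v V !\<^sub>v l)"
          using bideg_const bideg_snd_var by (cases "l = j") (simp_all add: set_entry_def)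
      qed
      moreover have "(G (set_block n N j u W) @\<^sub>v H (set_entry m j v V)) !\<^sub>v i = poly_value (hp (i - N)) (set_entry m j v V)" for u v
        using Gc[OF set_block_carrier, of n j u W] Hc[OF set_entry_carrier, of j v V] False i Hp(3)[OF im]
        by (subst index_append_vec(1)) auto
      ultimately show ?thesis by simp
    qed
  qed
next
  fix r :: real
  have Gc: "G z \<in> carrier_vec N" if "z \<in> carrier_vec N" for z using G that by (simp add: polynomial_map_def)
  have Hc: "H z \<in> carrier_vec m" if "z \<in> carrier_vec m" for z using H that by (simp add: polynomial_map_def)
  define c where "c = max r (max (\<Sum>i<N. cmod (W !\<^sub>v i)) (\<Sum>i<m. cmod (V !\<^sub>v i)))"
  obtain B1 where B1: "\<And>z i. z \<in> carrier_vec N \<Longrightarrow> (\<forall>i<N. cmod (z !\<^sub>v i) \<le> c) \<Longrightarrow> i < N \<Longrightarrow> cmod (G z !\<^sub>v i) \<le> B1"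
    using polynomial_map_bounded[OF G, of c] by blast
  obtain B2 where B2: "\<And>z i. z \<in> carrier_vec m \<Longrightarrow> (\<forall>i<m. cmod (z !\<^sub>v i) \<le> c) \<Longrightarrow> i < m \<Longrightarrow> cmod (H z !\<^sub>v i) \<le> B2"
    using polynomial_map_bounded[OF H, of c] by blast
  obtain B where B: "\<And>z. (\<forall>i<N + m. cmod (z !\<^sub>v i) \<le> max B1 B2) \<Longrightarrow> cmod (poly_value p z) \<le> B"
    using poly_value_bounded[OF p(1)] by blast
  show "\<exists>B. \<forall>w\<in>carrier_vec (n j). \<forall>v. euclid_norm w \<le> r \<longrightarrow> cmod v \<le> r \<longrightarrow>
      cmod (poly_value p (G (set_block n N j w W) @\<^sub>v H (set_entry m j v V))) \<le> B"
  proof (intro exI ballI allI impI, rule B, intro allI impI)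
    fix w :: cvec and v i assume w: "w \<in> carrier_vec (n j)" "euclid_norm w \<le> r" and v: "cmod v \<le> r" and i: "i < N + m"
    have wi: "cmod (w !\<^sub>v l) \<le> c" if "l < n j" for l
      using order_trans[OF cmod_index_le[OF w(1) that] w(2)] by (simp add: c_def)
    have Wi: "cmod (W !\<^sub>v l) \<le> c" if "l < N" for l
      using member_le_sum[of l "{..<N}" "\<lambda>i. cmod (W !\<^sub>v i)"] that by (simp add: c_def le_max_iff_disj)
    have Vi: "cmod (V !\<^sub>v l) \<le> c" if "l < m" for l
      using member_le_sum[of l "{..<m}" "\<lambda>i. cmod (V !\<^sub>v i)"] that by (simp add: c_def le_max_iff_disj)
    have 1: "cmod (G (set_block n N j w W) !\<^sub>v l) \<le> B1" if "l < N" for l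
      using wi Wi by (intro B1 that) (auto simp: set_block_def)
    have 2: "cmod (H (set_entry m j v V) !\<^sub>v l) \<le> B2" if "l < m" for l
      using v Vi by (intro B2 that) (auto simp: set_entry_def c_def)
    show "cmod ((G (set_block n N j w W) @\<^sub>v H (set_entry m j v V)) !\<^sub>v i) \<le> max B1 B2"
      using Gc[OF set_block_carrier, of n j w W] Hc[OF set_entry_carrier, of j v V] i 1[of i] 2[of "i - N"]
      by (subst index_append_vec(1)) (auto simp: le_max_iff_disj)
  qed
qed

lemma index_in_block:
  fixes n :: "nat \<Rightarrow> nat"
  assumes "i < (\<Sum>l<m. n l)"
  shows "\<exists>j<m. \<exists>x<n j. i = (\<Sum>l<j. n l) + x"
  using assms
proof (induction m)
  case (Suc m)
  show ?case
  proof (cases "i < (\<Sum>l<m. n l)")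
    case True
    then show ?thesis using Suc.IH less_SucI by blast
  next
    case False
    then show ?thesis using Suc.prems by (intro exI[of _ m] conjI exI[of _ "i - (\<Sum>l<m. n l)"]) auto
  qed
qed simp

lemma poly_value_degree_zero:
  assumes "total_degree p = 0"
  shows "poly_value p z = Poly_Mapping.lookup p 0"
proof -
  have "\<alpha> = 0" if "\<alpha> \<in> Poly_Mapping.keys p" for \<alpha>
  proof -
    have "keysum \<alpha> = 0" using assms total_degree_le_iff[of p 0] that by auto
    then have "Poly_Mapping.lookup \<alpha> a = 0" for a
      by (cases "a \<in> Poly_Mapping.keys \<alpha>") (auto simp: in_keys_iff)
    then show ?thesis by (intro poly_mapping_eqI) simp
  qed
  then have "poly_value p z = (\<Sum>\<alpha>\<in>{0}. Poly_Mapping.lookup p \<alpha> * monomial_value \<alpha> z)"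
    by (intro poly_value_superset) auto
  then show ?thesis by (simp add: monomial_value_def)
qed

lemma graph_max_upper:
  assumes "bdd_above ((\<lambda>z. cmod (poly_value p (z @\<^sub>v F z))) ` {z \<in> carrier_vec n. euclid_norm z \<le> r})"
    and "z \<in> carrier_vec n" "euclid_norm z \<le> r"
  shows "cmod (poly_value p (z @\<^sub>v F z)) \<le> graph_max n F p r"
  unfolding graph_max_def using assms by (intro cSUP_upper) auto

lemma graph_max_least:
  assumes "0 \<le> r" "\<And>z. z \<in> carrier_vec n \<Longrightarrow> euclid_norm z \<le> r \<Longrightarrow> cmod (poly_value p (z @\<^sub>v F z)) \<le> B"
  shows "graph_max n F p r \<le> B"
  unfolding graph_max_def
proof (rule cSUP_least)
  have "0\<^sub>v n \<in> {z \<in> carrier_vec n. euclid_norm z \<le> r}" using assms by simp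
  then show "{z \<in> carrier_vec n. euclid_norm z \<le> r} \<noteq> {}" by blast
qed (use assms in auto)

section \<open>The upper bound for products composed with automorphisms\<close>

locale product_graph =
  fixes m :: nat and n :: "nat \<Rightarrow> nat" and f :: "nat \<Rightarrow> cvec \<Rightarrow> complex" and P Q :: "cvec \<Rightarrow> cvec" and N :: nat
  assumes N_def: "N = (\<Sum>j<m. n j)"
    and class_C: "\<And>j. j < m \<Longrightarrow> class_C (n j) (f j)"
    and P: "polynomial_automorphism N P" and Q: "polynomial_automorphism m Q"
begin

definition P_inv :: "cvec \<Rightarrow> cvec" where "P_inv = inv_into (carrier_vec N) P"

definition F :: "cvec \<Rightarrow> cvec" where "F = Q \<circ> product_map m n f \<circ> P"

lemma f_entire: "j < m \<Longrightarrow> slice_entire (n j) (f j)" and f_not_poly: "j < m \<Longrightarrow> \<not> polynomial_function (n j) (f j)"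
  using class_C by (auto simp: class_C_def entire_imp_slice_entire)

lemma P_map: "polynomial_map N N P" and P_inv_map: "polynomial_map N N P_inv" and Q_map: "polynomial_map m m Q"
  using P Q by (auto simp: polynomial_automorphism_def P_inv_def)

lemma P_carrier [simp]: "z \<in> carrier_vec N \<Longrightarrow> P z \<in> carrier_vec N"
  and P_inv_carrier [simp]: "w \<in> carrier_vec N \<Longrightarrow> P_inv w \<in> carrier_vec N"
  and Q_carrier [simp]: "v \<in> carrier_vec m \<Longrightarrow> Q v \<in> carrier_vec m"
  using P_map P_inv_map Q_map by (auto simp: polynomial_map_def)

lemma P_P_inv: "w \<in> carrier_vec N \<Longrightarrow> P (P_inv w) = w"
  and P_inv_P: "z \<in> carrier_vec N \<Longrightarrow> P_inv (P z) = z"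
  using P unfolding polynomial_automorphism_def P_inv_def
  by (auto simp: bij_betw_inv_into_right bij_betw_inv_into_left)

definition pulled :: "cpoly \<Rightarrow> cvec \<Rightarrow> complex" where
  "pulled p w = poly_value p (P_inv w @\<^sub>v Q (product_map m n f w))"

lemma pulled_P: "z \<in> carrier_vec N \<Longrightarrow> pulled p (P z) = poly_value p (z @\<^sub>v F z)"
  by (simp add: pulled_def F_def P_inv_P)

lemma block_norm_le:
  fixes c :: real
  assumes j: "j < m" and c: "\<And>i. i < N \<Longrightarrow> cmod (w !\<^sub>v i) \<le> c" and c0: "0 \<le> c"
  shows "euclid_norm (block n j w) \<le> N * c"
proof -
  have jN: "(\<Sum>l<j. n l) + n j \<le> N" unfolding N_def by (rule sum_lessThan_block_le[OF j])
  have "euclid_norm (block n j w) \<le> (\<Sum>i<n j. cmod (block n j w !\<^sub>v i))" by (rule euclid_norm_le_sum) simp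
  also have "\<dots> \<le> (\<Sum>i<n j. c)" using jN by (intro sum_mono) (auto simp: block_def intro!: c)
  also have "\<dots> = n j * c" by simp
  also have "\<dots> \<le> N * c" using jN c0 by (intro mult_right_mono) auto
  finally show ?thesis .
qed

lemma pulled_bounded:
  assumes p: "p \<in> polys (N + m)"
  shows "\<exists>B. \<forall>w\<in>carrier_vec N. (\<forall>i<N. cmod (w !\<^sub>v i) \<le> c) \<longrightarrow> cmod (pulled p w) \<le> B"
proof -
  obtain B1 where B1: "\<And>z i. z \<in> carrier_vec N \<Longrightarrow> (\<forall>i<N. cmod (z !\<^sub>v i) \<le> c) \<Longrightarrow> i < N \<Longrightarrow> cmod (P_inv z !\<^sub>v i) \<le> B1"
    using polynomial_map_bounded[OF P_inv_map, of c] by blast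
  have "\<forall>j. \<exists>B. j < m \<longrightarrow> (\<forall>z\<in>carrier_vec (n j). euclid_norm z \<le> N * \<bar>c\<bar> \<longrightarrow> cmod (f j z) \<le> B)"
    using f_entire unfolding slice_entire_def by blast
  then obtain Bf where Bf: "\<And>j z. j < m \<Longrightarrow> z \<in> carrier_vec (n j) \<Longrightarrow> euclid_norm z \<le> N * \<bar>c\<bar> \<Longrightarrow> cmod (f j z) \<le> Bf j"
    by metis
  define c' where "c' = (\<Sum>j<m. \<bar>Bf j\<bar>)"
  obtain B2 where B2: "\<And>z i. z \<in> carrier_vec m \<Longrightarrow> (\<forall>i<m. cmod (z !\<^sub>v i) \<le> c') \<Longrightarrow> i < m \<Longrightarrow> cmod (Q z !\<^sub>v i) \<le> B2"
    using polynomial_map_bounded[OF Q_map, of c'] by blast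
  obtain B where B: "\<And>z. (\<forall>i<N + m. cmod (z !\<^sub>v i) \<le> max B1 B2) \<Longrightarrow> cmod (poly_value p z) \<le> B"
    using poly_value_bounded[OF p] by blast
  show ?thesis
    unfolding pulled_def
  proof (intro exI ballI impI, rule B, intro allI impI)
    fix w :: cvec and i assume w: "w \<in> carrier_vec N" "\<forall>i<N. cmod (w !\<^sub>v i) \<le> c" and i: "i < N + m"
    have "cmod (product_map m n f w !\<^sub>v j) \<le> c'" if j: "j < m" for j
    proof -
      have "euclid_norm (block n j w) \<le> N * \<bar>c\<bar>"
      proof (rule block_norm_le[OF j])
        show "cmod (w !\<^sub>v i) \<le> \<bar>c\<bar>" if "i < N" for i using w(2) that by (meson abs_ge_self order_trans)
      qed simp
      then have "cmod (f j (block n j w)) \<le> \<bar>Bf j\<bar>" using Bf[OF j, of "block n j w"] by simp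
      also have "\<dots> \<le> c'" unfolding c'_def using j by (intro member_le_sum) auto
      finally show ?thesis using j by (simp add: product_map_def)
    qed
    then have "cmod (Q (product_map m n f w) !\<^sub>v j) \<le> B2" if "j < m" for j using that by (intro B2) auto
    moreover have dims: "dim_vec (P_inv w) = N" "dim_vec (Q (product_map m n f w)) = m"
      using carrier_vecD[OF P_inv_carrier[OF w(1)]] carrier_vecD[OF Q_carrier[OF product_map_carrier]] by auto
    ultimately show "cmod ((P_inv w @\<^sub>v Q (product_map m n f w)) !\<^sub>v i) \<le> max B1 B2"
      using B1[OF w, of i] i
      by (subst index_append_vec(1)) (simp_all add: dims le_max_iff_disj)
  qed
qed

lemma graph_bdd:
  assumes p: "p \<in> polys (N + m)"
  shows "bdd_above ((\<lambda>z. cmod (poly_value p (z @\<^sub>v F z))) ` {z \<in> carrier_vec N. euclid_norm z \<le> r})"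
proof -
  obtain c where c: "\<And>z i. z \<in> carrier_vec N \<Longrightarrow> (\<forall>i<N. cmod (z !\<^sub>v i) \<le> r) \<Longrightarrow> i < N \<Longrightarrow> cmod (P z !\<^sub>v i) \<le> c"
    using polynomial_map_bounded[OF P_map, of r] by blast
  obtain B where B: "\<And>w. w \<in> carrier_vec N \<Longrightarrow> (\<forall>i<N. cmod (w !\<^sub>v i) \<le> c) \<Longrightarrow> cmod (pulled p w) \<le> B"
    using pulled_bounded[OF p, of c] by blast
  have "cmod (poly_value p (z @\<^sub>v F z)) \<le> B" if z: "z \<in> carrier_vec N" "euclid_norm z \<le> r" for z
    unfolding pulled_P[OF z(1), symmetric]
    using z order_trans[OF cmod_index_le[OF z(1)] z(2)] by (intro B) (auto intro: c)
  then show ?thesis by (intro bdd_aboveI[of _ B]) auto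
qed

text \<open>Neighbourhoods are products of balls, one for each block, so that one block can move
  while the others stay in place.\<close>

definition block_dist :: "nat \<Rightarrow> cvec \<Rightarrow> cvec \<Rightarrow> real" where
  "block_dist j w w0 = euclid_norm (line (n j) (block n j w) (block n j w0) (- 1))"

lemma block_dist_le:
  fixes c :: real
  assumes j: "j < m" and "\<And>i. i < N \<Longrightarrow> cmod (w !\<^sub>v i) \<le> c" "\<And>i. i < N \<Longrightarrow> cmod (w0 !\<^sub>v i) \<le> c" "0 \<le> c"
  shows "block_dist j w w0 \<le> 2 * N * c"
proof -
  have "block_dist j w w0 \<le> euclid_norm (block n j w) + cmod (- 1) * euclid_norm (block n j w0)"
    unfolding block_dist_def by (rule euclid_norm_line_le) auto
  also have "\<dots> \<le> N * c + 1 * (N * c)" using assms by (intro add_mono mult_mono block_norm_le) auto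
  finally show ?thesis by (simp add: mult_ac)
qed

text \<open>Continuity of the inverse of \<open>P\<close> at \<open>P 0\<close>, measured block by
  block, from the Lipschitz estimate at that point.\<close>

lemma P_inv_near:
  assumes "0 < r"
  obtains r' where "0 < r'" "\<And>w. w \<in> carrier_vec N \<Longrightarrow> (\<forall>j<m. block_dist j w (P (0\<^sub>v N)) < r') \<Longrightarrow> euclid_norm (P_inv w) \<le> r"
proof -
  let ?w0 = "P (0\<^sub>v N)"
  have w0: "?w0 \<in> carrier_vec N" "P_inv ?w0 = 0\<^sub>v N" by (auto simp: P_inv_P)
  obtain K where K: "0 \<le> K" "\<And>u x i. u \<in> carrier_vec N \<Longrightarrow> euclid_norm u \<le> 1 \<Longrightarrow> cmod x < 1 \<Longrightarrow> i < N \<Longrightarrow>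
      cmod (P_inv (line N ?w0 u x) !\<^sub>v i - P_inv ?w0 !\<^sub>v i) \<le> K * cmod x"
    using polynomial_map_lipschitz[OF P_inv_map w0(1)] by blast
  \<comment> \<open>Below 1 for the Lipschitz estimate and such that
    \<open>N * K * x0 \<le> r\<close>; the added 1 guards against \<open>N * K = 0\<close>.\<close>
  define x0 where "x0 = min (1/2) (r / (N * K + 1))"
  have NK: "0 < N * K + 1" using K by (simp add: add_nonneg_pos)
  have x0: "0 < x0" "x0 < 1" using assms NK by (auto simp: x0_def)
  have x0r: "N * K * x0 \<le> r"
  proof -
    have "(N * K + 1) * x0 \<le> (N * K + 1) * (r / (N * K + 1))" using NK by (intro mult_left_mono) (auto simp: x0_def)
    also have "\<dots> = r" using NK by simp
    finally show ?thesis using x0 by (simp add: distrib_right)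
  qed
  define r' where "r' = x0 / (N + 1)"
  have r': "0 < r'" using x0 by (simp add: r'_def)
  have "euclid_norm (P_inv w) \<le> r" if w: "w \<in> carrier_vec N" "\<forall>j<m. block_dist j w ?w0 < r'" for w
  proof -
    define d where "d = line N w ?w0 (- 1)"
    have "cmod (d !\<^sub>v i) \<le> r'" if i: "i < N" for i
    proof -
      obtain j x where jx: "j < m" "x < n j" "i = (\<Sum>l<j. n l) + x" using index_in_block[where i = i and m = m and n = n] i N_def by blast
      have "d !\<^sub>v i = line (n j) (block n j w) (block n j ?w0) (- 1) !\<^sub>v x" using jx i by (simp add: d_def block_def)
      also have "cmod \<dots> \<le> block_dist j w ?w0" unfolding block_dist_def using jx by (intro cmod_index_le) auto
      finally show ?thesis using w(2) jx(1) by fastforce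
    qed
    then have "(\<Sum>i<N. cmod (d !\<^sub>v i)) \<le> N * r'" using sum_bounded_above[of "{..<N}" "\<lambda>i. cmod (d !\<^sub>v i)" r'] by simp
    moreover have "N * r' \<le> x0" using x0 by (simp add: r'_def field_simps)
    moreover have "euclid_norm d \<le> (\<Sum>i<N. cmod (d !\<^sub>v i))" by (rule euclid_norm_le_sum) (simp add: d_def)
    ultimately have nd: "euclid_norm d \<le> x0" by linarith
    \<comment> \<open>\<open>u\<close> is \<open>d / x0\<close>, of norm at most 1, and
      \<open>w\<close> is the point with parameter \<open>x0\<close> on the line from
      \<open>P 0\<close> in direction \<open>u\<close>.\<close>
    define u where "u = line N (0\<^sub>v N) d (of_real (1 / x0))"
    have "euclid_norm u \<le> 1"
      unfolding u_def using nd x0 by (subst euclid_norm_line_origin) (auto simp: d_def norm_divide field_simps)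
    moreover have wu: "w = line N ?w0 u (of_real x0)"
      by (rule carrier_vec_eqI[of _ N]) (use w x0 in \<open>auto simp: u_def d_def\<close>)
    ultimately have "cmod (P_inv w !\<^sub>v i) \<le> K * x0" if "i < N" for i
      using K(2)[of u "of_real x0" i] that x0 by (simp add: w0 u_def flip: wu)
    then have "(\<Sum>i<N. cmod (P_inv w !\<^sub>v i)) \<le> N * (K * x0)"
      using sum_bounded_above[of "{..<N}" "\<lambda>i. cmod (P_inv w !\<^sub>v i)" "K * x0"] by simp
    moreover have "euclid_norm (P_inv w) \<le> (\<Sum>i<N. cmod (P_inv w !\<^sub>v i))"
      using w by (intro euclid_norm_le_sum) simp
    ultimately show ?thesis using x0r by (simp add: mult.assoc)
  qed
  then show thesis using that[OF r'] by blast
qed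

text \<open>Balls are exchanged for products of balls around \<open>P 0\<close>: those of radius
  \<open>r'\<close> lie over the ball of radius \<open>r\<close>, and those of radius
  \<open>R\<close> contain the image of the ball of radius \<open>exp 1 * r\<close>. Enlarging
  \<open>r'\<close> to \<open>R\<close> in one block after another costs a factor
  \<open>exp (E j)\<close> each time, so the exponents add up.\<close>

lemma admits_Bernstein_product:
  assumes e: "\<And>j k. j < m \<Longrightarrow> 0 \<le> e j k" "\<And>j. j < m \<Longrightarrow> decseq (e j)"
    and gc: "\<And>j. j < m \<Longrightarrow> growth_cond (n j) (f j) (\<lambda>k. real k powr (2 + e j k))"
  shows "admits_Bernstein N m F (\<lambda>k. real k powr (2 + (\<Sum>j<m. e j k)))"
  unfolding admits_Bernstein_def
proof (intro conjI allI impI)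
  define \<epsilon> where "\<epsilon> = (\<lambda>k. \<Sum>j<m. e j k)"
  fix r :: real assume r: "0 < r"
  let ?w0 = "P (0\<^sub>v N)"
  have w0: "?w0 \<in> carrier_vec N" by simp
  obtain r' where r': "0 < r'" "\<And>w. w \<in> carrier_vec N \<Longrightarrow> (\<forall>j<m. block_dist j w ?w0 < r') \<Longrightarrow> euclid_norm (P_inv w) \<le> r"
    using P_inv_near[OF r] by blast
  obtain B1 where B1: "\<And>z i. z \<in> carrier_vec N \<Longrightarrow> (\<forall>i<N. cmod (z !\<^sub>v i) \<le> exp 1 * r) \<Longrightarrow> i < N \<Longrightarrow> cmod (P z !\<^sub>v i) \<le> B1"
    using polynomial_map_bounded[OF P_map, of "exp 1 * r"] by blast
  define R where "R = 2 * N * \<bar>B1\<bar> + r' + 1"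
  have R: "r' < R" by (simp add: R_def add_nonneg_pos)
  have far: "block_dist j (P z) ?w0 < R" if "z \<in> carrier_vec N" "euclid_norm z \<le> exp 1 * r" "j < m" for z j
  proof -
    have P_le: "cmod (P z !\<^sub>v i) \<le> \<bar>B1\<bar>" if "z \<in> carrier_vec N" "euclid_norm z \<le> exp 1 * r" "i < N" for z i
    proof -
      have "cmod (P z !\<^sub>v i) \<le> B1"
        using order_trans[OF cmod_index_le[OF that(1)] that(2)] that by (intro B1) auto
      then show ?thesis by simp
    qed
    have "block_dist j (P z) ?w0 \<le> 2 * N * \<bar>B1\<bar>"
      by (rule block_dist_le[OF that(3)]) (use P_le that r in auto)
    then show ?thesis using r' by (simp add: R_def)
  qed
  have "\<forall>j. j < m \<longrightarrow> (\<exists>C\<ge>0. \<forall>k\<ge>1. \<forall>q. slice_poly (n j) k q \<longrightarrow> (\<forall>B.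
    (\<forall>u\<in>carrier_vec (n j). euclid_norm u < r' \<longrightarrow> cmod (q (line (n j) (block n j ?w0) u 1) (f j (line (n j) (block n j ?w0) u 1))) \<le> B) \<longrightarrow>
    (\<forall>u\<in>carrier_vec (n j). euclid_norm u < R \<longrightarrow>
       cmod (q (line (n j) (block n j ?w0) u 1) (f j (line (n j) (block n j ?w0) u 1))) \<le> exp (C * real k powr (2 + e j k)) * B)))"
  proof (intro allI impI)
    fix j assume j: "j < m"
    show "\<exists>C\<ge>0. \<forall>k\<ge>1. \<forall>q. slice_poly (n j) k q \<longrightarrow> (\<forall>B.
    (\<forall>u\<in>carrier_vec (n j). euclid_norm u < r' \<longrightarrow> cmod (q (line (n j) (block n j ?w0) u 1) (f j (line (n j) (block n j ?w0) u 1))) \<le> B) \<longrightarrow>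
    (\<forall>u\<in>carrier_vec (n j). euclid_norm u < R \<longrightarrow>
       cmod (q (line (n j) (block n j ?w0) u 1) (f j (line (n j) (block n j ?w0) u 1))) \<le> exp (C * real k powr (2 + e j k)) * B))"
      by (rule graph_growth_bound_center[OF f_entire[OF j] f_not_poly[OF j] gc[OF j] _ r'(1) R]) simp
  qed
  then obtain C where C: "\<And>j. j < m \<Longrightarrow> 0 \<le> C j"
    "\<And>j k q B u. j < m \<Longrightarrow> k \<ge> 1 \<Longrightarrow> slice_poly (n j) k q \<Longrightarrow>
    (\<forall>u\<in>carrier_vec (n j). euclid_norm u < r' \<longrightarrow> cmod (q (line (n j) (block n j ?w0) u 1) (f j (line (n j) (block n j ?w0) u 1))) \<le> B) \<Longrightarrow>
    u \<in> carrier_vec (n j) \<Longrightarrow> euclid_norm u < R \<Longrightarrow>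
       cmod (q (line (n j) (block n j ?w0) u 1) (f j (line (n j) (block n j ?w0) u 1))) \<le> exp (C j * real k powr (2 + e j k)) * B"
    by metis
  obtain D1 gp where D1: "1 \<le> D1" "\<And>i. i < N \<Longrightarrow> gp i \<in> polys N" "\<And>i. i < N \<Longrightarrow> total_degree (gp i) \<le> D1"
    "\<And>i z. i < N \<Longrightarrow> z \<in> carrier_vec N \<Longrightarrow> P_inv z !\<^sub>v i = poly_value (gp i) z"
    using polynomial_map_degree[OF P_inv_map] by metis
  obtain D2 hp where D2: "1 \<le> D2" "\<And>i. i < m \<Longrightarrow> hp i \<in> polys m" "\<And>i. i < m \<Longrightarrow> total_degree (hp i) \<le> D2"
    "\<And>i z. i < m \<Longrightarrow> z \<in> carrier_vec m \<Longrightarrow> Q z !\<^sub>v i = poly_value (hp i) z"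
    using polynomial_map_degree[OF Q_map] by metis
  define D where "D = max D1 D2"
  have D: "1 \<le> D" using D1(1) by (simp add: D_def)
  \<comment> \<open>The one-block bounds are applied in degree \<open>k * D\<close>. Since each
    \<open>e j\<close> decreases, \<open>(k * D) powr (2 + e j (k * D))\<close> is at most
    \<open>D powr (2 + \<epsilon> 0) * k powr (2 + \<epsilon> k)\<close>.\<close>
  define Ctot where "Ctot = (\<Sum>j<m. C j) * real D powr (2 + \<epsilon> 0)"
  have bound: "graph_max N F p (exp 1 * r) \<le> exp Ctot powr (real (total_degree p) powr (2 + \<epsilon> (total_degree p))) * graph_max N F p r"
    if p: "p \<in> polys (N + m)" for p
  \<comment> \<open>In degree 0 the exponent is 0 and the factor 1, whereas
    \<open>growth_cond\<close> speaks of \<open>k \<ge> 1\<close>; constants are treated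
    directly.\<close>
  proof (cases "total_degree p = 0")
    case True
    have c: "cmod (poly_value p (z @\<^sub>v F z)) = cmod (Poly_Mapping.lookup p 0)" for z
      by (simp add: poly_value_degree_zero[OF True])
    have "graph_max N F p (exp 1 * r) \<le> cmod (Poly_Mapping.lookup p 0)"
      using r by (intro graph_max_least) (auto simp: c)
    also have "\<dots> \<le> graph_max N F p r"
      using graph_max_upper[OF graph_bdd[OF p], of "0\<^sub>v N" r] r by (simp add: c)
    finally show ?thesis using True by simp
  next
    case False
    define k where "k = total_degree p"
    have k: "1 \<le> k" using False by (simp add: k_def)
    then have kD: "1 \<le> k * D" using D by simp
    define B where "B = graph_max N F p r"
    define E where "E = (\<lambda>j. C j * real (k * D) powr (2 + e j (k * D)))"
    have E0: "0 \<le> E j" if "j < m" for j using C(1)[OF that] by (simp add: E_def)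
    \<comment> \<open>The first \<open>j\<close> blocks may already be at distance up to
      \<open>R\<close> from those of \<open>P 0\<close>, the others are still within
      \<open>r'\<close>.\<close>
    have step: "cmod (pulled p w) \<le> exp (\<Sum>i<j. E i) * B"
      if "j \<le> m" "w \<in> carrier_vec N" "\<forall>i<m. block_dist i w ?w0 < (if i < j then R else r')" for j w
      using that
    proof (induction j arbitrary: w)
      case 0
      have "pulled p w = poly_value p (P_inv w @\<^sub>v F (P_inv w))"
        using pulled_P[of "P_inv w" p] 0 by (simp add: P_P_inv)
      also have "cmod \<dots> \<le> B"
        unfolding B_def using 0 r'(2)[of w] by (intro graph_max_upper[OF graph_bdd[OF p]]) auto
      finally show ?case by simp
    next
      case (Suc j)
      have j: "j < m" using Suc.prems by simp
      let ?q = "\<lambda>u v. poly_value p (P_inv (set_block n N j u w) @\<^sub>v Q (set_entry m j v (product_map m n f w)))"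
      let ?b = "block n j ?w0"
      have q: "slice_poly (n j) (k * D) ?q"
        by (rule slice_poly_block[OF p _ P_inv_map Q_map D1(2) _ D1(4) D2(2) _ D2(4)])
          (use D1(3) D2(3) in \<open>auto simp: k_def D_def le_max_iff_disj\<close>)
      have q_eq: "?q u (f j u) = pulled p (set_block n N j u w)" if "u \<in> carrier_vec (n j)" for u
        unfolding pulled_def product_map_set_block[OF N_def j that] ..
      define v where "v = line (n j) (block n j w) ?b (- 1)"
      have v: "v \<in> carrier_vec (n j)" "euclid_norm v < R" using Suc.prems(3) j by (auto simp: v_def block_dist_def)
      have bv: "line (n j) ?b v 1 = block n j w" by (rule carrier_vec_eqI[of _ "n j"]) (auto simp: v_def)
      have "cmod (?q (line (n j) ?b v 1) (f j (line (n j) ?b v 1))) \<le>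
          exp (C j * real (k * D) powr (2 + e j (k * D))) * (exp (\<Sum>i<j. E i) * B)"
      proof (rule C(2)[OF j kD q _ v], intro ballI impI)
        fix u :: cvec assume u: "u \<in> carrier_vec (n j)" "euclid_norm u < r'"
        let ?u = "line (n j) ?b u 1"
        have shift_back: "line (n j) ?u ?b (- 1) = u" by (rule carrier_vec_eqI[of _ "n j"]) (use u in auto)
        have "cmod (pulled p (set_block n N j ?u w)) \<le> exp (\<Sum>i<j. E i) * B"
        proof (rule Suc.IH)
          show "\<forall>i<m. block_dist i (set_block n N j ?u w) ?w0 < (if i < j then R else r')"
          proof (intro allI impI)
            fix i assume i: "i < m"
            show "block_dist i (set_block n N j ?u w) ?w0 < (if i < j then R else r')"
              using Suc.prems(3)[rule_format, OF i] u(2) i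
              by (auto simp: block_dist_def block_set_block[OF N_def j i] shift_back less_Suc_eq)
          qed
        qed (use j in auto)
        then show "cmod (?q ?u (f j ?u)) \<le> exp (\<Sum>i<j. E i) * B" by (simp add: q_eq)
      qed
      then have "cmod (pulled p (set_block n N j (block n j w) w)) \<le> exp (E j) * (exp (\<Sum>i<j. E i) * B)"
        unfolding bv E_def q_eq[of "block n j w", OF block_carrier] .
      then show ?case unfolding set_block_self[OF N_def j Suc.prems(2)]
        by (simp add: exp_add mult_ac)
    qed
    have B0: "0 \<le> B"
      unfolding B_def using graph_max_upper[OF graph_bdd[OF p], of "0\<^sub>v N" r] r by (auto intro: order_trans[OF norm_ge_zero])
    have E_le: "(\<Sum>j<m. E j) \<le> Ctot * real k powr (2 + \<epsilon> k)"
    proof -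
      have "E j \<le> C j * (real D powr (2 + \<epsilon> 0) * real k powr (2 + \<epsilon> k))" if j: "j < m" for j
        unfolding E_def
      proof (intro mult_left_mono C(1)[OF j])
        have dec: "e i a \<le> e i b" if "i < m" "b \<le> a" for i a b
          using decseqD[OF e(2)[OF that(1)] that(2)] .
        have "k \<le> k * D" using D by simp
        then have "e j (k * D) \<le> e j k" using dec j by blast
        also have "\<dots> \<le> \<epsilon> k" unfolding \<epsilon>_def using j e(1) by (intro member_le_sum) auto
        finally have "real (k * D) powr (2 + e j (k * D)) \<le> real (k * D) powr (2 + \<epsilon> k)"
          using of_nat_mono[OF kD, where 'a = real] by (intro powr_mono) simp_all
        also have "\<dots> = real D powr (2 + \<epsilon> k) * real k powr (2 + \<epsilon> k)" by (simp add: powr_mult mult.commute)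
        also have "\<dots> \<le> real D powr (2 + \<epsilon> 0) * real k powr (2 + \<epsilon> k)"
        proof (intro mult_right_mono powr_mono)
          have "\<epsilon> k \<le> \<epsilon> 0" unfolding \<epsilon>_def using dec by (intro sum_mono) auto
          then show "2 + \<epsilon> k \<le> 2 + \<epsilon> 0" by simp
        qed (use D in auto)
        finally show "real (k * D) powr (2 + e j (k * D)) \<le> real D powr (2 + \<epsilon> 0) * real k powr (2 + \<epsilon> k)" .
      qed
      then have "(\<Sum>j<m. E j) \<le> (\<Sum>j<m. C j * (real D powr (2 + \<epsilon> 0) * real k powr (2 + \<epsilon> k)))"
        by (intro sum_mono) auto
      also have "\<dots> = Ctot * real k powr (2 + \<epsilon> k)" by (simp add: Ctot_def sum_distrib_right mult.assoc)
      finally show ?thesis .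
    qed
    have "graph_max N F p (exp 1 * r) \<le> exp (\<Sum>j<m. E j) * B"
    proof (rule graph_max_least)
      fix z :: cvec assume z: "z \<in> carrier_vec N" "euclid_norm z \<le> exp 1 * r"
      have "cmod (pulled p (P z)) \<le> exp (\<Sum>j<m. E j) * B"
        using z far[OF z] by (intro step) auto
      then show "cmod (poly_value p (z @\<^sub>v F z)) \<le> exp (\<Sum>j<m. E j) * B" by (simp add: pulled_P[OF z(1)])
    qed (use r in simp)
    also have "\<dots> \<le> exp (Ctot * real k powr (2 + \<epsilon> k)) * B" using E_le B0 by (intro mult_right_mono) auto
    also have "exp (Ctot * real k powr (2 + \<epsilon> k)) = exp Ctot powr (real k powr (2 + \<epsilon> k))"
      by (simp add: powr_def mult.commute)
    finally show ?thesis by (simp add: k_def B_def)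
  qed
  show "\<exists>C\<ge>0. \<forall>p\<in>polys (N + m). graph_max N F p (exp 1 * r) \<le>
      C powr (real (total_degree p) powr (2 + (\<Sum>j<m. e j (total_degree p)))) * graph_max N F p r"
    using bound by (intro exI[of _ "exp Ctot"]) (auto simp: \<epsilon>_def)
qed auto

end

section \<open>Optimality\<close>

text \<open>A zero row completes the \<open>s\<close> equations in \<open>s + 1\<close> unknowns to
  a square matrix of determinant 0.\<close>

lemma underdetermined_system:
  fixes a :: "nat \<Rightarrow> nat \<Rightarrow> complex"
  shows "\<exists>c. (\<exists>e\<le>s. c e \<noteq> 0) \<and> (\<forall>l<s. (\<Sum>e\<le>s. c e * a e l) = 0)"
proof -
  let ?K = "Suc s"
  define A where "A = mat\<^sub>r ?K ?K (\<lambda>i. if i = s then 0\<^sub>v ?K else Matrix.vec ?K (\<lambda>e. a e i))"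
  have A: "A \<in> carrier_mat ?K ?K" by (simp add: A_def)
  have "det A = 0" unfolding A_def by (rule det_row_0) auto
  then obtain v where v: "v \<in> carrier_vec ?K" "v \<noteq> 0\<^sub>v ?K" "A *\<^sub>v v = 0\<^sub>v ?K"
    unfolding det_0_iff_vec_prod_zero_field[OF A] by blast
  have "\<exists>e\<le>s. v !\<^sub>v e \<noteq> 0"
  proof (rule ccontr)
    assume "\<not> ?thesis"
    then have "v = 0\<^sub>v ?K" using v(1) by (intro eq_vecI) (auto simp: less_Suc_eq_le)
    then show False using v(2) by simp
  qed
  moreover have "(\<Sum>e\<le>s. v !\<^sub>v e * a e l) = 0" if l: "l < s" for l
  proof -
    have "row A l = Matrix.vec ?K (\<lambda>e. a e l)" using l by (auto simp: A_def intro!: eq_vecI)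
    then have "(A *\<^sub>v v) !\<^sub>v l = (\<Sum>e<?K. a e l * v !\<^sub>v e)"
      using l v(1) A by (simp add: scalar_prod_def atLeast0LessThan del: sum.lessThan_Suc)
    then show ?thesis using v(3) l by (simp add: lessThan_Suc_atMost mult.commute)
  qed
  ultimately show ?thesis by blast
qed

text \<open>Taylor's formula with an entire remainder, by repeated division by
  \<open>t\<close>.\<close>

lemma holomorphic_taylor_factor:
  assumes "G holomorphic_on UNIV"
  shows "\<exists>a R. R holomorphic_on UNIV \<and> (\<forall>t. G t = (\<Sum>l<s. a l * t ^ l) + t ^ s * R t)"
  using assms
proof (induction s arbitrary: G)
  case 0
  then show ?case by (intro exI[of _ undefined] exI[of _ G]) simp
next
  case (Suc s)
  define G1 where "G1 = (\<lambda>z. if z = 0 then deriv G 0 else (G z - G 0) / (z - 0))"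
  have "G1 holomorphic_on UNIV" unfolding G1_def using Suc.prems by (intro pole_lemma_open) auto
  from Suc.IH[OF this] obtain a R where aR: "R holomorphic_on UNIV" "\<And>t. G1 t = (\<Sum>l<s. a l * t ^ l) + t ^ s * R t"
    by blast
  define b where "b = (\<lambda>l. case l of 0 \<Rightarrow> G 0 | Suc l \<Rightarrow> a l)"
  have "G t = (\<Sum>l<Suc s. b l * t ^ l) + t ^ Suc s * R t" for t
  proof -
    have "G t = G 0 + t * G1 t" by (simp add: G1_def)
    also have "\<dots> = G 0 + (\<Sum>l<s. a l * t ^ Suc l) + t ^ Suc s * R t"
      by (simp add: aR(2) distrib_left sum_distrib_left mult_ac)
    also have "G 0 + (\<Sum>l<s. a l * t ^ Suc l) = (\<Sum>l<Suc s. b l * t ^ l)"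
      unfolding sum.lessThan_Suc_shift by (simp add: b_def)
    finally show ?thesis .
  qed
  then show ?case using aR(1) by blast
qed

definition biv :: "nat \<Rightarrow> (nat \<Rightarrow> nat \<Rightarrow> complex) \<Rightarrow> complex \<Rightarrow> complex \<Rightarrow> complex" where
  "biv L c x v = (\<Sum>i\<le>L. \<Sum>j\<le>L. c i j * (x ^ i * v ^ j))"

text \<open>There are \<open>(L + 1)\<^sup>2\<close> coefficients and only \<open>(L + 1)\<^sup>2 - 1\<close> vanishing conditions.\<close>

lemma exists_vanishing_biv:
  assumes h: "h holomorphic_on UNIV"
  shows "\<exists>c R. (\<exists>i\<le>L. \<exists>j\<le>L. c i j \<noteq> 0) \<and> R holomorphic_on UNIV \<and>
    (\<forall>t. biv L c (c0 + t) (h (c0 + t)) = t ^ ((L + 1)\<^sup>2 - 1) * R t)"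
proof -
  define s where "s = (L + 1)\<^sup>2 - 1"
  \<comment> \<open>The number \<open>i * (L + 1) + j\<close> enumerates the pairs of exponents, so
    that the coefficients form one vector of length \<open>s + 1\<close> and the vanishing
    conditions a linear system.\<close>
  define G where "G = (\<lambda>e t. (c0 + t) ^ (e div (L + 1)) * h (c0 + t) ^ (e mod (L + 1)))"
  have hol: "G e holomorphic_on UNIV" for e
  proof -
    have "(h \<circ> (\<lambda>t. c0 + t)) holomorphic_on UNIV"
      by (rule holomorphic_on_compose_gen[OF _ h]) (auto intro!: holomorphic_intros)
    then show ?thesis unfolding G_def o_def by (intro holomorphic_intros)
  qed
  have "\<forall>e. \<exists>a R. R holomorphic_on UNIV \<and> (\<forall>t. G e t = (\<Sum>l<s. a l * t ^ l) + t ^ s * R t)"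
    using holomorphic_taylor_factor[OF hol] by blast
  then obtain a R where aR: "\<And>e. R e holomorphic_on UNIV" "\<And>e t. G e t = (\<Sum>l<s. a e l * t ^ l) + t ^ s * R e t"
    by metis
  obtain d where d: "\<exists>e\<le>s. d e \<noteq> 0" "\<And>l. l < s \<Longrightarrow> (\<Sum>e\<le>s. d e * a e l) = 0"
    using underdetermined_system[of s a] by blast
  define c where "c = (\<lambda>i j. d (i * (L + 1) + j))"
  have s1: "s + 1 = (L + 1) * (L + 1)" by (simp add: s_def power2_eq_square)
  have div_mod: "(i * (L + 1) + j) div (L + 1) = i" "(i * (L + 1) + j) mod (L + 1) = j" if "j \<le> L" for i j
  proof -
    have "(i * (L + 1) + j) div (L + 1) = i + j div (L + 1)" by (rule div_mult_self3) simp
    also have "j div (L + 1) = 0" using that by simp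
    finally show "(i * (L + 1) + j) div (L + 1) = i" by simp
    have "(i * (L + 1) + j) mod (L + 1) = j mod (L + 1)" by (rule mod_mult_self3)
    also have "\<dots> = j" using that by simp
    finally show "(i * (L + 1) + j) mod (L + 1) = j" .
  qed
  have bij: "bij_betw (\<lambda>(i, j). i * (L + 1) + j) ({..L} \<times> {..L}) {..s}"
  proof (rule bij_betw_byWitness[where f' = "\<lambda>e. (e div (L + 1), e mod (L + 1))"])
    show "(\<lambda>(i, j). i * (L + 1) + j) ` ({..L} \<times> {..L}) \<subseteq> {..s}"
    proof (rule image_subsetI)
      fix x assume "x \<in> {..L} \<times> {..L}"
      then obtain i j where x: "x = (i, j)" "i \<le> L" "j \<le> L" by auto
      then have "i * (L + 1) + j \<le> L * (L + 1) + L" by (intro add_mono mult_right_mono) auto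
      then have "i * (L + 1) + j \<le> s" using s1 by simp
      then show "(case x of (i, j) \<Rightarrow> i * (L + 1) + j) \<in> {..s}" by (simp add: x(1))
    qed
    show "(\<lambda>e. (e div (L + 1), e mod (L + 1))) ` {..s} \<subseteq> {..L} \<times> {..L}"
    proof (rule image_subsetI)
      fix e assume "e \<in> {..s}"
      then have "e < (L + 1) * (L + 1)" using s1 by simp
      then have "e div (L + 1) < L + 1" by (rule less_mult_imp_div_less)
      then show "(e div (L + 1), e mod (L + 1)) \<in> {..L} \<times> {..L}"
        using mod_less_divisor[of "L + 1" e] by (simp add: less_Suc_eq_le)
    qed
    show "\<forall>x\<in>{..L} \<times> {..L}. (\<lambda>e. (e div (L + 1), e mod (L + 1))) ((\<lambda>(i, j). i * (L + 1) + j) x) = x"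
    proof
      fix x assume "x \<in> {..L} \<times> {..L}"
      then obtain i j where "x = (i, j)" "j \<le> L" by auto
      then show "(\<lambda>e. (e div (L + 1), e mod (L + 1))) ((\<lambda>(i, j). i * (L + 1) + j) x) = x"
        using div_mod[of j i] by (simp only: prod.case)
    qed
    show "\<forall>e\<in>{..s}. (\<lambda>(i, j). i * (L + 1) + j) (e div (L + 1), e mod (L + 1)) = e"
      using div_mult_mod_eq[of _ "L + 1"] by (simp only: prod.case) blast
  qed
  have sum_eq: "biv L c (c0 + t) (h (c0 + t)) = (\<Sum>e\<le>s. d e * G e t)" for t
  proof -
    have "biv L c (c0 + t) (h (c0 + t)) = (\<Sum>(i, j)\<in>{..L} \<times> {..L}. c i j * ((c0 + t) ^ i * h (c0 + t) ^ j))"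
      unfolding biv_def by (simp add: sum.cartesian_product)
    also have "\<dots> = (\<Sum>x\<in>{..L} \<times> {..L}. d ((\<lambda>(i, j). i * (L + 1) + j) x) * G ((\<lambda>(i, j). i * (L + 1) + j) x) t)"
    proof (rule sum.cong[OF refl])
      fix x assume "x \<in> {..L} \<times> {..L}"
      then obtain i j where x: "x = (i, j)" "j \<le> L" by auto
      show "(case x of (i, j) \<Rightarrow> c i j * ((c0 + t) ^ i * h (c0 + t) ^ j)) =
          d ((\<lambda>(i, j). i * (L + 1) + j) x) * G ((\<lambda>(i, j). i * (L + 1) + j) x) t"
        by (simp only: x(1) prod.case G_def c_def div_mod[OF x(2)])
    qed
    also have "\<dots> = (\<Sum>e\<le>s. d e * G e t)" by (rule sum.reindex_bij_betw[OF bij])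
    finally show ?thesis .
  qed
  have "(\<Sum>e\<le>s. d e * G e t) = t ^ s * (\<Sum>e\<le>s. d e * R e t)" for t
  proof -
    have "(\<Sum>e\<le>s. d e * G e t) = (\<Sum>e\<le>s. \<Sum>l<s. (d e * a e l) * t ^ l) + t ^ s * (\<Sum>e\<le>s. d e * R e t)"
      by (simp add: aR(2) distrib_left sum.distrib sum_distrib_left mult_ac)
    also have "(\<Sum>e\<le>s. \<Sum>l<s. (d e * a e l) * t ^ l) = (\<Sum>l<s. (\<Sum>e\<le>s. d e * a e l) * t ^ l)"
      unfolding sum_distrib_right by (rule sum.swap)
    also have "\<dots> = 0" using d(2) by simp
    finally show ?thesis by simp
  qed
  moreover have "(\<lambda>t. \<Sum>e\<le>s. d e * R e t) holomorphic_on UNIV" by (intro holomorphic_intros aR)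
  moreover have "\<exists>i\<le>L. \<exists>j\<le>L. c i j \<noteq> 0"
  proof -
    obtain e where e: "e \<in> {..s}" "d e \<noteq> 0" using d(1) by auto
    have "e \<in> (\<lambda>(i, j). i * (L + 1) + j) ` ({..L} \<times> {..L})"
      using bij_betw_imp_surj_on[OF bij] e(1) by (simp only:)
    then obtain x where x: "x \<in> {..L} \<times> {..L}" "e = (\<lambda>(i, j). i * (L + 1) + j) x" by (rule imageE)
    then have "fst x \<le> L" "snd x \<le> L" "c (fst x) (snd x) \<noteq> 0"
      using e(2) by (auto simp: c_def split_beta)
    then show ?thesis by blast
  qed
  ultimately show ?thesis
    unfolding s_def[symmetric] by (intro exI[of _ c] exI[of _ "\<lambda>t. \<Sum>e\<le>s. d e * R e t"]) (simp add: sum_eq)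
qed

lemma biv_nonzero:
  assumes "\<exists>i\<le>L. \<exists>j\<le>L. c i j \<noteq> 0"
  shows "\<exists>x v. biv L c x v \<noteq> 0"
proof (rule ccontr)
  assume "\<not> ?thesis"
  then have zero: "biv L c x v = 0" for x v by blast
  have "c i j = 0" if ij: "i \<le> L" "j \<le> L" for i j
  proof -
    have inner: "(\<Sum>i\<le>L. c i j * x ^ i) = 0" for x
    proof -
      define p where "p = (\<Sum>j\<le>L. monom (\<Sum>i\<le>L. c i j * x ^ i) j)"
      have "poly p v = biv L c x v" for v
        unfolding p_def biv_def poly_sum poly_monom sum_distrib_right
        by (subst sum.swap) (simp add: mult_ac)
      then have "p = 0" using zero poly_all_0_iff_0[of p] by simp
      moreover have "coeff p j = (\<Sum>i\<le>L. c i j * x ^ i)" unfolding p_def coeff_sum using ij by simp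
      ultimately show ?thesis by simp
    qed
    define q where "q = (\<Sum>i\<le>L. monom (c i j) i)"
    have "poly q x = 0" for x using inner by (simp add: q_def poly_sum poly_monom)
    then have "q = 0" using poly_all_0_iff_0[of q] by simp
    moreover have "coeff q i = c i j" unfolding q_def coeff_sum using ij by simp
    ultimately show ?thesis by simp
  qed
  then show False using assms by blast
qed

lemma bideg_biv:
  assumes "bideg 1 X" "bideg 1 V"
  shows "bideg (L + L) (\<lambda>x v. biv L c (X x v) (V x v))"
  unfolding biv_def
proof (intro bideg_sum)
  fix i j assume "i \<in> {..L}" "j \<in> {..L}"
  then have le: "0 + (i * 1 + j * 1) \<le> L + L" by simp
  have "bideg (0 + (i * 1 + j * 1)) (\<lambda>x v. c i j * (X x v ^ i * V x v ^ j))"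
    by (intro bideg_mult bideg_const bideg_power assms)
  then show "bideg (L + L) (\<lambda>x v. c i j * (X x v ^ i * V x v ^ j))" using le by (rule bideg_mono)
qed

text \<open>Without this the high order of vanishing could be trivial.
  \<open>slice_poly_zero\<close> excludes that, by the growth condition that also gives the upper
  bound.\<close>

lemma biv_nonzero_on_graph:
  fixes f :: "cvec \<Rightarrow> complex"
  assumes f: "slice_entire 1 f" and np: "\<not> polynomial_function 1 f" and gc: "growth_cond 1 f \<mu>"
    and c: "\<exists>i\<le>L. \<exists>j\<le>L. c i j \<noteq> 0" and L: "1 \<le> L"
  shows "\<exists>x. biv L c x (f (Matrix.vec 1 (\<lambda>_. x))) \<noteq> 0"
proof (rule ccontr)
  assume neg: "\<not> ?thesis"
  obtain z0 where z0: "z0 \<in> carrier_vec 1" "f z0 \<noteq> 0" using not_polynomial_nonzero[OF np] .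
  obtain T s where gr: "growth_at 1 f (L + L) T s"
    using gc L unfolding growth_cond_def by (metis add_leD1 trans_le_add1)
  define q where "q = (\<lambda>(w :: cvec) v. biv L c (w !\<^sub>v 0) v)"
  have q: "slice_poly 1 (L + L) q"
    unfolding slice_poly_def
  proof (intro conjI ballI allI)
    fix a b :: cvec
    show "bideg (L + L) (\<lambda>x v. q (line 1 a b x) v)"
      unfolding q_def using bideg_fst_var bideg_snd_var by (intro bideg_biv) auto
  next
    fix r :: real
    have "cmod (q w v) \<le> (\<Sum>i\<le>L. \<Sum>j\<le>L. cmod (c i j) * (r ^ i * r ^ j))"
      if "w \<in> carrier_vec 1" "euclid_norm w \<le> r" "cmod v \<le> r" for w v
    proof -
      have wr: "cmod (w !\<^sub>v 0) \<le> r" using order_trans[OF cmod_index_le[OF that(1), of 0] that(2)] by simp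
      have r0: "0 \<le> r" using order_trans[OF norm_ge_zero that(3)] .
      show ?thesis unfolding q_def biv_def
        by (intro order_trans[OF norm_sum] sum_mono)
          (use wr that(3) r0 in \<open>auto simp: norm_mult norm_power intro!: mult_mono power_mono\<close>)
    qed
    then show "\<exists>B. \<forall>w\<in>carrier_vec 1. \<forall>v. euclid_norm w \<le> r \<longrightarrow> cmod v \<le> r \<longrightarrow> cmod (q w v) \<le> B" by blast
  qed
  have q0: "q w v = 0" if w: "w \<in> carrier_vec 1" for w v
  proof (rule slice_poly_zero[OF f z0 _ gr q _ w])
    show "1 \<le> L + L" using L by simp
    fix w :: cvec assume w: "w \<in> carrier_vec 1"
    have "w = Matrix.vec 1 (\<lambda>_. w !\<^sub>v 0)" by (rule carrier_vec_eqI[of _ 1]) (use w in auto)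
    then show "q w (f w) = 0" using neg unfolding q_def by metis
  qed
  have "biv L c x v = 0" for x v using q0[of "Matrix.vec 1 (\<lambda>_. x)" v] by (simp add: q_def)
  then show False using biv_nonzero[OF c] by blast
qed

lemma polyfun_biv:
  assumes "polyfun n D X" "polyfun n D V"
  shows "polyfun n (2 * L * D) (\<lambda>z. biv L c (X z) (V z))"
  unfolding biv_def
proof (intro polyfun_sum)
  fix i j assume ij: "i \<in> {..L}" "j \<in> {..L}"
  have "i * D + j * D \<le> L * D + L * D" using ij by (intro add_mono mult_right_mono) auto
  then have le: "0 + (i * D + j * D) \<le> 2 * L * D" by simp
  have "polyfun n (0 + (i * D + j * D)) (\<lambda>z. c i j * (X z ^ i * V z ^ j))"
    by (intro polyfun_mult polyfun_const polyfun_power assms)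
  then show "polyfun n (2 * L * D) (\<lambda>z. c i j * (X z ^ i * V z ^ j))" using le by (rule polyfun_mono)
qed

text \<open>A monomial factor shifts exponents injectively, so nothing cancels. This lets a test
  polynomial be raised to a prescribed degree.\<close>

lemma monomial_mult_total_degree:
  fixes p :: cpoly
  assumes p: "p \<noteq> 0"
  shows "total_degree (Poly_Mapping.single \<beta> 1 * p) = keysum \<beta> + total_degree p"
proof -
  have look: "Poly_Mapping.lookup (Poly_Mapping.single \<beta> 1 * p) (\<beta> + \<alpha>) = Poly_Mapping.lookup p \<alpha>" for \<alpha>
  proof -
    have "Poly_Mapping.single \<beta> 1 * p = (\<Sum>\<gamma>\<in>Poly_Mapping.keys p. Poly_Mapping.single (\<beta> + \<gamma>) (Poly_Mapping.lookup p \<gamma>))"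
      by (subst sum_single_keys[of p, symmetric]) (simp add: sum_distrib_left mult_single)
    then have "Poly_Mapping.lookup (Poly_Mapping.single \<beta> 1 * p) (\<beta> + \<alpha>) =
        (\<Sum>\<gamma>\<in>Poly_Mapping.keys p. if \<gamma> = \<alpha> then Poly_Mapping.lookup p \<gamma> else 0)"
      by (simp add: lookup_sum lookup_single when_def)
    then show ?thesis by (auto simp: in_keys_iff)
  qed
  have "total_degree (Poly_Mapping.single \<beta> 1 * p) \<le> keysum \<beta> + total_degree p"
    unfolding total_degree_le_iff
  proof
    fix \<alpha> assume "\<alpha> \<in> Poly_Mapping.keys (Poly_Mapping.single \<beta> 1 * p)"
    from subsetD[OF keys_mult this] obtain \<gamma> where \<gamma>: "\<alpha> = \<beta> + \<gamma>" "\<gamma> \<in> Poly_Mapping.keys p"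
      by (auto split: if_splits)
    then show "keysum \<alpha> \<le> keysum \<beta> + total_degree p"
      using total_degree_le_iff[of p "total_degree p"] by (simp add: keysum_add)
  qed
  moreover have "keysum \<beta> + total_degree p \<le> total_degree (Poly_Mapping.single \<beta> 1 * p)"
  proof -
    have ne: "Poly_Mapping.keys p \<noteq> {}" using p by simp
    have "total_degree p \<in> insert 0 (keysum ` Poly_Mapping.keys p)"
      unfolding total_degree_def by (rule Max_in) auto
    then obtain \<alpha> where \<alpha>: "\<alpha> \<in> Poly_Mapping.keys p" "total_degree p \<le> keysum \<alpha>" using ne by fastforce
    then have "\<beta> + \<alpha> \<in> Poly_Mapping.keys (Poly_Mapping.single \<beta> 1 * p)" by (simp add: in_keys_iff look)
    then have "keysum (\<beta> + \<alpha>) \<le> total_degree (Poly_Mapping.single \<beta> 1 * p)"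
      using total_degree_le_iff[of "Poly_Mapping.single \<beta> 1 * p"] by blast
    then show ?thesis using \<alpha> by (simp add: keysum_add)
  qed
  ultimately show ?thesis by simp
qed

section \<open>Test polynomials of large growth on the graph\<close>

context product_graph
begin

definition Q_inv :: "cvec \<Rightarrow> cvec" where "Q_inv = inv_into (carrier_vec m) Q"

lemma Q_inv_map: "polynomial_map m m Q_inv"
  using Q by (simp add: polynomial_automorphism_def Q_inv_def)

lemma Q_inv_Q: "v \<in> carrier_vec m \<Longrightarrow> Q_inv (Q v) = v"
  using Q unfolding polynomial_automorphism_def Q_inv_def by (metis bij_betw_inv_into_left)

lemma F_carrier [simp]: "z \<in> carrier_vec N \<Longrightarrow> F z \<in> carrier_vec m"
  by (simp add: F_def)

context
  assumes m: "0 < m" and n0: "n 0 = 1"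
begin

abbreviation (input) h :: "complex \<Rightarrow> complex" where "h x \<equiv> f 0 (Matrix.vec 1 (\<lambda>_. x))"

lemma N_pos: "0 < N"
proof -
  have "n 0 \<le> (\<Sum>j<m. n j)" using m by (intro member_le_sum) auto
  then show ?thesis using n0 by (simp add: N_def)
qed

lemma h_holomorphic: "h holomorphic_on A"
proof -
  have "h = (\<lambda>x. f 0 (line 1 (0\<^sub>v 1) (Matrix.vec 1 (\<lambda>_. 1)) x))"
    by (intro ext arg_cong[where f = "f 0"] carrier_vec_eqI[of _ 1]) auto
  then show ?thesis using slice_entireD[of 1 "f 0" "0\<^sub>v 1" "Matrix.vec 1 (\<lambda>_. 1)" A] f_entire[OF m] n0 by simp
qed

text \<open>Coordinate 0 of \<open>P z\<close> is polynomial in \<open>z\<close>, and undoing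
  \<open>Q\<close> recovers the value of \<open>f 0\<close> as a polynomial in \<open>F z\<close>.
  Hence every \<open>biv\<close> in these two quantities is the restriction of a polynomial to the
  graph, the degree growing by a constant factor.\<close>

lemma graph_polynomial_of_biv:
  obtains D where "1 \<le> D" "\<And>L c. \<exists>p\<in>polys (N + m). total_degree p \<le> 2 * L * D \<and>
    (\<forall>z\<in>carrier_vec N. poly_value p (z @\<^sub>v F z) = biv L c (P z !\<^sub>v 0) (h (P z !\<^sub>v 0)))"
proof -
  obtain D1 gp where D1: "1 \<le> D1" "\<And>i. i < N \<Longrightarrow> gp i \<in> polys N" "\<And>i. i < N \<Longrightarrow> total_degree (gp i) \<le> D1"
    "\<And>i z. i < N \<Longrightarrow> z \<in> carrier_vec N \<Longrightarrow> P z !\<^sub>v i = poly_value (gp i) z"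
    using polynomial_map_degree[OF P_map] by metis
  obtain D2 hp where D2: "1 \<le> D2" "\<And>i. i < m \<Longrightarrow> hp i \<in> polys m" "\<And>i. i < m \<Longrightarrow> total_degree (hp i) \<le> D2"
    "\<And>i z. i < m \<Longrightarrow> z \<in> carrier_vec m \<Longrightarrow> Q_inv z !\<^sub>v i = poly_value (hp i) z"
    using polynomial_map_degree[OF Q_inv_map] by metis
  define D where "D = max D1 D2"
  define fst_part where "fst_part = (\<lambda>z :: cvec. Matrix.vec N (\<lambda>i. z !\<^sub>v i))"
  define snd_part where "snd_part = (\<lambda>z :: cvec. Matrix.vec m (\<lambda>i. z !\<^sub>v (N + i)))"
  have X: "polyfun (N + m) D (\<lambda>z. poly_value (gp 0) (fst_part z))"
  proof (rule polyfun_mono[OF polyfun_compose[OF D1(2)[OF N_pos], of "N + m" 1]])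
    show "polyfun (N + m) 1 (\<lambda>z. fst_part z !\<^sub>v i)" if "i < N" for i
      using polyfun_coord[of i "N + m"] that by (simp add: fst_part_def)
    show "total_degree (gp 0) * 1 \<le> D" using D1(3)[OF N_pos] by (simp add: D_def)
  qed
  have V: "polyfun (N + m) D (\<lambda>z. poly_value (hp 0) (snd_part z))"
  proof (rule polyfun_mono[OF polyfun_compose[OF D2(2)[OF m], of "N + m" 1]])
    show "polyfun (N + m) 1 (\<lambda>z. snd_part z !\<^sub>v i)" if "i < m" for i
      using polyfun_coord[of "N + i" "N + m"] that by (simp add: snd_part_def)
    show "total_degree (hp 0) * 1 \<le> D" using D2(3)[OF m] by (simp add: D_def)
  qed
  have parts: "fst_part (z @\<^sub>v v) = z" "snd_part (z @\<^sub>v v) = v" if "z \<in> carrier_vec N" "v \<in> carrier_vec m" for z v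
    using that by (auto simp: fst_part_def snd_part_def intro!: eq_vecI)
  have main: "\<exists>p\<in>polys (N + m). total_degree p \<le> 2 * L * D \<and>
    (\<forall>z\<in>carrier_vec N. poly_value p (z @\<^sub>v F z) = biv L c (P z !\<^sub>v 0) (h (P z !\<^sub>v 0)))" for L c
  proof -
    obtain p where p: "p \<in> polys (N + m)" "total_degree p \<le> 2 * L * D"
      "\<And>z. z \<in> carrier_vec (N + m) \<Longrightarrow> biv L c (poly_value (gp 0) (fst_part z)) (poly_value (hp 0) (snd_part z)) = poly_value p z"
      using polyfun_biv[OF X V, of L c] unfolding polyfun_def by blast
    have "poly_value p (z @\<^sub>v F z) = biv L c (P z !\<^sub>v 0) (h (P z !\<^sub>v 0))" if z: "z \<in> carrier_vec N" for z
    proof -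
      have "poly_value (gp 0) z = P z !\<^sub>v 0" using D1(4)[OF N_pos z] by simp
      moreover have "poly_value (hp 0) (F z) = h (P z !\<^sub>v 0)"
      proof -
        have "poly_value (hp 0) (F z) = Q_inv (F z) !\<^sub>v 0" using D2(4)[OF m F_carrier[OF z]] by simp
        also have "Q_inv (F z) = product_map m n f (P z)" by (simp add: F_def Q_inv_Q)
        also have "\<dots> !\<^sub>v 0 = f 0 (block n 0 (P z))" using m by (simp add: product_map_def)
        also have "block n 0 (P z) = Matrix.vec 1 (\<lambda>_. P z !\<^sub>v 0)"
          by (rule eq_vecI) (auto simp: block_def n0)
        finally show ?thesis .
      qed
      ultimately show ?thesis
        using p(3)[of "z @\<^sub>v F z"] z by (simp add: parts)
    qed
    then show ?thesis using p by blast
  qed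
  show thesis by (rule that[OF _ main]) (use D1(1) in \<open>simp add: D_def\<close>)
qed

text \<open>The test polynomial vanishes to order \<open>(L + 1)\<^sup>2 - 1\<close> on the fibre over \<open>P 0\<close>. The power of
  \<open>z_0\<close> only serves to make its degree exactly \<open>k\<close>.\<close>

lemma fast_growing_polynomial:
  assumes gc: "growth_cond (n 0) (f 0) \<mu>"
  obtains D :: nat where "1 \<le> D" "\<And>L k :: nat. 1 \<le> L \<Longrightarrow> 2 * L * D \<le> k \<Longrightarrow> \<exists>p\<in>polys (N + m). total_degree p = k \<and>
    0 < graph_max N F p 1 \<and> exp (real ((L + 1)\<^sup>2 - 1)) * graph_max N F p 1 \<le> graph_max N F p (exp 1)"
proof -
  obtain D where D: "1 \<le> D" "\<And>L c. \<exists>p\<in>polys (N + m). total_degree p \<le> 2 * L * D \<and>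
    (\<forall>z\<in>carrier_vec N. poly_value p (z @\<^sub>v F z) = biv L c (P z !\<^sub>v 0) (h (P z !\<^sub>v 0)))"
    using graph_polynomial_of_biv by blast
  have "\<exists>p\<in>polys (N + m). total_degree p = k \<and>
    0 < graph_max N F p 1 \<and> exp (real ((L + 1)\<^sup>2 - 1)) * graph_max N F p 1 \<le> graph_max N F p (exp 1)"
    if L: "1 \<le> L" and k: "2 * L * D \<le> k" for L k :: nat
  proof -
    define s where "s = (L + 1)\<^sup>2 - 1"
    define c0 where "c0 = P (0\<^sub>v N) !\<^sub>v 0"
    obtain c R where c: "\<exists>i\<le>L. \<exists>j\<le>L. c i j \<noteq> 0" and R: "R holomorphic_on UNIV"
      and van: "\<And>t. biv L c (c0 + t) (h (c0 + t)) = t ^ s * R t"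
      using exists_vanishing_biv[OF h_holomorphic, of L c0] unfolding s_def by blast
    obtain p0 where p0: "p0 \<in> polys (N + m)" "total_degree p0 \<le> 2 * L * D"
      "\<And>z. z \<in> carrier_vec N \<Longrightarrow> poly_value p0 (z @\<^sub>v F z) = biv L c (P z !\<^sub>v 0) (h (P z !\<^sub>v 0))"
      using D(2) by blast
    obtain x1 where x1: "biv L c x1 (h x1) \<noteq> 0"
      using biv_nonzero_on_graph[of "f 0" \<mu> L c] f_entire[OF m] f_not_poly[OF m] gc c L n0 by auto
    obtain gp where gp: "gp \<in> polys N" "\<And>z. z \<in> carrier_vec N \<Longrightarrow> P z !\<^sub>v 0 = poly_value gp z"
      using P_map N_pos unfolding polynomial_map_def polynomial_function_def by blast
    have P_line: "\<exists>q. \<forall>x. P (line N a b x) !\<^sub>v 0 = poly q x" for a b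
    proof -
      have "bideg (total_degree gp * 1) (\<lambda>x v. poly_value gp (line N a b x))"
        by (rule bideg_poly_value[OF gp(1) order_refl]) (use bideg_fst_var in auto)
      from bideg_fst[OF this] show ?thesis using gp(2) line_carrier by metis
    qed
    define t where "t = k - total_degree p0"
    define p where "p = Poly_Mapping.single (Poly_Mapping.single 0 t) 1 * p0"
    define G where "G = (\<lambda>z. poly_value p (z @\<^sub>v F z))"
    have G: "G z = (z !\<^sub>v 0) ^ t * biv L c (P z !\<^sub>v 0) (h (P z !\<^sub>v 0))" if z: "z \<in> carrier_vec N" for z
    proof -
      have "(z @\<^sub>v F z) !\<^sub>v 0 = z !\<^sub>v 0" using z N_pos by (subst index_append_vec(1)) auto
      then show ?thesis
        using p0(3)[OF z] by (cases "t = 0") (auto simp: G_def p_def poly_value_mult poly_value_single monomial_value_def)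
    qed
    have biv_line: "(\<lambda>x. biv L c (P (line N a b x) !\<^sub>v 0) (h (P (line N a b x) !\<^sub>v 0))) holomorphic_on A" for a b A
    proof -
      obtain q where q: "\<And>x. P (line N a b x) !\<^sub>v 0 = poly q x" using P_line by blast
      have "(h \<circ> poly q) holomorphic_on A"
        by (rule holomorphic_on_compose_gen[OF _ h_holomorphic[of UNIV]]) (auto intro!: holomorphic_intros)
      then show ?thesis unfolding biv_def q o_def by (intro holomorphic_intros)
    qed
    have p: "p \<in> polys (N + m)"
    proof -
      have "keys_sub \<subseteq> {..<N + m}" if "keys_sub = Poly_Mapping.keys \<alpha>" "\<alpha> \<in> Poly_Mapping.keys p" for keys_sub \<alpha>
      proof -
        from subsetD[OF keys_mult that(2)[unfolded p_def]] obtain \<gamma> where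
          \<gamma>: "\<alpha> = Poly_Mapping.single 0 t + \<gamma>" "\<gamma> \<in> Poly_Mapping.keys p0" by (auto split: if_splits)
        have "Poly_Mapping.keys \<alpha> \<subseteq> {0} \<union> Poly_Mapping.keys \<gamma>"
          unfolding \<gamma>(1) using keys_add[of "Poly_Mapping.single 0 t" \<gamma>] by (auto split: if_splits)
        then show ?thesis using that(1) \<gamma>(2) p0(1) N_pos unfolding polys_def by fastforce
      qed
      then show ?thesis unfolding polys_def by blast
    qed
    have "\<exists>z\<in>carrier_vec N. G z \<noteq> 0"
    proof -
      obtain w where w: "w \<in> carrier_vec N" "w !\<^sub>v 0 = x1"
        using N_pos by (intro that[of "Matrix.vec N (\<lambda>_. x1)"]) auto
      define z1 where "z1 = P_inv w"
      have z1: "z1 \<in> carrier_vec N" "P z1 !\<^sub>v 0 = x1" using w by (auto simp: z1_def P_P_inv)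
      \<comment> \<open>The padding monomial vanishes where coordinate 0 does. A small shift in
        direction \<open>e\<close> leaves that hyperplane and keeps the other factor
        nonzero.\<close>
      define e :: cvec where "e = Matrix.vec N (\<lambda>_. 1)"
      let ?b = "\<lambda>x. biv L c (P (line N z1 e x) !\<^sub>v 0) (h (P (line N z1 e x) !\<^sub>v 0))"
      have "isCont ?b 0"
        using holomorphic_on_imp_continuous_on[OF biv_line[of z1 e UNIV]] by (simp add: continuous_on_eq_continuous_at)
      moreover have "?b 0 \<noteq> 0" using z1 x1 by simp
      ultimately have "\<forall>\<^sub>F x in at 0. ?b x \<noteq> 0" unfolding isCont_def by (rule tendsto_imp_eventually_ne)
      moreover have "\<forall>\<^sub>F x in at 0. x \<noteq> - (z1 !\<^sub>v 0)"
        by (cases "z1 !\<^sub>v 0 = 0") (auto simp: eventually_neq_at_within eventually_at_filter intro!: t1_space_nhds)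
      ultimately have "\<forall>\<^sub>F x in at 0. ?b x \<noteq> 0 \<and> x \<noteq> - (z1 !\<^sub>v 0)" by (rule eventually_conj)
      then obtain x where x: "?b x \<noteq> 0" "x \<noteq> - (z1 !\<^sub>v 0)"
        using eventually_happens[of _ "at (0::complex)"] by auto
      have "line N z1 e x !\<^sub>v 0 \<noteq> 0" using x(2) N_pos by (auto simp: e_def add_eq_0_iff)
      then have "G (line N z1 e x) \<noteq> 0" using G[of "line N z1 e x"] x(1) by simp
      then show ?thesis by (intro bexI[of _ "line N z1 e x"]) auto
    qed
    then obtain z1 where z1: "z1 \<in> carrier_vec N" "G z1 \<noteq> 0" by blast
    have "p0 \<noteq> 0" using z1 by (auto simp: G_def p_def)
    then have deg: "total_degree p = k"
      using monomial_mult_total_degree[of p0 "Poly_Mapping.single 0 t"] p0(2) k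
      by (cases "t = 0") (auto simp: p_def t_def)
    have slice: "\<exists>\<Psi>. \<Psi> holomorphic_on UNIV \<and> (\<forall>x. G (line N (0\<^sub>v N) z x) = x ^ s * \<Psi> x)"
      if z: "z \<in> carrier_vec N" for z
    proof -
      obtain q where q: "\<And>x. P (line N (0\<^sub>v N) z x) !\<^sub>v 0 = poly q x" using P_line by blast
      \<comment> \<open>On a line through the origin, coordinate 0 of \<open>P\<close> starts at
        \<open>c0\<close>; its difference from \<open>c0\<close> has a factor \<open>x\<close>, so
        vanishing of order \<open>s\<close> at \<open>c0\<close> becomes a factor
        \<open>x ^ s\<close>.\<close>
      define q' where "q' = synthetic_div q 0"
      have q': "poly q x = c0 + x * poly q' x" for x
      proof -
        have "poly q x = poly ([:-0, 1:] * synthetic_div q 0 + [:poly q 0:]) x"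
          using synthetic_div_correct'[of 0 q] by simp
        moreover have "poly q 0 = c0" using q[of 0] by (simp add: c0_def)
        ultimately show ?thesis by (simp add: q'_def)
      qed
      define \<Psi> where "\<Psi> = (\<lambda>x. (x * z !\<^sub>v 0) ^ t * (poly q' x ^ s * R (x * poly q' x)))"
      have "(R \<circ> (\<lambda>x. x * poly q' x)) holomorphic_on UNIV"
        by (rule holomorphic_on_compose_gen[OF _ R]) (auto intro!: holomorphic_intros)
      then have "\<Psi> holomorphic_on UNIV" unfolding \<Psi>_def o_def by (intro holomorphic_intros)
      moreover have "G (line N (0\<^sub>v N) z x) = x ^ s * \<Psi> x" for x
        unfolding G[OF line_carrier] q q' van using N_pos by (simp add: \<Psi>_def power_mult_distrib)
      ultimately show ?thesis by blast
    qed
    have up: "cmod (G z) \<le> graph_max N F p r" if "z \<in> carrier_vec N" "euclid_norm z \<le> r" for z r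
      unfolding G_def using that by (rule graph_max_upper[OF graph_bdd[OF p]])
    have "0 < graph_max N F p 1"
    proof (rule ccontr)
      assume neg: "\<not> 0 < graph_max N F p 1"
      have zero: "G z = 0" if "z \<in> carrier_vec N" "euclid_norm z \<le> 1" for z
      proof -
        have "cmod (G z) \<le> 0" using up[OF that] neg by linarith
        then show ?thesis by simp
      qed
      obtain \<Psi> where \<Psi>: "\<Psi> holomorphic_on UNIV" "\<And>x. G (line N (0\<^sub>v N) z1 x) = x ^ s * \<Psi> x"
        using slice[OF z1(1)] by blast
      define d where "d = 1 / (euclid_norm z1 + 1)"
      have Nz: "0 < euclid_norm z1 + 1" by (simp add: add_nonneg_pos)
      then have d: "0 < d" by (simp add: d_def)
      have "G (line N (0\<^sub>v N) z1 1) = 0"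
      proof (rule analytic_continuation[where f = "\<lambda>x. G (line N (0\<^sub>v N) z1 x)" and S = UNIV and U = "ball 0 d" and \<xi> = 0])
        show "(\<lambda>x. G (line N (0\<^sub>v N) z1 x)) holomorphic_on UNIV" unfolding \<Psi>(2) by (intro holomorphic_intros \<Psi>(1))
        show "0 islimpt ball (0::complex) d" using d by (intro interior_limit_point) simp
        fix x :: complex assume x: "x \<in> ball 0 d"
        have "euclid_norm (line N (0\<^sub>v N) z1 x) \<le> cmod x * (euclid_norm z1 + 1)"
          unfolding euclid_norm_line_origin[OF z1(1)] by (intro mult_left_mono) auto
        also have "\<dots> \<le> 1" using x Nz by (simp add: d_def pos_less_divide_eq)
        finally show "G (line N (0\<^sub>v N) z1 x) = 0" by (intro zero) auto
      qed auto
      then show False using z1 by simp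
    qed
    moreover have "exp s * graph_max N F p 1 \<le> graph_max N F p (exp 1)"
    proof -
      have "graph_max N F p 1 \<le> graph_max N F p (exp 1) / exp s"
      proof (rule graph_max_least)
        fix z :: cvec assume z: "z \<in> carrier_vec N" "euclid_norm z \<le> 1"
        obtain \<Psi> where \<Psi>: "\<Psi> holomorphic_on UNIV" "\<And>x. G (line N (0\<^sub>v N) z x) = x ^ s * \<Psi> x"
          using slice[OF z(1)] by blast
        \<comment> \<open>On the circle of radius \<open>exp 1\<close> dividing by
          \<open>x ^ s\<close> gains \<open>exp (- s)\<close>, and the maximum principle carries
          this to the parameter 1.\<close>
        have "cmod (\<Psi> 1) \<le> graph_max N F p (exp 1) / exp s"
        proof (rule maximum_modulus_frontier[where S = "cball 0 (exp 1)" and f = \<Psi> and \<xi> = 1])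
          show "\<Psi> holomorphic_on interior (cball 0 (exp 1))" using \<Psi>(1) holomorphic_on_subset by blast
          show "continuous_on (closure (cball 0 (exp 1))) \<Psi>"
            using \<Psi>(1) holomorphic_on_imp_continuous_on holomorphic_on_subset by blast
          show "1 \<in> cball (0::complex) (exp 1)" by simp
          fix x :: complex assume "x \<in> frontier (cball 0 (exp 1))"
          then have x: "cmod x = exp 1" by simp
          have "cmod (G (line N (0\<^sub>v N) z x)) \<le> graph_max N F p (exp 1)"
            using z x by (intro up) (auto simp: euclid_norm_line_origin)
          then have "exp 1 ^ s * cmod (\<Psi> x) \<le> graph_max N F p (exp 1)"
            by (simp add: \<Psi>(2) norm_mult norm_power x)
          moreover have "exp 1 ^ s = exp (real s)" by (simp flip: exp_of_nat_mult)
          ultimately show "cmod (\<Psi> x) \<le> graph_max N F p (exp 1) / exp s" by (simp add: field_simps)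
        qed auto
        then show "cmod (poly_value p (z @\<^sub>v F z)) \<le> graph_max N F p (exp 1) / exp s"
          using \<Psi>(2)[of 1] z(1) by (simp add: G_def)
      qed simp
      then show ?thesis by (simp add: field_simps)
    qed
    ultimately show ?thesis using deg by (intro bexI[OF _ p] conjI) (simp_all only: s_def)
  qed
  then show thesis by (rule that[OF D(1)])
qed

text \<open>With \<open>L\<close> the integer part of \<open>k / (2 * D)\<close> there is a test
  polynomial of degree exactly \<open>k\<close> that grows by
  \<open>exp ((L + 1)\<^sup>2 - 1)\<close>, and \<open>L + 1\<close> is at least
  \<open>k / (2 * D)\<close>. Such an \<open>L \<ge> 1\<close> exists only from
  \<open>k = 2 * D\<close> on, whence the eventual form.\<close>

lemma exponent_lower_bound:
  assumes gc: "growth_cond (n 0) (f 0) \<mu>" and adm: "admits_Bernstein N m F \<nu>"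
  obtains K where "\<forall>\<^sub>F k in sequentially. real k ^ 2 \<le> K * \<nu> k" "0 \<le> K"
proof -
  obtain D :: nat where D: "1 \<le> D" "\<And>L k :: nat. 1 \<le> L \<Longrightarrow> 2 * L * D \<le> k \<Longrightarrow> \<exists>p\<in>polys (N + m). total_degree p = k \<and>
    0 < graph_max N F p 1 \<and> exp (real ((L + 1)\<^sup>2 - 1)) * graph_max N F p 1 \<le> graph_max N F p (exp 1)"
    using fast_growing_polynomial[OF gc] by blast
  have \<nu>: "0 \<le> \<nu> k" for k using adm by (simp add: admits_Bernstein_def)
  have "(0::real) < 1" by simp
  with adm obtain C where "0 \<le> C" "\<forall>p\<in>polys (N + m). graph_max N F p (exp 1 * 1) \<le> C powr \<nu> (total_degree p) * graph_max N F p 1"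
    unfolding admits_Bernstein_def by blast
  then have C: "0 \<le> C" "\<And>p. p \<in> polys (N + m) \<Longrightarrow> graph_max N F p (exp 1) \<le> C powr \<nu> (total_degree p) * graph_max N F p 1"
    by auto
  have main: "real k ^ 2 \<le> 8 * real D ^ 2 * max 0 (ln C) * \<nu> k" if k: "2 * D \<le> k" for k
  proof -
    define L where "L = k div (2 * D)"
    have L1: "1 \<le> L" using k D(1) by (simp add: L_def div_greater_zero_iff Suc_le_eq)
    have L2: "2 * L * D \<le> k" unfolding L_def using div_times_less_eq_dividend[of k "2 * D"] by (simp add: mult_ac)
    have L3: "k \<le> 2 * D * (L + 1)"
      using dividend_less_times_div[of "2 * D" k] D(1) by (simp add: L_def)
    obtain p where p: "p \<in> polys (N + m)" "total_degree p = k" "0 < graph_max N F p 1"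
      "exp (real ((L + 1)\<^sup>2 - 1)) * graph_max N F p 1 \<le> graph_max N F p (exp 1)" using D(2)[OF L1 L2] by blast
    have "exp (real ((L + 1)\<^sup>2 - 1)) * graph_max N F p 1 \<le> C powr \<nu> k * graph_max N F p 1"
      using p(4) C(2)[OF p(1)] p(2) by simp
    then have le: "exp (real ((L + 1)\<^sup>2 - 1)) \<le> C powr \<nu> k" using p(3) by (rule mult_right_le_imp_le)
    \<comment> \<open>\<open>C = 0\<close> is impossible, because every power
      \<open>0 powr x\<close> is 0 and the left side is positive.\<close>
    then have Cp: "0 < C" using C(1) exp_gt_zero[of "real ((L + 1)\<^sup>2 - 1)"] by (cases "C = 0") auto
    have "exp (real ((L + 1)\<^sup>2 - 1)) \<le> exp (\<nu> k * ln C)" using le Cp by (simp add: powr_def)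
    then have "real ((L + 1)\<^sup>2 - 1) \<le> \<nu> k * ln C" by simp
    also have "\<dots> \<le> \<nu> k * max 0 (ln C)" using \<nu> by (intro mult_left_mono) auto
    finally have 1: "real ((L + 1)\<^sup>2 - 1) \<le> \<nu> k * max 0 (ln C)" .
    have "real ((L + 1)\<^sup>2 - 1) = (real L + 1)\<^sup>2 - 1" by (simp add: of_nat_diff)
    \<comment> \<open>Subtracting 1 thus costs at most half of \<open>(L + 1)\<^sup>2\<close>, which
      doubles the constant from 4 to 8.\<close>
    moreover have "2 \<le> (real L + 1)\<^sup>2" using power_mono[of 2 "real L + 1" 2] L1 by simp
    ultimately have 2: "(real L + 1)\<^sup>2 \<le> 2 * (\<nu> k * max 0 (ln C))" using 1 by linarith
    have "real k \<le> 2 * real D * (real L + 1)" using of_nat_mono[OF L3, where 'a = real] by (simp add: algebra_simps)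
    then have "real k ^ 2 \<le> (2 * real D * (real L + 1)) ^ 2" by (intro power_mono) auto
    also have "\<dots> = 4 * real D ^ 2 * (real L + 1)\<^sup>2" by (simp add: power_mult_distrib)
    also have "\<dots> \<le> 4 * real D ^ 2 * (2 * (\<nu> k * max 0 (ln C)))" using 2 by (intro mult_left_mono) auto
    finally show ?thesis by (simp add: mult_ac)
  qed
  show thesis
  proof (rule that[of "8 * real D ^ 2 * max 0 (ln C)"])
    show "\<forall>\<^sub>F k in sequentially. real k ^ 2 \<le> 8 * real D ^ 2 * max 0 (ln C) * \<nu> k"
      using eventually_ge_at_top[of "2 * D"] by eventually_elim (rule main)
  qed simp
qed

lemma optimal_square:
  assumes gc: "growth_cond (n 0) (f 0) \<mu>" and adm: "admits_Bernstein N m F (\<lambda>k. real k ^ 2)"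
  shows "optimal_exponent N m F (\<lambda>k. real k ^ 2)"
  unfolding optimal_exponent_def
proof (intro conjI adm notI)
  assume "\<exists>\<nu>. admits_Bernstein N m F \<nu> \<and> (\<exists>c>0. \<forall>d. \<nu> d \<le> c * real d ^ 2) \<and>
      limsup (\<lambda>d. ereal (real d ^ 2) / ereal (\<nu> d)) = \<infinity>"
  then obtain \<nu> where \<nu>: "admits_Bernstein N m F \<nu>" "limsup (\<lambda>d. ereal (real d ^ 2) / ereal (\<nu> d)) = \<infinity>" by blast
  obtain K where K: "\<forall>\<^sub>F k in sequentially. real k ^ 2 \<le> K * \<nu> k" "0 \<le> K"
    using exponent_lower_bound[OF gc \<nu>(1)] by blast
  have "\<forall>\<^sub>F k in sequentially. ereal (real k ^ 2) / ereal (\<nu> k) \<le> ereal K"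
    using K(1) eventually_gt_at_top[of 0]
  proof eventually_elim
    case (elim k)
    have "0 \<le> \<nu> k" using \<nu>(1) by (simp add: admits_Bernstein_def)
    \<comment> \<open>Otherwise \<open>k\<^sup>2 \<le> 0\<close> for a positive \<open>k\<close>; so
      the extended quotient is an ordinary one.\<close>
    moreover have "\<nu> k \<noteq> 0" using elim by auto
    ultimately show ?case using elim by (simp add: divide_le_eq)
  qed
  then have "limsup (\<lambda>d. ereal (real d ^ 2) / ereal (\<nu> d)) \<le> ereal K" by (rule Limsup_bounded)
  then show False using \<nu>(2) by simp
qed

end

end

theorem theorem1p7:
  fixes m :: nat
    and n :: "nat \<Rightarrow> nat"
    and f :: "nat \<Rightarrow> cvec \<Rightarrow> complex"
    and P Q :: "cvec \<Rightarrow> cvec"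
  assumes "m \<ge> 1"
    and "\<And>j. j < m \<Longrightarrow> n j \<ge> 1"
    and "\<And>j. j < m \<Longrightarrow> class_C (n j) (f j)"
    and "polynomial_automorphism (\<Sum>j<m. n j) P"
    and "polynomial_automorphism m Q"
  shows "(\<exists>\<epsilon> :: nat \<Rightarrow> real.
            (\<forall>k. 0 \<le> \<epsilon> k) \<and>
            ((\<forall>j<m. growth_order (n j) (f j) < \<infinity>) \<longrightarrow> (\<forall>k. \<epsilon> k = 0)) \<and>
            ((\<exists>j<m. growth_order (n j) (f j) = \<infinity>) \<longrightarrow> decseq \<epsilon> \<and> \<epsilon> \<longlonglongrightarrow> 0) \<and>
            admits_Bernstein (\<Sum>j<m. n j) m (Q \<circ> product_map m n f \<circ> P)
              (\<lambda>k. real k powr (2 + \<epsilon> k))) \<and>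
         ((\<forall>j<m. n j = 1) \<and> (\<forall>j<m. growth_order (n j) (f j) < \<infinity>) \<longrightarrow>
            optimal_exponent (\<Sum>j<m. n j) m (Q \<circ> product_map m n f \<circ> P)
              (\<lambda>k. real k ^ 2))"
proof -
  interpret product_graph m n f P Q "\<Sum>j<m. n j"
  proof (rule product_graph.intro)
    show "class_C (n j) (f j)" if "j < m" for j using that by (rule assms(3))
  qed (rule refl assms(4) assms(5))+
  have "\<forall>j. \<exists>\<epsilon>. j < m \<longrightarrow> (\<forall>k. 0 \<le> \<epsilon> k) \<and> decseq \<epsilon> \<and> \<epsilon> \<longlonglongrightarrow> 0 \<and>
      (growth_order (n j) (f j) < \<infinity> \<longrightarrow> (\<forall>k. \<epsilon> k = 0)) \<and> growth_cond (n j) (f j) (\<lambda>k. real k powr (2 + \<epsilon> k))"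
  proof
    fix j
    show "\<exists>\<epsilon>. j < m \<longrightarrow> (\<forall>k. 0 \<le> \<epsilon> k) \<and> decseq \<epsilon> \<and> \<epsilon> \<longlonglongrightarrow> 0 \<and>
      (growth_order (n j) (f j) < \<infinity> \<longrightarrow> (\<forall>k. \<epsilon> k = 0)) \<and> growth_cond (n j) (f j) (\<lambda>k. real k powr (2 + \<epsilon> k))"
    proof (cases "j < m")
      case True
      from class_C_growth_cond[OF assms(3)[OF True]] show ?thesis by blast
    qed simp
  qed
  from choice[OF this] obtain e where e0: "\<forall>j. j < m \<longrightarrow> (\<forall>k. 0 \<le> e j k) \<and> decseq (e j) \<and> e j \<longlonglongrightarrow> 0 \<and>
      (growth_order (n j) (f j) < \<infinity> \<longrightarrow> (\<forall>k. e j k = 0)) \<and> growth_cond (n j) (f j) (\<lambda>k. real k powr (2 + e j k))" ..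
  have e: "0 \<le> e j k" "decseq (e j)" "e j \<longlonglongrightarrow> 0" "growth_order (n j) (f j) < \<infinity> \<Longrightarrow> e j k = 0"
    "growth_cond (n j) (f j) (\<lambda>k. real k powr (2 + e j k))" if "j < m" for j k
    using e0[rule_format, OF that] by simp_all
  \<comment> \<open>The sum majorises every \<open>e j\<close> and inherits monotonicity and the
    limit 0; it vanishes when all orders are finite.\<close>
  define \<epsilon> where "\<epsilon> = (\<lambda>k. \<Sum>j<m. e j k)"
  have adm: "admits_Bernstein (\<Sum>j<m. n j) m (Q \<circ> product_map m n f \<circ> P) (\<lambda>k. real k powr (2 + \<epsilon> k))"
    unfolding \<epsilon>_def F_def[symmetric] by (rule admits_Bernstein_product) (use e in auto)
  have zero: "\<epsilon> k = 0" if "\<forall>j<m. growth_order (n j) (f j) < \<infinity>" for k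
    unfolding \<epsilon>_def using that e(4) by (intro sum.neutral) auto
  have "decseq \<epsilon>" unfolding \<epsilon>_def decseq_def using decseqD[OF e(2)] by (auto intro!: sum_mono)
  moreover have "\<epsilon> \<longlonglongrightarrow> 0"
  proof -
    have "\<epsilon> \<longlonglongrightarrow> (\<Sum>j<m. 0)" unfolding \<epsilon>_def by (rule tendsto_sum) (use e(3) in auto)
    then show ?thesis by simp
  qed
  moreover have "0 \<le> \<epsilon> k" for k unfolding \<epsilon>_def using e(1) by (intro sum_nonneg) auto
  moreover have "optimal_exponent (\<Sum>j<m. n j) m (Q \<circ> product_map m n f \<circ> P) (\<lambda>k. real k ^ 2)"
    if "\<forall>j<m. n j = 1" "\<forall>j<m. growth_order (n j) (f j) < \<infinity>"
  proof -
    have "admits_Bernstein (\<Sum>j<m. n j) m F (\<lambda>k. real k ^ 2)"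
      using adm zero[OF that(2)] by (simp add: F_def)
    moreover have "0 < m" "n 0 = 1" using assms(1) that(1) by auto
    ultimately show ?thesis
      using optimal_square[OF _ _ e(5)[of 0]] unfolding F_def by blast
  qed
  ultimately show ?thesis using adm zero by blast
qed

end
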